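(* Let $0<s_1\le 1$, $s_2>0$, and consider the vector Gaussian model of the context with two agents ($K=2$). Suppose that at iteration $t$ the test channels are Gaussian: for $k=1,2$, $P^{(t)}_{\mathbf U_k|\mathbf Y_k}$ is given by $\mathbf U_k^t=\mathbf A_k^t\mathbf Y_k+\mathbf Z_k^t$ with $\mathbf Z_k^t\sim\mathcal{CN}(\mathbf 0,\mathbf\Sigma_{\mathbf z_k^t})$. Then the updated conditional law $P^{(t+1)}_{\mathbf U_k|\mathbf Y_k}$ (defined in the context) is also Gaussian: it is that of $\mathbf U_k^{t+1}=\mathbf A_k^{t+1}\mathbf Y_k+\mathbf Z_k^{t+1}$ with $\mathbf Z_k^{t+1}\sim\mathcal{CN}(\mathbf 0,\mathbf\Sigma_{\mathbf z_k^{t+1}})$, where $$\mathbf\Sigma_{\mathbf z_k^{t+1}}=\left(\frac1{s_k}\mathbf\Sigma^{-1}_{\mathbf u_k^t|(\mathbf x,\mathbf y_0)}-\frac{1-s_1}{s_k}\mathbf\Sigma^{-1}_{\mathbf u_k^t|(\mathbf u_{\bar k}^t,\mathbf y_0)}+\frac{s_k-s_1}{s_k}\mathbf\Sigma^{-1}_{\mathbf u_k^t|\mathbf y_0}\right)^{-1},$$ $$\begin{aligned}\mathbf A_k^{t+1}=\ &\mathbf\Sigma_{\mathbf z_k^{t+1}}\left(\frac1{s_k}\mathbf\Sigma^{-1}_{\mathbf u_k^t|(\mathbf x,\mathbf y_0)}\mathbf A_k^t\big(\mathbf I-\mathbf\Sigma_{\mathbf y_k|(\mathbf x,\mathbf y_0)}\mathbf\Sigma_{\mathbf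 y_k}^{-1}\big)\right)\\&-\mathbf\Sigma_{\mathbf z_k^{t+1}}\left(\frac{1-s_1}{s_k}\mathbf\Sigma^{-1}_{\mathbf u_k^t|(\mathbf u_{\bar k}^t,\mathbf y_0)}\mathbf A_k^t\big(\mathbf I-\mathbf\Sigma_{\mathbf y_k|(\mathbf u_{\bar k}^t,\mathbf y_0)}\mathbf\Sigma_{\mathbf y_k}^{-1}\big)-\frac{s_k-s_1}{s_k}\mathbf\Sigma^{-1}_{\mathbf u_k^t|\mathbf y_0}\mathbf A_k^t\big(\mathbf I-\mathbf\Sigma_{\mathbf y_k|\mathbf y_0}\mathbf\Sigma_{\mathbf y_k}^{-1}\big)\right),\end{aligned}$$ with $\bar k=2$ if $k=1$ and $\bar k=1$ if $k=2$.
   Context: Model. $(\mathbf X,\mathbf Y_0,\mathbf Y_1,\mathbf Y_2)$ is a zero-mean jointly Gaussian complex-valued random vector. $\mathbf X\in\mathbb C^{n_x}$ has covariance $\mathbf\Sigma_{\mathbf x}\succeq\mathbf 0$; for $k=0,1,2$, $\mathbf Y_k=\mathbf H_k\mathbf X+\mathbf N_k$ with $\mathbf H_k\in\mathbb C^{n_k\times n_x}$ fixed and $\mathbf N_k\in\mathbb C^{n_k}$ zero-mean Gaussian noise independent of $\mathbf X$; $\mathbf N_0$ has covariance $\mathbf\Sigma_0\succeq\mathbf 0$, and $\mathbf N_1,\mathbf N_2$ are conditionally independent given $\mathbf N_0$. The test-channel noises $\mathbf Z_1^t,\mathbf Z_2^t$ are independent of each other and of $(\mathbf X,\mathbf Y_0,\mathbf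 Y_1,\mathbf Y_2)$, with covariances $\mathbf\Sigma_{\mathbf z_k^t}\succeq\mathbf 0$. $\mathcal{CN}(\boldsymbol\mu,\mathbf\Sigma)$ denotes the complex Gaussian law with mean $\boldsymbol\mu$ and covariance $\mathbf\Sigma$; $\mathbf\Sigma_{\mathbf a}$ is the covariance of a vector $\mathbf a$, $\mathbf\Sigma_{\mathbf a,\mathbf b}$ the cross-correlation of $\mathbf a$ and $\mathbf b$, and $\mathbf\Sigma_{\mathbf a|\mathbf b}=\mathbf\Sigma_{\mathbf a}-\mathbf\Sigma_{\mathbf a,\mathbf b}\mathbf\Sigma_{\mathbf b}^{-1}\mathbf\Sigma_{\mathbf b,\mathbf a}$ the conditional covariance, all computed under the joint law of $(\mathbf X,\mathbf Y_0,\mathbf Y_1,\mathbf Y_2,\mathbf U_1^t,\mathbf U_2^t)$. Update. Let $Q$ denote the laws induced by the test channels $P^{(t)}_{\mathbf U_1|\mathbf Y_1},P^{(t)}_{\mathbf U_2|\mathbf Y_2}$: $Q_{\mathbf U_k}$, $Q_{\mathbf X|\mathbf U_k,\mathbf Y_0}$, $Q_{\mathbf Y_0|\mathbf U_k}$, $Q_{\mathbf X|\mathbf U_1,\mathbf U_2,\mathbf Y_0}$ are the corresponding marginal and conditional laws of $(\mathbf X,\mathbf Y_0,\mathbf U_1^t,\mathbf U_2^t)$, with density $q(\mathbf u_k)$ for $Q_{\mathbf U_k}$. The updated conditional density is $$p^{(t+1)}(\mathbf u_k|\mathbf y_k)=\frac{q(\mathbf u_k)\exp[-\psi_k(\mathbf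 u_k,\mathbf y_k)]}{\int q(\mathbf u)\exp[-\psi_k(\mathbf u,\mathbf y_k)]\,d\mathbf u},\qquad k=1,2,$$ where $$\psi_k(\mathbf u_k,\mathbf y_k)=\tfrac{1-s_1}{s_k}\mathbb E_{\mathbf U_{\bar k},\mathbf Y_0|\mathbf y_k}D_{\mathrm{KL}}(P_{\mathbf X|\mathbf y_k,\mathbf U_{\bar k},\mathbf Y_0}\|Q_{\mathbf X|\mathbf u_k,\mathbf U_{\bar k},\mathbf Y_0})+\tfrac{s_1}{s_k}\mathbb E_{\mathbf Y_0|\mathbf y_k}D_{\mathrm{KL}}(P_{\mathbf X|\mathbf y_k,\mathbf Y_0}\|Q_{\mathbf X|\mathbf u_k,\mathbf Y_0})+D_{\mathrm{KL}}(P_{\mathbf Y_0|\mathbf y_k}\|Q_{\mathbf Y_0|\mathbf u_k}),$$ with $P$ the joint law at iteration $t$ (i.e. with $\mathbf U_{\bar k}=\mathbf U_{\bar k}^t$). Logarithms are natural. *)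

theory Defs
  imports "HOL-Probability.Probability"
begin

section \<open>Complex matrices and stacked vectors\<close>

definition conj_transpose :: "complex^'n^'m \<Rightarrow> complex^'m^'n" where
  "conj_transpose A = (\<chi> i j. cnj (A $ j $ i))"

definition stack :: "complex^'a \<Rightarrow> complex^'b \<Rightarrow> complex^('a + 'b)" where
  "stack a b = (\<chi> i. case i of Inl k \<Rightarrow> a $ k | Inr l \<Rightarrow> b $ l)"

definition stack_rv :: "('w \<Rightarrow> complex^'a) \<Rightarrow> ('w \<Rightarrow> complex^'b) \<Rightarrow> 'w \<Rightarrow> complex^('a + 'b)"
    (infixr \<open>\<bowtie>\<close> 65) where
  "(A \<bowtie> B) = (\<lambda>\<omega>. stack (A \<omega>) (B \<omega>))"


section \<open>Covariances\<close>

definition cross_cov ::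
    "'w measure \<Rightarrow> ('w \<Rightarrow> complex^'a) \<Rightarrow> ('w \<Rightarrow> complex^'b) \<Rightarrow> complex^'b^'a" where
  "cross_cov M A B = (\<chi> i j.
     \<integral>\<omega>. (A \<omega> $ i - (\<integral>\<omega>'. A \<omega>' $ i \<partial>M)) * cnj (B \<omega> $ j - (\<integral>\<omega>'. B \<omega>' $ j \<partial>M)) \<partial>M)"

definition covm :: "'w measure \<Rightarrow> ('w \<Rightarrow> complex^'a) \<Rightarrow> complex^'a^'a" where
  "covm M A = cross_cov M A A"

definition cond_cov ::
    "'w measure \<Rightarrow> ('w \<Rightarrow> complex^'a) \<Rightarrow> ('w \<Rightarrow> complex^'b) \<Rightarrow> complex^'a^'a" where
  "cond_cov M A B = covm M A - cross_cov M A B ** matrix_inv (covm M B) ** cross_cov M B A"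


section \<open>Complex Gaussian laws\<close>

text \<open>
  The law of a vector with independent circularly symmetric entries of variance 1; the Lebesgue
  measure on \<open>complex^'n\<close> is that of real dimension \<open>2 * CARD('n)\<close>.
\<close>
definition std_complex_gaussian :: "(complex^'n) measure" where
  "std_complex_gaussian = density lborel (\<lambda>w. ennreal (\<Prod>i\<in>UNIV. exp (- (cmod (w $ i))\<^sup>2) / pi))"

text \<open>
  \<open>N\<close> is the (circularly symmetric) law with mean \<open>\<mu>\<close> and covariance \<open>\<Sigma>\<close>: the law of
  \<open>\<mu> + L W\<close> with \<open>W\<close> standard and \<open>L L\<^sup>H = \<Sigma>\<close>. Singular positive semidefinite \<open>\<Sigma>\<close> are allowed;
  a \<open>\<Sigma>\<close> that is not positive semidefinite has no such \<open>L\<close>.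
\<close>
definition complex_gaussian :: "(complex^'n) measure \<Rightarrow> complex^'n \<Rightarrow> complex^'n^'n \<Rightarrow> bool" where
  "complex_gaussian N \<mu> \<Sigma> \<longleftrightarrow>
     (\<exists>L :: complex^'n^'n. L ** conj_transpose L = \<Sigma> \<and>
        N = distr std_complex_gaussian borel (\<lambda>w. \<mu> + L *v w))"


section \<open>Independence and conditional laws\<close>

text \<open>The library's \<open>indep_var\<close> requires both variables to have the same codomain.\<close>
definition indep_rv ::
    "'w measure \<Rightarrow> ('w \<Rightarrow> 'a::topological_space) \<Rightarrow> ('w \<Rightarrow> 'b::topological_space) \<Rightarrow> bool" where
  "indep_rv M A B \<longleftrightarrow>
     prob_space.indep_set M (sets (vimage_algebra (space M) A borel))
                            (sets (vimage_algebra (space M) B borel))"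

definition cond_indep_rv ::
    "'w measure \<Rightarrow> ('w \<Rightarrow> 'a::topological_space) \<Rightarrow> ('w \<Rightarrow> 'b::topological_space)
       \<Rightarrow> ('w \<Rightarrow> 'c::topological_space) \<Rightarrow> bool" where
  "cond_indep_rv M A B C \<longleftrightarrow>
     (let P = (\<lambda>E. real_cond_exp M (vimage_algebra (space M) C borel) (indicator E))
      in \<forall>S\<in>sets borel. \<forall>T\<in>sets borel. AE \<omega> in M.
           P (A -` S \<inter> B -` T \<inter> space M) \<omega> = P (A -` S \<inter> space M) \<omega> * P (B -` T \<inter> space M) \<omega>)"

definition is_cond_law ::
    "'w measure \<Rightarrow> ('w \<Rightarrow> 'a::topological_space) \<Rightarrow> ('w \<Rightarrow> 'b::topological_space)
       \<Rightarrow> ('b \<Rightarrow> 'a measure) \<Rightarrow> bool" where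
  "is_cond_law M A B \<kappa> \<longleftrightarrow>
     \<kappa> \<in> borel \<rightarrow>\<^sub>M prob_algebra borel \<and>
     (\<forall>S\<in>sets borel. \<forall>T\<in>sets borel.
        emeasure M {\<omega> \<in> space M. A \<omega> \<in> S \<and> B \<omega> \<in> T} =
        (\<integral>\<^sup>+ b. emeasure (\<kappa> b) S * indicator T b \<partial>distr M borel B))"

text \<open>
  A version of the law of \<open>A\<close> given \<open>B = b\<close>; on standard Borel spaces any two versions agree for
  almost every \<open>b\<close> under the law of \<open>B\<close>.
\<close>
definition cond_law ::
    "'w measure \<Rightarrow> ('w \<Rightarrow> 'a::topological_space) \<Rightarrow> ('w \<Rightarrow> 'b::topological_space)
       \<Rightarrow> 'b \<Rightarrow> 'a measure" where
  "cond_law M A B = (SOME \<kappa>. is_cond_law M A B \<kappa>)"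


section \<open>Relative entropy\<close>

text \<open>
  \<open>kl P Q\<close> is the divergence of \<open>P\<close> from \<open>Q\<close> in nats. The library's \<open>KL_divergence\<close> is
  real-valued, takes its measure arguments in the opposite order, and is only meaningful in the
  first case; the negative part of \<open>ln (dP/dQ)\<close> is always \<open>P\<close>-integrable, so the divergence is
  infinite in the second.
\<close>
definition kl :: "'a measure \<Rightarrow> 'a measure \<Rightarrow> ennreal" where
  "kl P Q = (if absolutely_continuous Q P \<and> integrable P (entropy_density (exp 1) Q P)
             then ennreal (KL_divergence (exp 1) Q P) else \<infinity>)"

definition exp_neg :: "ennreal \<Rightarrow> ennreal" where
  "exp_neg t = (if t = \<infinity> then 0 else ennreal (exp (- enn2real t)))"


section \<open>The update\<close>

text \<open>
  In what follows \<open>Y\<close>, \<open>U\<close> belong to the agent that is updated, \<open>V\<close> is the auxiliary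
  variable of the other agent, and \<open>s\<close> is the weight of the updated agent.
\<close>

text \<open>The expectation over \<open>W\<close> given \<open>Y = y\<close> of the divergence of the law of \<open>X\<close> given \<open>(y, W)\<close>
  from the law of \<open>X\<close> given \<open>(u, W)\<close>.\<close>
definition expected_kl ::
    "'w measure \<Rightarrow> ('w \<Rightarrow> 'x::topological_space) \<Rightarrow> ('w \<Rightarrow> 'c::topological_space)
       \<Rightarrow> ('w \<Rightarrow> 'y::topological_space) \<Rightarrow> ('w \<Rightarrow> 'u::topological_space) \<Rightarrow> 'u \<Rightarrow> 'y \<Rightarrow> ennreal" where
  "expected_kl M X W Y U u y =
     (\<integral>\<^sup>+ w. kl (cond_law M X (\<lambda>\<omega>. (Y \<omega>, W \<omega>)) (y, w))
               (cond_law M X (\<lambda>\<omega>. (U \<omega>, W \<omega>)) (u, w)) \<partial>cond_law M W Y y)"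

definition psi ::
    "'w measure \<Rightarrow> ('w \<Rightarrow> complex^'x) \<Rightarrow> ('w \<Rightarrow> complex^'y0) \<Rightarrow> ('w \<Rightarrow> complex^'y)
       \<Rightarrow> ('w \<Rightarrow> complex^'u) \<Rightarrow> ('w \<Rightarrow> complex^'v) \<Rightarrow> real \<Rightarrow> real
       \<Rightarrow> complex^'u \<Rightarrow> complex^'y \<Rightarrow> ennreal" where
  "psi M X Y0 Y U V s1 s u y =
     ennreal ((1 - s1) / s) * expected_kl M X (\<lambda>\<omega>. (V \<omega>, Y0 \<omega>)) Y U u y
     + ennreal (s1 / s) * expected_kl M X Y0 Y U u y
     + kl (cond_law M Y0 Y y) (cond_law M Y0 U u)"

definition upd_weight ::
    "'w measure \<Rightarrow> ('w \<Rightarrow> complex^'x) \<Rightarrow> ('w \<Rightarrow> complex^'y0) \<Rightarrow> ('w \<Rightarrow> complex^'y)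
       \<Rightarrow> ('w \<Rightarrow> complex^'u) \<Rightarrow> ('w \<Rightarrow> complex^'v) \<Rightarrow> real \<Rightarrow> real
       \<Rightarrow> complex^'u \<Rightarrow> complex^'y \<Rightarrow> ennreal" where
  "upd_weight M X Y0 Y U V s1 s u y =
     RN_deriv lborel (distr M borel U) u * exp_neg (psi M X Y0 Y U V s1 s u y)"

definition upd_normalizer ::
    "'w measure \<Rightarrow> ('w \<Rightarrow> complex^'x) \<Rightarrow> ('w \<Rightarrow> complex^'y0) \<Rightarrow> ('w \<Rightarrow> complex^'y)
       \<Rightarrow> ('w \<Rightarrow> complex^'u) \<Rightarrow> ('w \<Rightarrow> complex^'v) \<Rightarrow> real \<Rightarrow> real
       \<Rightarrow> complex^'y \<Rightarrow> ennreal" where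
  "upd_normalizer M X Y0 Y U V s1 s y = (\<integral>\<^sup>+ u. upd_weight M X Y0 Y U V s1 s u y \<partial>lborel)"

text \<open>The updated conditional law of the auxiliary variable given \<open>Y = y\<close>.\<close>
definition upd_law ::
    "'w measure \<Rightarrow> ('w \<Rightarrow> complex^'x) \<Rightarrow> ('w \<Rightarrow> complex^'y0) \<Rightarrow> ('w \<Rightarrow> complex^'y)
       \<Rightarrow> ('w \<Rightarrow> complex^'u) \<Rightarrow> ('w \<Rightarrow> complex^'v) \<Rightarrow> real \<Rightarrow> real
       \<Rightarrow> complex^'y \<Rightarrow> (complex^'u) measure" where
  "upd_law M X Y0 Y U V s1 s y =
     density lborel
       (\<lambda>u. upd_weight M X Y0 Y U V s1 s u y / upd_normalizer M X Y0 Y U V s1 s y)"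


section \<open>The updated parameters\<close>

definition next_precision ::
    "'w measure \<Rightarrow> ('w \<Rightarrow> complex^'x) \<Rightarrow> ('w \<Rightarrow> complex^'y0) \<Rightarrow> ('w \<Rightarrow> complex^'u)
       \<Rightarrow> ('w \<Rightarrow> complex^'v) \<Rightarrow> real \<Rightarrow> real \<Rightarrow> complex^'u^'u" where
  "next_precision M X Y0 U V s1 s =
     (1 / s) *\<^sub>R matrix_inv (cond_cov M U (X \<bowtie> Y0))
     - ((1 - s1) / s) *\<^sub>R matrix_inv (cond_cov M U (V \<bowtie> Y0))
     + ((s - s1) / s) *\<^sub>R matrix_inv (cond_cov M U Y0)"

definition next_noise_cov ::
    "'w measure \<Rightarrow> ('w \<Rightarrow> complex^'x) \<Rightarrow> ('w \<Rightarrow> complex^'y0) \<Rightarrow> ('w \<Rightarrow> complex^'u)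
       \<Rightarrow> ('w \<Rightarrow> complex^'v) \<Rightarrow> real \<Rightarrow> real \<Rightarrow> complex^'u^'u" where
  "next_noise_cov M X Y0 U V s1 s = matrix_inv (next_precision M X Y0 U V s1 s)"

definition next_gain ::
    "'w measure \<Rightarrow> ('w \<Rightarrow> complex^'x) \<Rightarrow> ('w \<Rightarrow> complex^'y0) \<Rightarrow> ('w \<Rightarrow> complex^'y)
       \<Rightarrow> ('w \<Rightarrow> complex^'u) \<Rightarrow> ('w \<Rightarrow> complex^'v) \<Rightarrow> complex^'y^'u \<Rightarrow> real \<Rightarrow> real
       \<Rightarrow> complex^'y^'u" where
  "next_gain M X Y0 Y U V A s1 s =
     next_noise_cov M X Y0 U V s1 s **
       ((1 / s) *\<^sub>R (matrix_inv (cond_cov M U (X \<bowtie> Y0)) ** A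
          ** (mat 1 - cond_cov M Y (X \<bowtie> Y0) ** matrix_inv (covm M Y))))
     - next_noise_cov M X Y0 U V s1 s **
       (((1 - s1) / s) *\<^sub>R (matrix_inv (cond_cov M U (V \<bowtie> Y0)) ** A
          ** (mat 1 - cond_cov M Y (V \<bowtie> Y0) ** matrix_inv (covm M Y)))
        - ((s - s1) / s) *\<^sub>R (matrix_inv (cond_cov M U Y0) ** A
          ** (mat 1 - cond_cov M Y Y0 ** matrix_inv (covm M Y))))"

text \<open>
  The updated conditional law is defined, and is that of \<open>A' Y + Z'\<close> with \<open>Z'\<close> independent of \<open>Y\<close>,
  zero-mean Gaussian, where \<open>A'\<close> and the covariance of \<open>Z'\<close> are the updated parameters. Conditional
  laws being determined only almost everywhere, so is this identity.

  The theorem assumes that \<open>(X, Y0, Y)\<close> and \<open>(X, Y0, U)\<close> have nonsingular covariance for both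
  agents. For \<open>s1 > 0\<close> this holds exactly when every matrix inverted in the formulas (including
  those in conditional covariances) is invertible and the normalizer does not vanish: if
  \<open>(X, Y0, Y)\<close> is singular while those inverses exist, then \<open>psi\<close> is identically infinite and the
  update is 0/0.
\<close>
definition gaussian_update ::
    "'w measure \<Rightarrow> ('w \<Rightarrow> complex^'x) \<Rightarrow> ('w \<Rightarrow> complex^'y0) \<Rightarrow> ('w \<Rightarrow> complex^'y)
       \<Rightarrow> ('w \<Rightarrow> complex^'u) \<Rightarrow> ('w \<Rightarrow> complex^'v) \<Rightarrow> complex^'y^'u \<Rightarrow> real \<Rightarrow> real \<Rightarrow> bool" where
  "gaussian_update M X Y0 Y U V A s1 s \<longleftrightarrow>
     invertible (next_precision M X Y0 U V s1 s) \<and>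
     (\<exists>Z'. complex_gaussian Z' 0 (next_noise_cov M X Y0 U V s1 s) \<and>
       (AE y in distr M borel Y.
          0 < upd_normalizer M X Y0 Y U V s1 s y \<and>
          upd_normalizer M X Y0 Y U V s1 s y < \<infinity> \<and>
          upd_law M X Y0 Y U V s1 s y
            = distr Z' borel (\<lambda>z. next_gain M X Y0 Y U V A s1 s *v y + z)))"

end

(*
  Every vector of the model is the image of one standard Gaussian vector under a linear map, so
  conditioning becomes orthogonal projection in the source space. Since psi only involves
  logarithms of Gaussian densities, Bayes' rule turns the divergences of the laws of X into
  differences of quadratic forms in u whose matrices are the inverse conditional covariances of U;
  taking the expectation of such a form given Y = y only moves its centre, up to a constant.
  Hence -ln (q(u) exp (- psi(u, y))) is a quadratic polynomial in u, with leading part the updated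
  precision, and completing the square yields the updated gain. That precision is positive definite
  because conditioning on more variables increases the precision of U. The conditional independence
  of N1 and N2 given N0 enters by making the other agent's variable useless for predicting U
  from (X, Y0).
*)
theory Submission
  imports Defs
begin

text \<open>Although the vectors are complex, the source is a real Euclidean space: densities refer
  to real Lebesgue measure, and products of sources model independent noises. The complex structure
  returns only when projections are compared with the covariance matrices of the formulas. The full
  joint law may be singular, so each step asks for surjectivity of just the blocks that it
  conditions on. Conditional laws and the density of U are arbitrary versions; hence all identities
  hold almost everywhere, and the positivity of Gaussian densities turns every exceptional set into
  a Lebesgue null set. No determinant is evaluated: factors independent of u cancel in the quotient
  that defines the update. The coefficients are bookkeeping. Let J1, J2, J3 be the forms of the
  residuals of U given (X, Y0), (V, Y0) and Y0. The terms of psi contribute (1 - s1)/s (J1 - J2),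
  s1/s (J1 - J3), and J3 minus the form of U itself; q(u) restores the latter. The sum has
  coefficients 1/s, -(1 - s1)/s and 1 - s1/s.\<close>

abbreviation pair_map :: "('e \<Rightarrow> 'a) \<Rightarrow> ('e \<Rightarrow> 'b) \<Rightarrow> 'e \<Rightarrow> 'a \<times> 'b" (infixr \<open>\<star>\<close> 65) where
  "f \<star> g \<equiv> \<lambda>e. (f e, g e)"

section \<open>Regression by orthogonal projection\<close>

text \<open>
  A linear map stands for the random vector that it makes of a standard Gaussian source, so inner
  products of adjoints are covariances. For surjective maps, \<open>pinv \<phi> a\<close> is the preimage of \<open>a\<close> of
  least norm, \<open>resid \<phi> \<psi>\<close> is the residual of the regression of \<open>\<phi>\<close> on \<open>\<psi>\<close>, and \<open>qform \<phi>\<close> is the quadratic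
  form of the inverse covariance of \<open>\<phi>\<close>; for other maps these are junk values.
\<close>
definition pinv :: "('e::euclidean_space \<Rightarrow> 'a::euclidean_space) \<Rightarrow> 'a \<Rightarrow> 'e" where
  "pinv \<phi> a = adjoint \<phi> (inv (\<lambda>b. \<phi> (adjoint \<phi> b)) a)"

text \<open>For surjective \<open>\<phi>\<close>, the orthogonal projection onto the complement of
  the kernel, that is, the conditional expectation of the source given the value of
  \<open>\<phi>\<close>.\<close>

definition prj :: "('e::euclidean_space \<Rightarrow> 'a::euclidean_space) \<Rightarrow> 'e \<Rightarrow> 'e" where
  "prj \<phi> e = pinv \<phi> (\<phi> e)"

definition resid :: "('e::euclidean_space \<Rightarrow> 'a::euclidean_space) \<Rightarrow> ('e \<Rightarrow> 'b::euclidean_space) \<Rightarrow> 'e \<Rightarrow> 'a" where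
  "resid \<phi> \<psi> e = \<phi> (e - prj \<psi> e)"

definition qform :: "('e::euclidean_space \<Rightarrow> 'a::euclidean_space) \<Rightarrow> 'a \<Rightarrow> real" where
  "qform \<phi> a = (norm (pinv \<phi> a))\<^sup>2"

text \<open>Surjectivity is nonsingularity of the covariance, the condition under which the vector
  has a density.\<close>

definition lsurj :: "('e::euclidean_space \<Rightarrow> 'a::euclidean_space) \<Rightarrow> bool" where
  "lsurj \<phi> \<longleftrightarrow> linear \<phi> \<and> surj \<phi>"

lemma lsurj_linear: "lsurj \<phi> \<Longrightarrow> linear \<phi>"
  and lsurjE: "lsurj \<phi> \<Longrightarrow> \<exists>e. \<phi> e = a"
  by (simp add: lsurj_def) (metis lsurj_def surjD)

lemma linear_pair:
  "linear \<phi> \<Longrightarrow> linear \<psi> \<Longrightarrow> linear (\<phi> \<star> \<psi>)"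
  by (simp add: linear_iff)

lemma lsurj_pairD:
  assumes "lsurj (\<phi> \<star> \<psi>)"
  shows "lsurj \<phi>" "lsurj \<psi>"
  using assms unfolding lsurj_def linear_iff surj_def by (auto; metis fst_conv snd_conv)+

lemma lsurj_comp:
  assumes "lsurj \<phi>" "lsurj \<theta>" shows "lsurj (\<lambda>e. \<theta> (\<phi> e))"
  using assms unfolding lsurj_def linear_iff surj_def by auto metis

text \<open>If \<open>\<phi> (adjoint \<phi> b) = 0\<close>, then \<open>adjoint \<phi> b\<close>
  has norm 0; writing \<open>b\<close> as a value of \<open>\<phi>\<close> gives
  \<open>b \<bullet> b = 0\<close>.\<close>

lemma bij_cov:
  assumes "lsurj \<phi>"
  shows "linear (\<lambda>b. \<phi> (adjoint \<phi> b))" "bij (\<lambda>b. \<phi> (adjoint \<phi> b))"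
proof -
  have l: "linear \<phi>" using assms by (rule lsurj_linear)
  show lin: "linear (\<lambda>b. \<phi> (adjoint \<phi> b))"
    using linear_compose[OF adjoint_linear[OF l] l] by (simp add: o_def)
  have "inj (\<lambda>b. \<phi> (adjoint \<phi> b))"
  proof (subst linear_injective_0[OF lin], intro allI impI)
    fix b assume b: "\<phi> (adjoint \<phi> b) = 0"
    have "adjoint \<phi> b \<bullet> adjoint \<phi> b = 0" using adjoint_works[OF l, of "adjoint \<phi> b" b] b
      by simp
    then have z: "adjoint \<phi> b = 0" by simp
    obtain e where e: "\<phi> e = b" using lsurjE[OF assms] by blast
    have "b \<bullet> b = 0" using adjoint_works[OF l, of e b] z e by simp
    then show "b = 0" by simp
  qed
  then show "bij (\<lambda>b. \<phi> (adjoint \<phi> b))"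
    using linear_injective_imp_surjective[OF lin] by (simp add: bij_def)
qed

lemma pinv_right: "lsurj \<phi> \<Longrightarrow> \<phi> (pinv \<phi> a) = a"
  unfolding pinv_def using bij_cov(2)[of \<phi>] by (metis bij_is_surj surj_f_inv_f)

lemma linear_inv_bij: "linear f \<Longrightarrow> bij f \<Longrightarrow> linear (inv f)"
  for f :: "'a::real_vector \<Rightarrow> 'b::real_vector"
  unfolding linear_iff by (metis bij_inv_eq_iff)

lemma pinv_linear: assumes "lsurj \<phi>" shows "linear (pinv \<phi>)"
proof -
  have "linear (inv (\<lambda>b. \<phi> (adjoint \<phi> b)))" by (rule linear_inv_bij[OF bij_cov[OF assms]])
  from linear_compose[OF this adjoint_linear[OF lsurj_linear[OF assms]]]
  show ?thesis unfolding pinv_def by (simp add: o_def)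
qed

lemma pinv_ortho: "lsurj \<phi> \<Longrightarrow> \<phi> k = 0 \<Longrightarrow> pinv \<phi> a \<bullet> k = 0"
  unfolding pinv_def using adjoint_works[OF lsurj_linear, of \<phi> k]
  by (metis inner_commute inner_zero_left)

text \<open>Two preimages differ by a kernel vector, to which both are orthogonal. This
  characterization replaces the inverse covariance in all later computations of
  \<open>pinv\<close>.\<close>

lemma pinv_eqI:
  assumes "lsurj \<phi>" "\<phi> e = a" "\<And>k. \<phi> k = 0 \<Longrightarrow> e \<bullet> k = 0"
  shows "pinv \<phi> a = e"
proof -
  let ?d = "e - pinv \<phi> a"
  have "\<phi> ?d = 0" using assms(2) pinv_right[OF assms(1)] by (simp add: linear_diff[OF lsurj_linear[OF assms(1)]])
  then have "e \<bullet> ?d = 0" "pinv \<phi> a \<bullet> ?d = 0" using assms(3) pinv_ortho[OF assms(1)] by auto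
  then have "?d \<bullet> ?d = 0" by (simp add: inner_diff_left)
  then show ?thesis by simp
qed

lemma prj_right: "lsurj \<phi> \<Longrightarrow> \<phi> (prj \<phi> e) = \<phi> e"
  by (simp add: prj_def pinv_right)

lemma prj_linear: "lsurj \<phi> \<Longrightarrow> linear (prj \<phi>)"
  unfolding prj_def using linear_compose[OF lsurj_linear pinv_linear, of \<phi> \<phi>] by (simp add: o_def)

lemma prj_diff0: "lsurj \<phi> \<Longrightarrow> \<phi> (e - prj \<phi> e) = 0"
  by (simp add: linear_diff[OF lsurj_linear] prj_right)

lemma pinv_ortho_diff: "lsurj \<phi> \<Longrightarrow> pinv \<phi> a \<bullet> (e - prj \<phi> e) = 0"
  by (simp add: prj_diff0 pinv_ortho)

lemma prj_selfadj: assumes "lsurj \<phi>" shows "prj \<phi> e \<bullet> f = e \<bullet> prj \<phi> f"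
proof -
  have "prj \<phi> e \<bullet> (f - prj \<phi> f) = 0" "prj \<phi> f \<bullet> (e - prj \<phi> e) = 0"
    unfolding prj_def[of \<phi> e] prj_def[of \<phi> f]
    using pinv_ortho_diff[OF assms] by (auto simp: prj_def)
  then show ?thesis by (simp add: inner_diff_right inner_commute)
qed

lemma pinv_comp_bij:
  assumes "lsurj \<phi>" "linear \<theta>" "bij \<theta>"
  shows "pinv (\<lambda>e. \<theta> (\<phi> e)) (\<theta> a) = pinv \<phi> a" "lsurj (\<lambda>e. \<theta> (\<phi> e))"
proof -
  show s: "lsurj (\<lambda>e. \<theta> (\<phi> e))" using lsurj_comp[OF assms(1), of \<theta>] assms(2,3) by (simp add: lsurj_def bij_def)
  have "\<theta> x = 0 \<Longrightarrow> x = 0" for x using assms(2,3) by (metis bij_def linear_injective_0)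
  then show "pinv (\<lambda>e. \<theta> (\<phi> e)) (\<theta> a) = pinv \<phi> a"
    by (intro pinv_eqI[OF s]) (auto simp: pinv_right[OF assms(1)] pinv_ortho[OF assms(1)])
qed

lemma qform_le: assumes "lsurj \<phi>" "\<phi> e = a" shows "qform \<phi> a \<le> (norm e)\<^sup>2"
proof -
  have "pinv \<phi> a \<bullet> (e - pinv \<phi> a) = 0"
    using pinv_ortho_diff[OF assms(1), of a e] assms(2) by (simp add: prj_def)
  then have "(norm e)\<^sup>2 = (norm (pinv \<phi> a))\<^sup>2 + (norm (e - pinv \<phi> a))\<^sup>2"
    by (simp add: power2_norm_eq_inner inner_diff_left inner_diff_right inner_commute)
  then show ?thesis by (simp add: qform_def)
qed

lemma qform_pos: assumes "lsurj \<phi>" "a \<noteq> 0" shows "0 < qform \<phi> a"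
proof -
  have "pinv \<phi> a \<noteq> 0" using pinv_right[OF assms(1), of a] assms(2) linear_0[OF lsurj_linear[OF assms(1)]] by metis
  then show ?thesis by (simp add: qform_def)
qed

lemma qform_comp_bij:
  assumes "lsurj \<phi>" "linear \<theta>" "bij \<theta>"
  shows "qform (\<lambda>e. \<theta> (\<phi> e)) (\<theta> a) = qform \<phi> a"
  by (simp add: qform_def pinv_comp_bij[OF assms])

text \<open>Only the kernel matters: invertible changes of the conditioning vector, such as
  permuting or stacking its blocks or subtracting a function of X from Y0, leave the prediction
  unchanged.\<close>

lemma prj_cong_kernel:
  assumes "lsurj \<phi>" "lsurj \<psi>" "\<And>k. \<psi> k = 0 \<longleftrightarrow> \<phi> k = 0"
  shows "prj \<phi> e = prj \<psi> e"
  unfolding prj_def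
proof (rule pinv_eqI[OF assms(1)])
  show "\<phi> (pinv \<psi> (\<psi> e)) = \<phi> e"
    using prj_diff0[OF assms(2), of e] assms(3) by (auto simp: linear_diff[OF lsurj_linear[OF assms(1)]] prj_def)
  show "pinv \<psi> (\<psi> e) \<bullet> k = 0" if "\<phi> k = 0" for k using pinv_ortho[OF assms(2)] assms(3) that by auto
qed

lemma resid_linear: assumes "linear \<phi>" "lsurj \<psi>" shows "linear (resid \<phi> \<psi>)"
  using linear_compose[OF linear_compose_sub[OF linear_ident prj_linear[OF assms(2)]] assms(1)]
  unfolding resid_def o_def by simp

lemma resid_lsurj:
  assumes "lsurj (\<phi> \<star> \<psi>)"
  shows "lsurj (resid \<phi> \<psi>)"
proof -
  note s = lsurj_pairD[OF assms]
  have "\<exists>e. resid \<phi> \<psi> e = a" for a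
  proof -
    obtain e where "(\<phi> e, \<psi> e) = (a, 0)" using lsurjE[OF assms] by metis
    then show ?thesis by (intro exI[of _ e]) (auto simp: resid_def prj_def linear_0[OF pinv_linear[OF s(2)]])
  qed
  then show ?thesis using resid_linear[OF lsurj_linear[OF s(1)] s(2)] unfolding lsurj_def surj_def by metis
qed

text \<open>The residual annihilates the range of \<open>prj \<psi>\<close>, so its least-norm
  preimages are orthogonal to that range. They therefore lie in the kernel of \<open>\<psi>\<close>,
  where the residual coincides with \<open>\<phi>\<close>.\<close>

lemma prj_pinv_resid:
  assumes "lsurj (\<phi> \<star> \<psi>)"
  shows "prj \<psi> (pinv (resid \<phi> \<psi>) r) = 0" and "\<psi> (pinv (resid \<phi> \<psi>) r) = 0"
    and "\<phi> (pinv (resid \<phi> \<psi>) r) = r"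
proof -
  note s = lsurj_pairD[OF assms]
  have "pinv (resid \<phi> \<psi>) r \<bullet> prj \<psi> f = 0" for f
    by (rule pinv_ortho[OF resid_lsurj[OF assms]])
      (simp add: resid_def prj_def pinv_right[OF s(2)] linear_0[OF lsurj_linear[OF s(1)]])
  then have "prj \<psi> (pinv (resid \<phi> \<psi>) r) \<bullet> f = 0" for f by (simp add: prj_selfadj[OF s(2)])
  then show z: "prj \<psi> (pinv (resid \<phi> \<psi>) r) = 0" by (metis inner_eq_zero_iff)
  show "\<psi> (pinv (resid \<phi> \<psi>) r) = 0"
    using prj_right[OF s(2), of "pinv (resid \<phi> \<psi>) r"] z linear_0[OF lsurj_linear[OF s(2)]] by simp
  show "\<phi> (pinv (resid \<phi> \<psi>) r) = r"
    using pinv_right[OF resid_lsurj[OF assms], of r] z by (simp add: resid_def)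
qed

text \<open>Innovation form: reach \<open>b\<close> first, then correct the first coordinate by a
  vector that \<open>\<psi>\<close> does not see.\<close>

lemma pinv_pair:
  assumes "lsurj (\<phi> \<star> \<psi>)"
  shows "pinv (\<phi> \<star> \<psi>) (a, b) = pinv (resid \<phi> \<psi>) (a - \<phi> (pinv \<psi> b)) + pinv \<psi> b"
proof (rule pinv_eqI[OF assms])
  note s = lsurj_pairD[OF assms]
  let ?r = "pinv (resid \<phi> \<psi>) (a - \<phi> (pinv \<psi> b))"
  show "(\<phi> (?r + pinv \<psi> b), \<psi> (?r + pinv \<psi> b)) = (a, b)"
    by (simp add: linear_add[OF lsurj_linear[OF s(1)]] linear_add[OF lsurj_linear[OF s(2)]]
        prj_pinv_resid[OF assms] pinv_right[OF s(2)])
  fix k assume k: "(\<phi> k, \<psi> k) = 0"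
  then have "\<phi> k = 0" "\<psi> k = 0" by (auto simp: zero_prod_def)
  moreover then have "resid \<phi> \<psi> k = 0" by (simp add: resid_def prj_def linear_0[OF pinv_linear[OF s(2)]])
  ultimately show "(?r + pinv \<psi> b) \<bullet> k = 0"
    by (simp add: inner_add_left pinv_ortho[OF s(2)] pinv_ortho[OF resid_lsurj[OF assms]])
qed

text \<open>Pythagoras for the two summands of \<open>pinv_pair\<close>. It is the Schur complement
  formula, and the exponent of the factorization p(a, b) = p(a | b) p(b).\<close>

lemma qform_pair:
  assumes "lsurj (\<phi> \<star> \<psi>)"
  shows "qform (\<phi> \<star> \<psi>) (a, b) = qform (resid \<phi> \<psi>) (a - \<phi> (pinv \<psi> b)) + qform \<psi> b"
proof -
  note s = lsurj_pairD[OF assms]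
  let ?r = "pinv (resid \<phi> \<psi>) (a - \<phi> (pinv \<psi> b))"
  have "pinv \<psi> b \<bullet> ?r = 0" by (rule pinv_ortho[OF s(2) prj_pinv_resid(2)[OF assms]])
  then show ?thesis
    unfolding qform_def pinv_pair[OF assms]
    by (simp add: power2_norm_eq_inner inner_add_left inner_add_right inner_commute)
qed

lemma prj_pair:
  assumes "lsurj (\<phi> \<star> \<psi>)"
  shows "prj (\<phi> \<star> \<psi>) e = prj (resid \<phi> \<psi>) e + prj \<psi> e"
proof -
  note s = lsurj_pairD[OF assms]
  show ?thesis unfolding prj_def pinv_pair[OF assms]
    by (simp add: resid_def linear_diff[OF lsurj_linear[OF s(1)]] prj_def)
qed

lemma linear_swap3: "linear ((\<lambda>(a, b, c). (b, a, c)) :: 'a::real_vector \<times> 'b::real_vector \<times> 'c::real_vector \<Rightarrow> _)"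
  by (auto simp: linear_iff)

lemma bij_swap3: "bij (\<lambda>(a, b, c). (b, a, c))"
  by (rule bij_betw_byWitness[where f' = "\<lambda>(a, b, c). (b, a, c)"]) auto

lemma qform_swap3:
  assumes "lsurj (\<phi> \<star> \<psi> \<star> \<rho>)"
  shows "qform (\<psi> \<star> \<phi> \<star> \<rho>) (b, a, c) = qform (\<phi> \<star> \<psi> \<star> \<rho>) (a, b, c)"
    and "lsurj (\<psi> \<star> \<phi> \<star> \<rho>)"
  using qform_comp_bij[OF assms linear_swap3 bij_swap3, of "(a,b,c)"]
    pinv_comp_bij(2)[OF assms linear_swap3 bij_swap3] by (simp_all only: prod.case)

lemma linear_swap2: "linear ((\<lambda>(a, b). (b, a)) :: 'a::real_vector \<times> 'b::real_vector \<Rightarrow> _)"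
  by (auto simp: linear_iff)

lemma bij_swap2: "bij (\<lambda>(a, b). (b, a))"
  by (rule bij_betw_byWitness[where f' = "\<lambda>(a, b). (b, a)"]) auto

lemma qform_swap2:
  assumes "lsurj (\<phi> \<star> \<psi>)"
  shows "qform (\<psi> \<star> \<phi>) (b, a) = qform (\<phi> \<star> \<psi>) (a, b)"
    and "lsurj (\<psi> \<star> \<phi>)"
  using qform_comp_bij[OF assms linear_swap2 bij_swap2, of "(a,b)"]
    pinv_comp_bij(2)[OF assms linear_swap2 bij_swap2] by (simp_all only: prod.case)

text \<open>Both sides are the quadratic form of the joint vector, up to the form of the second block.\<close>
lemma qform_bayes2:
  assumes "lsurj (x \<star> u)"
  shows "qform (resid x u) (x0 - x (pinv u u0)) = qform (resid u x) (u0 - u (pinv x x0)) + qform x x0 - qform u u0"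
  using qform_pair[OF assms, of x0 u0] qform_pair[OF qform_swap2(2)[OF assms], of u0 x0]
    qform_swap2(1)[OF assms, of u0 x0] by linarith

text \<open>Exponents of p(x | u, w) = p(u | x, w) p(x, w) / (p(u | w) p(w)), from expanding the
  form of the triple in two orders. On the right \<open>u0\<close> occurs only in forms of residuals
  of \<open>u\<close>.\<close>

lemma qform_bayes3:
  assumes "lsurj (x \<star> u \<star> w)"
  shows "qform (resid x (u \<star> w)) (x0 - x (pinv (u \<star> w) (u0, w0)))
    = qform (resid u (x \<star> w)) (u0 - u (pinv (x \<star> w) (x0, w0)))
      + qform (x \<star> w) (x0, w0) - qform (resid u w) (u0 - u (pinv w w0)) - qform w w0"
proof -
  have "qform (x \<star> u \<star> w) (x0, u0, w0) = qform (u \<star> x \<star> w) (u0, x0, w0)"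
    by (rule qform_swap3(1)[OF assms, symmetric])
  moreover note qform_pair[OF assms, of x0 "(u0, w0)"] qform_pair[OF qform_swap3(2)[OF assms], of u0 "(x0, w0)"]
    qform_pair[OF lsurj_pairD(2)[OF assms], of u0 w0]
  ultimately show ?thesis by argo
qed


text \<open>The form is the least squared norm of the preimages, of which there are fewer for \<open>x\<close> than for \<open>w\<close>.\<close>
lemma qform_resid_mono:
  assumes "lsurj (u \<star> x)" "lsurj (u \<star> w)" "\<And>e. x e = 0 \<Longrightarrow> w e = 0"
  shows "qform (resid u w) a \<le> qform (resid u x) a"
proof -
  note s = lsurj_pairD[OF assms(1)] lsurj_pairD[OF assms(2)]
  have z: "qform w 0 = 0" "qform x 0 = 0" "u (pinv w 0) = 0" "u (pinv x 0) = 0"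
    using linear_0[OF pinv_linear[OF s(2)]] linear_0[OF pinv_linear[OF s(4)]] linear_0[OF lsurj_linear[OF s(1)]]
    by (simp_all add: qform_def)
  have "qform (u \<star> w) (a, 0) \<le> (norm (pinv (u \<star> x) (a, 0)))\<^sup>2"
    using pinv_right[OF assms(1), of "(a, 0)"] assms(3) by (intro qform_le[OF assms(2)]) auto
  then show ?thesis using qform_pair[OF assms(1), of a 0] qform_pair[OF assms(2), of a 0] z
    by (simp add: qform_def)
qed

section \<open>Uncorrelated linear maps\<close>

definition orth :: "('e::euclidean_space \<Rightarrow> 'a::euclidean_space) \<Rightarrow> ('e \<Rightarrow> 'b::euclidean_space) \<Rightarrow> bool" where
  "orth \<phi> \<psi> \<longleftrightarrow> (\<forall>a b. adjoint \<phi> a \<bullet> adjoint \<psi> b = 0)"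

lemma orth_sym: "orth \<phi> \<psi> \<longleftrightarrow> orth \<psi> \<phi>"
  unfolding orth_def by (metis inner_commute)

text \<open>The definition is symmetric in the two maps; this side says that the cross-covariance
  operator vanishes and is the one to compute with.\<close>

lemma orth_iff:
  assumes "linear \<phi>" shows "orth \<phi> \<psi> \<longleftrightarrow> (\<forall>b. \<phi> (adjoint \<psi> b) = 0)"
proof
  assume o: "orth \<phi> \<psi>"
  show "\<forall>b. \<phi> (adjoint \<psi> b) = 0"
  proof
    fix b
    have "\<phi> (adjoint \<psi> b) \<bullet> \<phi> (adjoint \<psi> b) = adjoint \<psi> b \<bullet> adjoint \<phi> (\<phi> (adjoint \<psi> b))"
      by (rule adjoint_works[OF assms, symmetric])
    also have "\<dots> = 0" using o unfolding orth_def by (subst inner_commute) blast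
    finally show "\<phi> (adjoint \<psi> b) = 0" by (simp only: inner_eq_zero_iff)
  qed
next
  assume "\<forall>b. \<phi> (adjoint \<psi> b) = 0"
  then have "adjoint \<psi> b \<bullet> adjoint \<phi> a = 0" for a b
    by (simp add: adjoint_works[OF assms])
  then show "orth \<phi> \<psi>" unfolding orth_def by (subst inner_commute) blast
qed

lemma orth_pinv: "linear \<phi> \<Longrightarrow> orth \<phi> \<psi> \<Longrightarrow> \<phi> (pinv \<psi> b) = 0"
  by (simp add: orth_iff pinv_def)

lemma orth_comp:
  assumes "linear \<phi>" "linear A" "orth \<phi> \<psi>" shows "orth (\<lambda>e. A (\<phi> e)) \<psi>"
  using assms orth_iff[of "\<lambda>e. A (\<phi> e)" \<psi>] linear_compose[of \<phi> A]
  by (simp add: orth_iff o_def linear_0)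

lemma orth_add:
  assumes "linear \<phi>" "linear \<phi>'" "orth \<phi> \<psi>" "orth \<phi>' \<psi>" shows "orth (\<lambda>e. \<phi> e + \<phi>' e) \<psi>"
  using assms by (simp add: orth_iff linear_compose_add)

lemma orth_pair:
  assumes "linear \<phi>" "linear \<phi>'" "orth \<phi> \<psi>" "orth \<phi>' \<psi>" shows "orth (\<phi> \<star> \<phi>') \<psi>"
  using assms by (simp add: orth_iff linear_pair zero_prod_def)

text \<open>Prescribe \<open>u\<close> and \<open>b\<close> first, then correct \<open>v\<close>
  along its innovation, which moves neither \<open>b\<close> nor, the residuals being uncorrelated,
  \<open>u\<close>. Nonsingularity of vectors containing both agents' variables is obtained in this
  way.\<close>

lemma lsurj_cond_pair:
  assumes "lsurj (u \<star> b)" "lsurj (v \<star> b)" "orth (resid u b) (resid v b)"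
  shows "lsurj (u \<star> v \<star> b)"
proof -
  note s = lsurj_pairD[OF assms(1)] lsurj_pairD[OF assms(2)]
  note l = s[THEN lsurj_linear]
  have ub: "u (pinv (resid v b) c) = 0" for c
    using orth_pinv[OF resid_linear[OF l(1) s(2)] assms(3), of c] prj_pinv_resid(1)[OF assms(2), of c]
    by (simp add: resid_def)
  have "\<exists>e. (u e, v e, b e) = (p, q, r)" for p q r
  proof -
    define e1 where "e1 = pinv (resid u b) (p - u (pinv b r)) + pinv b r"
    define e where "e = pinv (resid v b) (q - v e1) + e1"
    have "u e1 = p" "b e1 = r"
      by (simp_all add: e1_def linear_add[OF l(1)] linear_add[OF l(2)] prj_pinv_resid[OF assms(1)] pinv_right[OF s(2)])
    then have "u e = p" "v e = q" "b e = r"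
      by (simp_all add: e_def linear_add[OF l(1)] linear_add[OF l(2)] linear_add[OF l(3)] ub prj_pinv_resid[OF assms(2)])
    then show ?thesis by auto
  qed
  then have "surj (u \<star> v \<star> b)" unfolding surj_def by (metis prod_cases3)
  moreover have "linear (u \<star> v \<star> b)" by (intro linear_pair l)
  ultimately show ?thesis by (simp add: lsurj_def)
qed

text \<open>Linear Markov property: the projection onto the larger block adds only the innovation of
  \<open>v\<close>, on which \<open>u\<close> vanishes.\<close>

lemma prj_cond_orth:
  assumes "lsurj (v \<star> b)" "linear u" "orth (resid u b) (resid v b)"
  shows "u (prj (v \<star> b) e) = u (prj b e)"
proof -
  note s = lsurj_pairD[OF assms(1)]
  have "u (pinv (resid v b) c) = 0" for c
    using orth_pinv[OF resid_linear[OF assms(2) s(2)] assms(3), of c] prj_pinv_resid(1)[OF assms(1), of c]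
    by (simp add: resid_def)
  then show ?thesis by (simp add: prj_pair[OF assms(1)] linear_add[OF assms(2)] prj_def[of "resid v b"])
qed

section \<open>Images of Lebesgue measure under linear bijections\<close>

lemma borel_measurable_linear:
  fixes f :: "'a::euclidean_space \<Rightarrow> 'b::euclidean_space"
  shows "linear f \<Longrightarrow> f \<in> borel_measurable borel"
  by (simp add: borel_measurable_continuous_onI linear_continuous_on linear_conv_bounded_linear)

lemma nn_integral_lborel_shift:
  fixes f :: "'a::euclidean_space \<Rightarrow> ennreal"
  assumes [measurable]: "f \<in> borel_measurable borel"
  shows "(\<integral>\<^sup>+x. f (x + a) \<partial>lborel) = (\<integral>\<^sup>+x. f x \<partial>lborel)"
  by (subst (2) lborel_distr_plus[of a, symmetric]) (simp add: nn_integral_distr add.commute)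

text \<open>Uniqueness of Haar measure: the image of Lebesgue measure is translation invariant, so
  integrating \<open>f x * g y\<close> against both measures and shifting twice exchanges their roles.\<close>
lemma distr_lborel_linear:
  fixes G :: "'a::euclidean_space \<Rightarrow> 'b::euclidean_space"
  assumes G: "linear G" "bij G"
  shows "\<exists>c>0. distr lborel borel G = density lborel (\<lambda>_. ennreal c)"
proof -
  define \<nu> where "\<nu> = distr lborel borel G"
  note [measurable] = borel_measurable_linear[OF G(1)]
  have linv: "linear (inv G)" by (rule linear_inv_bij[OF G])
  note [measurable] = borel_measurable_linear[OF linv]
  have sn: "sets \<nu> = sets borel" "space \<nu> = UNIV" by (auto simp: \<nu>_def)
  note [measurable_cong] = sn(1)
  have vim: "G -` S = inv G ` S" for S using bij_vimage_eq_inv_image[OF G(2)] .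
  have fin: "emeasure \<nu> S < \<infinity>" if "bounded S" "S \<in> sets borel" for S
    using emeasure_bounded_finite[OF bounded_linear_image[OF that(1)], of "inv G"] linv that(2)
    by (simp add: \<nu>_def emeasure_distr vim linear_conv_bounded_linear)
  interpret N: sigma_finite_measure \<nu>
  proof
    show "\<exists>A. countable A \<and> A \<subseteq> sets \<nu> \<and> \<Union> A = space \<nu> \<and> (\<forall>a\<in>A. emeasure \<nu> a \<noteq> \<infinity>)"
      using fin real_arch_simple
      by (intro exI[of _ "range (\<lambda>n. cball 0 (real n))"]) (auto simp: sn less_top)
  qed
  interpret P: pair_sigma_finite \<nu> "lborel :: 'b measure" ..
  have inv: "(\<integral>\<^sup>+x. f (x + a) \<partial>\<nu>) = (\<integral>\<^sup>+x. f x \<partial>\<nu>)"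
    if [measurable]: "f \<in> borel_measurable borel" for f :: "'b \<Rightarrow> ennreal" and a
  proof -
    have "(\<integral>\<^sup>+x. f (x + a) \<partial>\<nu>) = (\<integral>\<^sup>+x. f (G (x + inv G a)) \<partial>lborel)"
      using G by (simp add: \<nu>_def nn_integral_distr linear_add surj_f_inv_f bij_is_surj)
    also have "\<dots> = (\<integral>\<^sup>+x. f (G x) \<partial>lborel)"
      by (rule nn_integral_lborel_shift) measurable
    finally show ?thesis by (simp add: \<nu>_def nn_integral_distr)
  qed
  \<comment> \<open>Symmetry of the ball permits replacing \<open>g (y - x)\<close> by
    \<open>g (x - y)\<close>, so that the second shift is one of Lebesgue measure; positive finite
    mass under both measures makes their ratio a legitimate constant.\<close>
  define B where "B = cball (0::'b) 1"
  define g where "g = (indicator B :: 'b \<Rightarrow> ennreal)"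
  have [measurable]: "B \<in> sets borel" by (simp add: B_def)
  have [measurable]: "g \<in> borel_measurable borel" by (simp add: g_def)
  have gsym: "g (- x) = g x" for x by (simp add: g_def B_def indicator_def)
  have main: "emeasure lborel S * emeasure \<nu> B = emeasure \<nu> S * emeasure lborel B"
    if S[measurable]: "S \<in> sets borel" for S
  proof -
    let ?f = "indicator S :: 'b \<Rightarrow> ennreal"
    have "emeasure lborel S * emeasure \<nu> B = (\<integral>\<^sup>+y. (\<integral>\<^sup>+x. ?f x * g y \<partial>lborel) \<partial>\<nu>)"
      by (simp add: nn_integral_multc nn_integral_cmult g_def sn mult.commute)
    also have "\<dots> = (\<integral>\<^sup>+y. (\<integral>\<^sup>+x. ?f (x + y) * g y \<partial>lborel) \<partial>\<nu>)"
      by (intro nn_integral_cong nn_integral_lborel_shift[symmetric]) measurable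
    also have "\<dots> = (\<integral>\<^sup>+x. (\<integral>\<^sup>+y. ?f (y + x) * g (y + x + - x) \<partial>\<nu>) \<partial>lborel)"
      by (subst P.Fubini') (simp_all add: add.commute split: prod.split)
    also have "\<dots> = (\<integral>\<^sup>+x. (\<integral>\<^sup>+y. ?f y * g (y + - x) \<partial>\<nu>) \<partial>lborel)"
      by (intro nn_integral_cong inv[where f="\<lambda>y. ?f y * g (y + - x)" for x]) measurable
    also have "\<dots> = (\<integral>\<^sup>+y. (\<integral>\<^sup>+x. ?f y * g (y + - x) \<partial>lborel) \<partial>\<nu>)"
      by (subst P.Fubini') (simp_all split: prod.split)
    also have "\<dots> = (\<integral>\<^sup>+y. ?f y * (\<integral>\<^sup>+x. g (x + - y) \<partial>lborel) \<partial>\<nu>)"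
      using gsym[of "x - y" for x y] by (simp add: nn_integral_cmult)
    also have "\<dots> = (\<integral>\<^sup>+y. ?f y * emeasure lborel B \<partial>\<nu>)"
      by (subst nn_integral_lborel_shift) (simp_all add: g_def)
    also have "\<dots> = emeasure \<nu> S * emeasure lborel B"
      by (simp add: nn_integral_multc sn)
    finally show ?thesis .
  qed
  have Bfin: "emeasure lborel B < \<infinity>" "emeasure \<nu> B < \<infinity>"
    unfolding B_def by (intro emeasure_bounded_finite fin; simp)+
  have pos: "0 < emeasure lborel T" if "open T" "T \<noteq> {}" for T :: "'c::euclidean_space set"
    using open_not_negligible[OF that] that(1) by (auto simp: negligible_iff_null_sets null_sets_def zero_less_iff_neq_zero)
  have Bpos: "0 < emeasure lborel B"
    using pos[of "ball (0::'b) 1"] emeasure_mono[of "ball (0::'b) 1" B lborel] by (auto simp: B_def)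
  have "0 \<in> G -` ball 0 1" using linear_0[OF G(1)] by simp
  then have "0 < emeasure lborel (G -` ball 0 1)"
    by (intro pos open_vimage linear_continuous_on)
      (auto simp: linear_conv_bounded_linear[symmetric] G intro!: exI[of _ 0])
  also have "\<dots> = emeasure \<nu> (ball 0 1)" by (simp add: \<nu>_def emeasure_distr)
  also have "\<dots> \<le> emeasure \<nu> B"
    by (rule emeasure_mono) (auto simp: B_def sn)
  finally have Npos: "0 < emeasure \<nu> B" .
  define c where "c = enn2real (emeasure \<nu> B) / enn2real (emeasure lborel B)"
  have c: "0 < c" "ennreal c * emeasure lborel B = emeasure \<nu> B"
    using Bpos Npos Bfin unfolding c_def
    by (cases "emeasure lborel B"; cases "emeasure \<nu> B"; simp add: ennreal_mult[symmetric])+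
  have "\<nu> = density lborel (\<lambda>_. ennreal c)"
  proof (rule measure_eqI)
    fix S assume "S \<in> sets \<nu>"
    then have S: "S \<in> sets borel" by (simp add: sn)
    have "emeasure lborel B * emeasure \<nu> S = emeasure lborel B * (ennreal c * emeasure lborel S)"
      using main[OF S] c(2) by (metis mult.assoc mult.commute)
    then have "emeasure \<nu> S = ennreal c * emeasure lborel S"
      using Bpos Bfin by (simp only: ennreal_mult_cancel_left) (auto simp: less_top)
    then show "emeasure \<nu> S = emeasure (density lborel (\<lambda>_. ennreal c)) S"
      using S by (simp add: emeasure_density nn_integral_cmult)
  qed (simp add: sn)
  then show ?thesis using c(1) by (auto simp: \<nu>_def)
qed

lemma distr_density_linear:
  fixes G :: "'a::euclidean_space \<Rightarrow> 'b::euclidean_space"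
  assumes G: "linear G" "bij G" and [measurable]: "f \<in> borel_measurable borel"
  shows "\<exists>c>0. distr (density lborel f) borel G = density lborel (\<lambda>b. ennreal c * f (inv G b))"
proof -
  obtain c where c: "c > 0" "distr lborel borel G = density lborel (\<lambda>_. ennreal c)"
    using distr_lborel_linear[OF G] by blast
  note [measurable] = borel_measurable_linear[OF G(1)] borel_measurable_linear[OF linear_inv_bij[OF G]]
  have "distr (density lborel f) borel G = density lborel (\<lambda>b. ennreal c * f (inv G b))" (is "?L = ?R")
  proof (rule measure_eqI)
    fix S assume "S \<in> sets ?L"
    then have [measurable]: "S \<in> sets borel" by simp
    have "G -` S \<in> sets borel" using measurable_sets_borel[of G borel S] by simp
    then have "emeasure ?L S = (\<integral>\<^sup>+x. f x * indicator (G -` S) x \<partial>lborel)"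
      by (simp add: emeasure_distr emeasure_density)
    also have "\<dots> = (\<integral>\<^sup>+x. f (inv G (G x)) * indicator S (G x) \<partial>lborel)"
      using G by (intro nn_integral_cong) (auto simp: bij_is_inj inv_f_f indicator_def)
    also have "\<dots> = (\<integral>\<^sup>+b. f (inv G b) * indicator S b \<partial>distr lborel borel G)"
      by (subst nn_integral_distr) auto
    also have "\<dots> = emeasure ?R S"
      by (simp add: c(2) nn_integral_density emeasure_density mult.assoc)
    finally show "emeasure ?L S = emeasure ?R S" .
  qed simp
  with c(1) show ?thesis by blast
qed

section \<open>The standard Gaussian measure\<close>

text \<open>Each real coordinate has variance 1/2, as for the real and imaginary parts of a standard
  complex Gaussian; hence the factors 1/2 in the second moments below.\<close>
definition std_gauss :: "'e::euclidean_space measure" where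
  "std_gauss = density lborel (\<lambda>w. ennreal (exp (- (norm w)\<^sup>2) / sqrt pi ^ DIM('e)))"

lemma sets_std_gauss[simp, measurable_cong]: "sets std_gauss = sets borel" and space_std_gauss[simp]: "space std_gauss = UNIV"
  by (simp_all add: std_gauss_def)

lemma norm2_Basis: "(norm (w::'e::euclidean_space))\<^sup>2 = (\<Sum>b\<in>Basis. (w \<bullet> b)\<^sup>2)"
  unfolding power2_norm_eq_inner by (subst euclidean_inner) (simp add: power2_eq_square)

lemma std_gauss_dens: "exp (- (norm w)\<^sup>2) / sqrt pi ^ DIM('e) = (\<Prod>b\<in>Basis. exp (- (w \<bullet> b)\<^sup>2) / sqrt pi)"
  for w :: "'e::euclidean_space"
  by (simp add: norm2_Basis prod_dividef exp_sum[symmetric] sum_negf)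

section \<open>Moments of the standard Gaussian measure\<close>

lemma has_bochner_prod_lborel:
  fixes f :: "'e::euclidean_space \<Rightarrow> real \<Rightarrow> real"
  assumes f: "\<And>b. b \<in> Basis \<Longrightarrow> has_bochner_integral lborel (f b) (I b)"
  shows "has_bochner_integral lborel (\<lambda>w. \<Prod>b\<in>Basis. f b (w \<bullet> b)) (\<Prod>b\<in>Basis. I b)"
proof -
  interpret product_sigma_finite "\<lambda>b::'e. lborel :: real measure" by standard
  have i: "integrable lborel (f b)" "integral\<^sup>L lborel (f b) = I b" if "b \<in> Basis" for b
    using f[OF that] by (auto simp: has_bochner_integral_iff)
  have [measurable]: "f b \<in> borel_measurable borel" if "b \<in> Basis" for b
    using i(1)[OF that] by (simp add: integrable_iff_bounded)
  have eq: "(\<Prod>b\<in>Basis. f b ((\<Sum>b'\<in>Basis. x b' *\<^sub>R b') \<bullet> b)) = (\<Prod>b\<in>Basis. f b (x b))" for x :: "'e \<Rightarrow> real"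
    by (intro prod.cong refl) simp
  have "integrable (\<Pi>\<^sub>M b\<in>Basis. lborel) (\<lambda>x. \<Prod>b\<in>Basis. f b (x b))"
    by (rule product_integrable_prod) (auto intro: i)
  moreover have "(\<integral>x. (\<Prod>b\<in>Basis. f b (x b)) \<partial>Pi\<^sub>M Basis (\<lambda>b::'e. lborel)) = (\<Prod>b\<in>Basis. I b)"
    by (subst product_integral_prod) (auto simp: i)
  ultimately show ?thesis
    unfolding has_bochner_integral_iff
    by (subst (1 2) lborel_eq) (simp add: integrable_distr_eq integral_distr eq)
qed

lemma std_gauss_prod:
  fixes f :: "'e::euclidean_space \<Rightarrow> real \<Rightarrow> real"
  assumes f: "\<And>b. b \<in> Basis \<Longrightarrow> has_bochner_integral lborel (\<lambda>t. f b t * (exp (- t\<^sup>2) / sqrt pi)) (I b)"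
    and [measurable]: "\<And>b. b \<in> Basis \<Longrightarrow> f b \<in> borel_measurable borel"
  shows "has_bochner_integral std_gauss (\<lambda>w. \<Prod>b\<in>Basis. f b (w \<bullet> b)) (\<Prod>b\<in>Basis. I b)"
proof -
  have "has_bochner_integral lborel (\<lambda>w::'e. (exp (- (norm w)\<^sup>2) / sqrt pi ^ DIM('e)) *\<^sub>R (\<Prod>b\<in>Basis. f b (w \<bullet> b))) (\<Prod>b\<in>Basis. I b)"
  proof -
    have "has_bochner_integral lborel (\<lambda>w::'e. \<Prod>b\<in>Basis. f b (w \<bullet> b) * (exp (- (w \<bullet> b)\<^sup>2) / sqrt pi)) (\<Prod>b\<in>Basis. I b)"
      by (rule has_bochner_prod_lborel[where f="\<lambda>b t. f b t * (exp (- t\<^sup>2) / sqrt pi)"]) (rule f)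
    then show ?thesis unfolding std_gauss_dens prod.distrib real_scaleR_def by (simp only: mult.commute)
  qed
  then show ?thesis unfolding std_gauss_def by (intro has_bochner_integral_density) auto
qed

lemma gauss1:
  shows "has_bochner_integral lborel (\<lambda>t. exp (- t\<^sup>2) / sqrt pi) (1::real)"
    and "has_bochner_integral lborel (\<lambda>t. t * (exp (- t\<^sup>2) / sqrt pi)) (0::real)"
    and "has_bochner_integral lborel (\<lambda>t. t * t * (exp (- t\<^sup>2) / sqrt pi)) (1/2::real)"
proof -
  have "has_bochner_integral lborel (\<lambda>t::real. exp (- t\<^sup>2)) (2 *\<^sub>R (sqrt pi / 2))"
    by (rule has_bochner_integral_even_function[OF gaussian_moment_0]) simp
  from has_bochner_integral_mult_left[OF this, of "1 / sqrt pi"]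
  show "has_bochner_integral lborel (\<lambda>t. exp (- t\<^sup>2) / sqrt pi) (1::real)" by simp
  have "has_bochner_integral lborel (\<lambda>t::real. exp (- t\<^sup>2) * t) 0"
    by (rule has_bochner_integral_odd_function[OF gaussian_moment_1]) simp
  from has_bochner_integral_mult_left[OF this, of "1 / sqrt pi"]
  show "has_bochner_integral lborel (\<lambda>t. t * (exp (- t\<^sup>2) / sqrt pi)) (0::real)" by (simp add: mult.commute)
  have "has_bochner_integral lborel (\<lambda>t::real. exp (- t\<^sup>2) * t ^ (2 * 1))
     (2 *\<^sub>R ((sqrt pi / 2) * (fact (2 * 1) / (2 ^ (2 * 1) * fact 1))))"
    by (rule has_bochner_integral_even_function[OF gaussian_moment_even_pos]) simp
  from has_bochner_integral_mult_left[OF this, of "1 / sqrt pi"]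
  show "has_bochner_integral lborel (\<lambda>t. t * t * (exp (- t\<^sup>2) / sqrt pi)) (1/2::real)"
    by (simp add: power2_eq_square mult_ac)
qed

lemma prob_space_std_gauss: "prob_space std_gauss"
proof
  have "has_bochner_integral lborel (\<lambda>w::'a. exp (- (norm w)\<^sup>2) / sqrt pi ^ DIM('a)) 1"
    unfolding std_gauss_dens using has_bochner_prod_lborel[OF gauss1(1)] by simp
  then have "(\<integral>\<^sup>+w. ennreal (exp (- (norm (w::'a))\<^sup>2) / sqrt pi ^ DIM('a)) \<partial>lborel) = ennreal 1"
    by (auto simp: has_bochner_integral_iff nn_integral_eq_integral)
  then show "emeasure (std_gauss::'a measure) (space std_gauss) = 1"
    by (simp add: std_gauss_def emeasure_density)
qed

lemma std_gauss_basis2: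
  assumes "i \<in> Basis" "j \<in> Basis"
  shows "has_bochner_integral std_gauss (\<lambda>w. (w \<bullet> i) * (w \<bullet> j)) ((i \<bullet> j) / 2)"
proof -
  \<comment> \<open>The coordinate \<open>b\<close> receives one factor \<open>t\<close> for each of
    \<open>i\<close>, \<open>j\<close> equal to it, so the case \<open>i = j\<close> yields the
    second moment of a single coordinate.\<close>
  define f where "f b t = (if b = i then t else 1) * (if b = j then t else (1::real))" for b :: 'a and t
  define I where "I b = (if b = i \<and> b = j then 1/2 else if b = i \<or> b = j then 0 else (1::real))" for b
  have "has_bochner_integral std_gauss (\<lambda>w. \<Prod>b\<in>Basis. f b (w \<bullet> b)) (\<Prod>b\<in>Basis. I b)"
  proof (rule std_gauss_prod)
    fix b :: 'a
    show "f b \<in> borel_measurable borel" unfolding f_def by simp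
    show "has_bochner_integral lborel (\<lambda>t. f b t * (exp (- t\<^sup>2) / sqrt pi)) (I b)"
      using gauss1 by (auto simp: f_def I_def)
  qed
  moreover have "(\<Prod>b\<in>Basis. f b (w \<bullet> b)) = (w \<bullet> i) * (w \<bullet> j)" for w
    unfolding f_def prod.distrib using assms by (simp add: prod.delta[where b="\<lambda>b. w \<bullet> b"])
  moreover have "(\<Prod>b\<in>Basis. I b) = (i \<bullet> j) / 2"
  proof (cases "i = j")
    case True
    then have "(\<Prod>b\<in>Basis. I b) = (\<Prod>b\<in>Basis. if b = i then 1/2 else 1)" by (intro prod.cong) (auto simp: I_def)
    then show ?thesis using True assms by (simp add: inner_Basis)
  next
    case False
    then have "(\<Prod>b\<in>Basis. I b) = 0" using assms by (intro prod_zero) (auto simp: I_def intro!: bexI[of _ i])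
    then show ?thesis using False assms by (simp add: inner_Basis)
  qed
  ultimately show ?thesis by simp
qed

lemma std_gauss_basis1:
  assumes "i \<in> Basis"
  shows "has_bochner_integral std_gauss (\<lambda>w. w \<bullet> i) 0"
proof -
  define f where "f b t = (if b = i then t else (1::real))" for b :: 'a and t
  define I where "I b = (if b = i then 0 else (1::real))" for b
  have "has_bochner_integral std_gauss (\<lambda>w. \<Prod>b\<in>Basis. f b (w \<bullet> b)) (\<Prod>b\<in>Basis. I b)"
  proof (rule std_gauss_prod)
    fix b :: 'a
    show "f b \<in> borel_measurable borel" unfolding f_def by simp
    show "has_bochner_integral lborel (\<lambda>t. f b t * (exp (- t\<^sup>2) / sqrt pi)) (I b)"
      using gauss1 by (auto simp: f_def I_def)
  qed
  moreover have "(\<Prod>b\<in>Basis. f b (w \<bullet> b)) = w \<bullet> i" for w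
    unfolding f_def using assms by (simp add: prod.delta[where b="\<lambda>b. w \<bullet> b"])
  moreover have "(\<Prod>b\<in>Basis. I b) = 0" using assms by (intro prod_zero) (auto simp: I_def)
  ultimately show ?thesis by simp
qed

lemma std_gauss_mean: "has_bochner_integral std_gauss (\<lambda>w. w \<bullet> a) 0"
proof -
  have "has_bochner_integral std_gauss (\<lambda>w. \<Sum>i\<in>Basis. (w \<bullet> i) * (a \<bullet> i)) (\<Sum>i\<in>Basis. 0 * (a \<bullet> i))"
    by (intro has_bochner_integral_sum has_bochner_integral_mult_left std_gauss_basis1)
  then show ?thesis by (simp add: euclidean_inner[symmetric])
qed

lemma std_gauss_second: "has_bochner_integral std_gauss (\<lambda>w. (w \<bullet> a) * (w \<bullet> b)) ((a \<bullet> b) / 2)"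
proof -
  have "has_bochner_integral std_gauss (\<lambda>w. \<Sum>i\<in>Basis. \<Sum>j\<in>Basis. (w \<bullet> i) * (w \<bullet> j) * ((a \<bullet> i) * (b \<bullet> j)))
    (\<Sum>i\<in>Basis. \<Sum>j\<in>Basis. (i \<bullet> j) / 2 * ((a \<bullet> i) * (b \<bullet> j)))"
    by (intro has_bochner_integral_sum has_bochner_integral_mult_left std_gauss_basis2)
  moreover have "(\<Sum>i\<in>Basis. \<Sum>j\<in>Basis. (w \<bullet> i) * (w \<bullet> j) * ((a \<bullet> i) * (b \<bullet> j))) = (w \<bullet> a) * (w \<bullet> b)" for w
    by (subst (3 4) euclidean_inner) (simp add: sum_product mult_ac)
  moreover have "(\<Sum>i\<in>Basis. \<Sum>j\<in>Basis. (i \<bullet> j) / 2 * ((a \<bullet> i) * (b \<bullet> j))) = (a \<bullet> b) / 2"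
  proof -
    have "(\<Sum>j\<in>Basis. (i \<bullet> j) / 2 * ((a \<bullet> i) * (b \<bullet> j))) = (a \<bullet> i) * (b \<bullet> i) / 2" if "i \<in> Basis" for i
    proof -
      have "(\<Sum>j\<in>Basis. (i \<bullet> j) / 2 * ((a \<bullet> i) * (b \<bullet> j))) = (\<Sum>j\<in>Basis. if j = i then (a \<bullet> i) * (b \<bullet> i) / 2 else 0)"
        using that by (intro sum.cong) (auto simp: inner_Basis)
      then show ?thesis using that by simp
    qed
    then have "(\<Sum>i\<in>Basis. \<Sum>j\<in>Basis. (i \<bullet> j) / 2 * ((a \<bullet> i) * (b \<bullet> j))) = (\<Sum>i\<in>Basis. (a \<bullet> i) * (b \<bullet> i) / 2)"
      by (rule sum.cong[OF refl])
    then show ?thesis by (simp only: euclidean_inner[of a b] sum_divide_distrib)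
  qed
  ultimately show ?thesis by (simp only:)
qed

lemma std_gauss_linear_inner:
  fixes \<phi> :: "'e::euclidean_space \<Rightarrow> 'a::euclidean_space" and \<psi> :: "'e \<Rightarrow> 'b::euclidean_space"
  assumes "linear \<phi>" "linear \<psi>"
  shows "has_bochner_integral std_gauss (\<lambda>w. (\<phi> w \<bullet> a) * (\<psi> w \<bullet> b)) ((adjoint \<phi> a \<bullet> adjoint \<psi> b) / 2)"
  unfolding adjoint_works[OF assms(1), symmetric] adjoint_works[OF assms(2), of _ b, symmetric] by (rule std_gauss_second)

lemma std_gauss_linear_mean:
  fixes \<phi> :: "'e::euclidean_space \<Rightarrow> 'a::euclidean_space"
  assumes "linear \<phi>" shows "has_bochner_integral std_gauss (\<lambda>w. \<phi> w \<bullet> a) 0"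
  unfolding adjoint_works[OF assms, symmetric] by (rule std_gauss_mean)

text \<open>The cross term has mean zero, so averaging adds a constant that is the same for every
  \<open>p\<close>. This is why expectations of quadratic forms only move their centres.\<close>

lemma std_gauss_norm2:
  fixes q :: "'e::euclidean_space \<Rightarrow> 'a::euclidean_space"
  assumes "linear q"
  shows "\<exists>c. \<forall>p. has_bochner_integral std_gauss (\<lambda>w. (norm (p + q w))\<^sup>2) ((norm p)\<^sup>2 + c)"
proof -
  \<comment> \<open>The mean squared norm of \<open>q w\<close>, one half of the trace of the
    operator \<open>q\<close> composed with its adjoint.\<close>
  define c where "c = (\<Sum>b\<in>Basis. adjoint q b \<bullet> adjoint q b / 2)"
  have "has_bochner_integral std_gauss (\<lambda>w. (norm (p + q w))\<^sup>2) ((norm p)\<^sup>2 + c)" for p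
  proof -
    interpret prob_space "std_gauss :: 'e measure" by (rule prob_space_std_gauss)
    have "has_bochner_integral (std_gauss::'e measure) (\<lambda>w. (norm p)\<^sup>2) ((norm p)\<^sup>2)"
      using prob_space by (simp add: has_bochner_integral_iff)
    then have "has_bochner_integral std_gauss (\<lambda>w. (norm p)\<^sup>2 + (2 * (q w \<bullet> p) + (\<Sum>b\<in>Basis. (q w \<bullet> b) * (q w \<bullet> b)))) ((norm p)\<^sup>2 + (2 * 0 + c))"
      unfolding c_def
      by (intro has_bochner_integral_add has_bochner_integral_sum std_gauss_linear_inner assms has_bochner_integral_mult_right std_gauss_linear_mean) auto
    moreover have "(norm p)\<^sup>2 + (2 * (q w \<bullet> p) + (\<Sum>b\<in>Basis. (q w \<bullet> b) * (q w \<bullet> b))) = (norm (p + q w))\<^sup>2" for w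
      unfolding euclidean_inner[of "q w" "q w", symmetric]
      by (simp add: power2_norm_eq_inner inner_add_left inner_add_right inner_commute)
    ultimately show ?thesis by simp
  qed
  then show ?thesis by blast
qed

text \<open>Adjoining independent randomness just enlarges the source to a product, which is again
  standard.\<close>

lemma std_gauss_prod_measure: "(std_gauss::'a::euclidean_space measure) \<Otimes>\<^sub>M (std_gauss :: 'b::euclidean_space measure) = std_gauss"
proof -
  have e: "exp (- (norm a)\<^sup>2) / sqrt pi ^ DIM('a) * (exp (- (norm b)\<^sup>2) / sqrt pi ^ DIM('b))
    = exp (- (norm (a,b))\<^sup>2) / sqrt pi ^ DIM('a \<times> 'b)" for a :: 'a and b :: 'b
    by (simp add: norm_Pair power_add exp_diff exp_minus field_simps)
  have "(std_gauss::'a measure) \<Otimes>\<^sub>M (std_gauss :: 'b measure) = density (lborel \<Otimes>\<^sub>M lborel) (\<lambda>(a, b).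
      ennreal (exp (- (norm (a::'a))\<^sup>2) / sqrt pi ^ DIM('a)) * ennreal (exp (- (norm (b::'b))\<^sup>2) / sqrt pi ^ DIM('b)))"
    unfolding std_gauss_def
    by (rule pair_measure_density)
      (auto simp: lborel.sigma_finite_measure_axioms std_gauss_def[symmetric] prob_space_std_gauss prob_space_imp_sigma_finite)
  also have "\<dots> = std_gauss"
    unfolding std_gauss_def lborel_prod case_prod_beta by (simp add: ennreal_mult[symmetric] e[simplified] del: times_divide_times_eq)
  finally show ?thesis .
qed

lemma emeasure_distr_density:
  assumes [measurable]: "f \<in> borel_measurable N" "G \<in> N \<rightarrow>\<^sub>M L" "S \<in> sets L"
  shows "emeasure (distr (density N f) L G) S = (\<integral>\<^sup>+x. f x * indicator S (G x) \<partial>N)"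
proof -
  have "emeasure (distr (density N f) L G) S = (\<integral>\<^sup>+x. indicator S x \<partial>distr (density N f) L G)" by simp
  also have "\<dots> = (\<integral>\<^sup>+x. f x * indicator S (G x) \<partial>N)"
    by (subst nn_integral_distr) (simp_all add: nn_integral_density)
  finally show ?thesis .
qed

lemma distr_density_snd:
  fixes f :: "'a::euclidean_space \<times> 'b::euclidean_space \<Rightarrow> ennreal"
  assumes [measurable]: "f \<in> borel_measurable borel"
  shows "distr (density lborel f) borel snd = density lborel (\<lambda>b. \<integral>\<^sup>+a. f (a, b) \<partial>lborel)"
proof (rule measure_eqI)
  have [measurable]: "f \<in> borel_measurable (lborel \<Otimes>\<^sub>M lborel)" by (simp add: lborel_prod)
  fix S :: "'b set" assume "S \<in> sets (distr (density lborel f) borel snd)"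
  then have [measurable]: "S \<in> sets borel" by simp
  have [measurable]: "snd \<in> borel_measurable (borel :: ('a \<times> 'b) measure)" by (rule borel_measurable_linear[OF linear_snd])
  have "emeasure (distr (density lborel f) borel snd) S = (\<integral>\<^sup>+x. f x * indicator S (snd x) \<partial>(lborel \<Otimes>\<^sub>M lborel))"
    unfolding lborel_prod by (rule emeasure_distr_density) simp_all
  also have "\<dots> = (\<integral>\<^sup>+b. \<integral>\<^sup>+a. f (a, b) * indicator S b \<partial>lborel \<partial>lborel)"
    by (subst lborel_pair.nn_integral_snd[symmetric]) (simp_all add: split_beta')
  also have "\<dots> = emeasure (density lborel (\<lambda>b. \<integral>\<^sup>+a. f (a, b) \<partial>lborel)) S"
    by (subst emeasure_density) (simp_all add: nn_integral_multc)
  finally show "emeasure (distr (density lborel f) borel snd) S = emeasure (density lborel (\<lambda>b. \<integral>\<^sup>+a. f (a, b) \<partial>lborel)) S" .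
qed simp

lemma distr_std_gauss_fst: "distr (std_gauss :: ('a::euclidean_space \<times> 'b::euclidean_space) measure) borel fst = std_gauss"
proof -
  interpret prob_space "std_gauss :: 'b measure" by (rule prob_space_std_gauss)
  have "distr ((std_gauss :: 'a measure) \<Otimes>\<^sub>M (std_gauss :: 'b measure)) std_gauss fst = std_gauss" by (rule distr_pair_fst)
  then show ?thesis unfolding std_gauss_prod_measure by (simp cong: distr_cong)
qed

section \<open>Densities of linear images of the standard Gaussian\<close>

lemma qform_measurable[measurable]: "lsurj \<phi> \<Longrightarrow> qform \<phi> \<in> borel_measurable borel"
  unfolding qform_def using borel_measurable_linear[OF pinv_linear] by measurable

text \<open>Padding the source by a copy of the target completes \<open>\<phi>\<close> to a bijection whose image density
  factorizes, so the density of \<open>\<phi>\<close> is read off as a marginal and no basis of the kernel is needed.\<close>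
lemma law_density:
  fixes \<phi> :: "'e::euclidean_space \<Rightarrow> 'a::euclidean_space"
  assumes "lsurj \<phi>"
  shows "\<exists>c>0. distr std_gauss borel \<phi> = density lborel (\<lambda>a. ennreal (c * exp (- qform \<phi> a)))"
proof -
  note l = lsurj_linear[OF assms]
  note lp = prj_linear[OF assms] and lpin = pinv_linear[OF assms] and ladj = adjoint_linear[OF l]
  define Ci where "Ci = inv (\<lambda>b. \<phi> (adjoint \<phi> b))"
  have lCi: "linear Ci" unfolding Ci_def by (rule linear_inv_bij[OF bij_cov[OF assms]])
  have Ci: "Ci (\<phi> (adjoint \<phi> b)) = b" for b
    unfolding Ci_def by (rule inv_f_f[OF bij_is_inj[OF bij_cov(2)[OF assms]]])
  have pa: "prj \<phi> (adjoint \<phi> b) = adjoint \<phi> b" for b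
    using Ci by (simp add: prj_def pinv_def Ci_def)
  \<comment> \<open>\<open>G\<close> keeps the kernel component of the first block, puts the padding
    into the orthogonal complement of the kernel through the adjoint, and outputs
    \<open>\<phi>\<close> as second coordinate; \<open>K\<close> undoes this.\<close>
  define G where "G = (\<lambda>x. (fst x - prj \<phi> (fst x) + adjoint \<phi> (snd x), \<phi> (fst x)))"
  define K where "K = (\<lambda>x. (fst x - prj \<phi> (fst x) + pinv \<phi> (snd x), Ci (\<phi> (fst x))))"
  have GK: "K (G x) = x" for x
  proof -
    let ?w = "fst x - prj \<phi> (fst x)"
    have z: "\<phi> ?w = 0" "prj \<phi> ?w = 0" using prj_diff0[OF assms] by (simp_all add: prj_def linear_0[OF lpin])
    then have "\<phi> (?w + adjoint \<phi> (snd x)) = \<phi> (adjoint \<phi> (snd x))"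
      "prj \<phi> (?w + adjoint \<phi> (snd x)) = adjoint \<phi> (snd x)"
      unfolding linear_add[OF l] linear_add[OF lp] pa by simp_all
    then show ?thesis by (simp add: G_def K_def Ci prj_def[symmetric] prod_eq_iff)
  qed
  have G: "linear G"
    unfolding G_def linear_iff
    by (simp add: linear_add[OF l] linear_add[OF lp] linear_add[OF ladj] linear_scale[OF l] linear_scale[OF lp] linear_scale[OF ladj] algebra_simps)
  have "inj G" using GK by (metis injI)
  then have bG: "bij G" using G by (simp add: bij_def linear_injective_imp_surjective)
  have iG: "inv G y = K y" for y using GK[of "inv G y"] bG by (simp add: bij_is_surj surj_f_inv_f)
  \<comment> \<open>The kernel component of \<open>p\<close> is orthogonal to
    \<open>pinv \<phi> b\<close>, so the Gaussian exponent splits into a function of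
    \<open>p\<close> and one of \<open>b\<close>.\<close>
  have nK: "(norm (K (p, b)))\<^sup>2 = (norm (K (p, 0)))\<^sup>2 + qform \<phi> b" for p b
    using pinv_ortho_diff[OF assms, of b p]
    by (simp add: K_def norm_Pair qform_def linear_0[OF lpin])
      (simp add: power2_norm_eq_inner inner_add_left inner_add_right inner_commute)
  note [measurable] = borel_measurable_linear[OF G] borel_measurable_linear[OF l] borel_measurable_linear[OF lp]
    borel_measurable_linear[OF lpin] borel_measurable_linear[OF lCi] qform_measurable[OF assms]
  have Km[measurable]: "K \<in> borel_measurable borel"
    unfolding K_def borel_prod[symmetric] by measurable
  define d where "d = sqrt pi ^ DIM('e \<times> 'a)"
  have d: "d > 0" by (simp add: d_def)
  obtain c where c: "c > 0" "distr std_gauss borel G = density lborel (\<lambda>b. ennreal c * ennreal (exp (- (norm (inv G b))\<^sup>2) / d))"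
    using distr_density_linear[OF G bG, of "\<lambda>w. ennreal (exp (- (norm w)\<^sup>2) / d)"]
    unfolding std_gauss_def d_def by auto
  define I where "I = (\<integral>\<^sup>+p. ennreal (c / d * exp (- (norm (K (p, 0)))\<^sup>2)) \<partial>lborel)"
  have "distr std_gauss borel \<phi> = distr (distr (std_gauss :: ('e \<times> 'a) measure) borel G) borel snd"
  proof -
    have [measurable]: "fst \<in> borel_measurable (borel :: ('e \<times> 'a) measure)"
        "snd \<in> borel_measurable (borel :: ('e \<times> 'a) measure)"
      by (rule borel_measurable_linear[OF linear_fst], rule borel_measurable_linear[OF linear_snd])
    have "distr std_gauss borel \<phi> = distr (distr (std_gauss :: ('e \<times> 'a) measure) borel fst) borel \<phi>"
      by (simp add: distr_std_gauss_fst)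
    also have "\<dots> = distr std_gauss borel (snd \<circ> G)"
      by (subst distr_distr) (simp_all add: o_def G_def)
    also have "\<dots> = distr (distr (std_gauss :: ('e \<times> 'a) measure) borel G) borel snd"
      by (subst distr_distr) simp_all
    finally show ?thesis .
  qed
  also have "\<dots> = density lborel (\<lambda>b. \<integral>\<^sup>+p. ennreal c * ennreal (exp (- (norm (inv G (p, b)))\<^sup>2) / d) \<partial>lborel)"
    unfolding c(2) by (rule distr_density_snd) (simp add: iG)
  also have "\<dots> = density lborel (\<lambda>b. I * ennreal (exp (- qform \<phi> b)))"
  proof -
    have "(\<integral>\<^sup>+p. ennreal c * ennreal (exp (- (norm (inv G (p, b)))\<^sup>2) / d) \<partial>lborel)
       = (\<integral>\<^sup>+p. ennreal (c / d * exp (- (norm (K (p, 0)))\<^sup>2)) * ennreal (exp (- qform \<phi> b)) \<partial>lborel)" for b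
      unfolding iG nK[of _ b] using c d
      by (intro nn_integral_cong) (simp add: ennreal_mult[symmetric] exp_diff exp_minus field_simps)
    also have "\<dots> b = I * ennreal (exp (- qform \<phi> b))" for b
      unfolding I_def by (rule nn_integral_multc) (simp add: borel_prod[symmetric])
    finally show ?thesis by simp
  qed
  finally have law: "distr std_gauss borel \<phi> = density lborel (\<lambda>b. I * ennreal (exp (- qform \<phi> b)))" .
  interpret prob_space "distr std_gauss borel \<phi>"
    by (rule prob_space.prob_space_distr[OF prob_space_std_gauss]) measurable
  \<comment> \<open>The fibre integral \<open>I\<close> might be infinite a priori; total mass 1
    forces it to be positive and finite.\<close>
  have one: "I * (\<integral>\<^sup>+b. ennreal (exp (- qform \<phi> b)) \<partial>lborel) = 1"
    using emeasure_space_1 unfolding law by (simp add: emeasure_density nn_integral_cmult)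
  have "(\<integral>\<^sup>+b. ennreal (exp (- qform \<phi> b)) \<partial>lborel) \<noteq> 0"
    using one by auto
  then have "I < \<infinity>" using one by (cases "I = \<infinity>") (auto simp: ennreal_top_mult less_top)
  moreover have "I \<noteq> 0" using one by auto
  ultimately have "I = ennreal (enn2real I)" "enn2real I > 0"
    by (auto simp: less_top enn2real_positive_iff zero_less_iff_neq_zero)
  then show ?thesis unfolding law
    by (intro exI[of _ "enn2real I"]) (simp add: ennreal_mult)
qed

text \<open>The normalizing constant, essentially an inverse determinant; only its positivity and
  the total mass 1 that it produces are ever used.\<close>

definition gconst :: "('e::euclidean_space \<Rightarrow> 'a::euclidean_space) \<Rightarrow> real" where
  "gconst \<phi> = (SOME c. c > 0 \<and> distr std_gauss borel \<phi> = density lborel (\<lambda>a. ennreal (c * exp (- qform \<phi> a))))"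

definition gdens :: "('e::euclidean_space \<Rightarrow> 'a::euclidean_space) \<Rightarrow> 'a \<Rightarrow> real" where
  "gdens \<phi> a = gconst \<phi> * exp (- qform \<phi> a)"

lemma gconst_pos: "lsurj \<phi> \<Longrightarrow> 0 < gconst \<phi>"
  and law_gdens: "lsurj \<phi> \<Longrightarrow> distr std_gauss borel \<phi> = density lborel (\<lambda>a. ennreal (gdens \<phi> a))"
  using someI_ex[OF law_density[of \<phi>, unfolded Bex_def], folded gconst_def] by (simp_all add: gdens_def)

lemma gdens_pos: "lsurj \<phi> \<Longrightarrow> 0 < gdens \<phi> a"
  by (simp add: gdens_def gconst_pos)

lemma gdens_measurable[measurable]: "lsurj \<phi> \<Longrightarrow> gdens \<phi> \<in> borel_measurable borel"
  unfolding gdens_def by measurable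

lemma prob_space_distr_std_gauss:
  "\<phi> \<in> borel_measurable borel \<Longrightarrow> prob_space (distr std_gauss borel \<phi>)"
  by (rule prob_space.prob_space_distr[OF prob_space_std_gauss]) measurable

lemma gdens_shift:
  assumes "lsurj \<phi>"
  shows "density lborel (\<lambda>a. ennreal (gdens \<phi> (a - m))) = distr std_gauss borel (\<lambda>e. m + \<phi> e)"
proof -
  note [measurable] = borel_measurable_linear[OF lsurj_linear[OF assms]] gdens_measurable[OF assms]
  have "distr std_gauss borel (\<lambda>e. m + \<phi> e) = distr (distr std_gauss borel \<phi>) borel ((+) m)"
    by (simp add: distr_distr o_def)
  also have "\<dots> = density lborel (\<lambda>a. ennreal (gdens \<phi> (a - m)))"
  proof (rule measure_eqI)
    fix S assume "S \<in> sets (distr (distr std_gauss borel \<phi>) borel ((+) m))"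
    then have [measurable]: "S \<in> sets borel" by simp
    have "emeasure (distr (distr std_gauss borel \<phi>) borel ((+) m)) S
        = (\<integral>\<^sup>+a. ennreal (gdens \<phi> (a + m - m)) * indicator S (a + m) \<partial>lborel)"
      unfolding law_gdens[OF assms] by (subst emeasure_distr_density) (auto simp: add.commute)
    also have "\<dots> = (\<integral>\<^sup>+a. ennreal (gdens \<phi> (a - m)) * indicator S a \<partial>lborel)"
      by (rule nn_integral_lborel_shift) measurable
    finally show "emeasure (distr (distr std_gauss borel \<phi>) borel ((+) m)) S
      = emeasure (density lborel (\<lambda>a. ennreal (gdens \<phi> (a - m)))) S" by (simp add: emeasure_density)
  qed simp
  finally show ?thesis ..
qed

lemma prob_space_gdens: "lsurj \<phi> \<Longrightarrow> prob_space (density lborel (\<lambda>a. ennreal (gdens \<phi> (a - m))))"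
  using borel_measurable_linear[OF lsurj_linear[of \<phi>]]
  by (subst gdens_shift) (auto intro!: prob_space_distr_std_gauss)

lemma nn_integral_gdens:
  assumes "lsurj \<phi>" shows "(\<integral>\<^sup>+a. ennreal (gdens \<phi> (a - m)) \<partial>lborel) = 1"
  using prob_space.emeasure_space_1[OF prob_space_gdens[OF assms, of m]] gdens_measurable[OF assms]
  by (simp add: emeasure_density)

text \<open>By \<open>qform_pair\<close> both sides agree up to a constant factor, and both have
  integral 1.\<close>

lemma gdens_pair:
  assumes s: "lsurj (\<phi> \<star> \<psi>)"
  shows "gdens (\<phi> \<star> \<psi>) (a, b) = gdens (resid \<phi> \<psi>) (a - \<phi> (pinv \<psi> b)) * gdens \<psi> b"
proof -
  note s' = lsurj_pairD[OF s] resid_lsurj[OF s]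
  let ?p = "\<lambda>e. (\<phi> e, \<psi> e)" and ?r = "resid \<phi> \<psi>"
  define c where "c = gconst ?p / (gconst ?r * gconst \<psi>)"
  have c: "c > 0" by (simp add: c_def gconst_pos s s')
  have eq: "gdens ?p (a, b) = c * (gdens ?r (a - \<phi> (pinv \<psi> b)) * gdens \<psi> b)" for a b
    using gconst_pos[OF s'(2)] gconst_pos[OF s'(3)]
    by (simp add: gdens_def qform_pair[OF s] c_def exp_diff exp_minus field_simps exp_add)
  note [measurable] = gdens_measurable[OF s] gdens_measurable[OF s'(3)] gdens_measurable[OF s'(2)]
    borel_measurable_linear[OF lsurj_linear[OF s'(1)]] borel_measurable_linear[OF pinv_linear[OF s'(2)]]
  have [measurable]: "(\<lambda>x. ennreal (gdens ?p x)) \<in> borel_measurable (lborel \<Otimes>\<^sub>M lborel)"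
    by (simp add: lborel_prod)
  have "1 = (\<integral>\<^sup>+x. ennreal (gdens ?p x) \<partial>(lborel \<Otimes>\<^sub>M lborel))"
    using nn_integral_gdens[OF s, of 0] by (simp add: lborel_prod)
  also have "\<dots> = (\<integral>\<^sup>+b. \<integral>\<^sup>+a. ennreal (gdens ?p (a, b)) \<partial>lborel \<partial>lborel)"
    by (subst lborel_pair.nn_integral_snd[symmetric]) simp_all
  also have "\<dots> = (\<integral>\<^sup>+b. \<integral>\<^sup>+a. ennreal (c * gdens \<psi> b) * ennreal (gdens ?r (a - \<phi> (pinv \<psi> b))) \<partial>lborel \<partial>lborel)"
    using c gdens_pos[OF s'(2)] gdens_pos[OF s'(3)]
    by (simp add: eq ennreal_mult[symmetric] mult_ac less_imp_le)
  also have "\<dots> = (\<integral>\<^sup>+b. ennreal c * ennreal (gdens \<psi> (b - 0)) \<partial>lborel)"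
    using c gdens_pos[OF s'(2)]
    by (subst nn_integral_cmult, measurable) (simp add: nn_integral_gdens s' ennreal_mult less_imp_le)
  also have "\<dots> = ennreal c" by (subst nn_integral_cmult, measurable) (simp only: nn_integral_gdens s' mult_1_right)
  finally have "c = 1" using c by simp
  then show ?thesis using eq by simp
qed

section \<open>Conditional laws\<close>

text \<open>For each fixed \<open>S\<close> the two densities agree off a null set depending on
  \<open>S\<close>. A countable generator closed under intersections gives one null set for all
  Borel sets.\<close>

lemma kernel_ae_unique:
  fixes \<kappa> \<kappa>' :: "'b::euclidean_space \<Rightarrow> 'a::euclidean_space measure"
  assumes "finite_measure N"
    and N[measurable_cong]: "sets N = sets borel"
    and k: "\<kappa> \<in> borel \<rightarrow>\<^sub>M prob_algebra borel" "\<kappa>' \<in> borel \<rightarrow>\<^sub>M prob_algebra borel"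
    and eq: "\<And>S T. S \<in> sets borel \<Longrightarrow> T \<in> sets borel \<Longrightarrow>
      (\<integral>\<^sup>+b. emeasure (\<kappa> b) S * indicator T b \<partial>N) = (\<integral>\<^sup>+b. emeasure (\<kappa>' b) S * indicator T b \<partial>N)"
  shows "AE b in N. \<kappa> b = \<kappa>' b"
proof -
  interpret finite_measure N by fact
  obtain B :: "'a set set" where B: "countable B" "topological_basis B"
    using ex_countable_basis by blast
  \<comment> \<open>Finite intersections keep the basis countable and make it intersection-stable;
    the empty intersection contributes the whole space.\<close>
  define E where "E = Inter ` {F. finite F \<and> F \<subseteq> B}"
  have E: "countable E" unfolding E_def using countable_Collect_finite_subset[OF B(1)] by blast
  have EO: "S \<in> E \<Longrightarrow> open S" for S
    using topological_basis_open[OF B(2)] by (auto simp: E_def intro!: open_Inter)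
  have IE: "Int_stable E"
    unfolding E_def Int_stable_def
  proof safe
    fix F G assume "finite F" "F \<subseteq> B" "finite G" "G \<subseteq> B"
    then show "\<Inter> F \<inter> \<Inter> G \<in> Inter ` {F. finite F \<and> F \<subseteq> B}"
      by (intro image_eqI[of _ _ "F \<union> G"]) auto
  qed
  have UE: "UNIV \<in> E" unfolding E_def by (rule image_eqI[of _ _ "{}"]) auto
  have BE: "B \<subseteq> E" unfolding E_def by (intro subsetI image_eqI[of _ _ "{x}" for x]) auto
  have sE: "sigma_sets UNIV E = sets borel"
  proof (rule antisym)
    show "sigma_sets UNIV E \<subseteq> sets borel"
      using EO sets.sigma_sets_subset[of E "borel :: 'a measure"] by (auto simp: subset_eq)
    have "sets (borel :: 'a measure) = sigma_sets UNIV B"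
      unfolding borel_eq_countable_basis[OF B] by (rule sets_measure_of) simp
    also have "\<dots> \<subseteq> sigma_sets UNIV E" by (rule sigma_sets_mono'[OF BE])
    finally show "sets (borel :: 'a measure) \<subseteq> sigma_sets UNIV E" .
  qed
  have K: "sets (\<kappa> b) = sets borel" "prob_space (\<kappa> b)" "sets (\<kappa>' b) = sets borel" "prob_space (\<kappa>' b)" for b
    using measurable_space[OF k(1), of b] measurable_space[OF k(2), of b] by (auto simp: space_prob_algebra)
  have "AE b in N. emeasure (\<kappa> b) S = emeasure (\<kappa>' b) S" if "S \<in> E" for S
  proof -
    have S: "S \<in> sets borel" using EO[OF that] by auto
    have [measurable]: "(\<lambda>b. emeasure (\<kappa> b) S) \<in> borel_measurable borel" "(\<lambda>b. emeasure (\<kappa>' b) S) \<in> borel_measurable borel"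
      using S k[THEN measurable_prob_algebraD] by (auto intro: measurable_emeasure_kernel)
    show ?thesis
      by (rule density_unique_finite_measure) (auto simp: N intro!: eq[OF S])
  qed
  then have "AE b in N. \<forall>S\<in>E. emeasure (\<kappa> b) S = emeasure (\<kappa>' b) S"
    by (subst AE_ball_countable[OF E]) auto
  then show ?thesis
  proof (rule AE_mp, intro AE_I2 impI)
    fix b assume b: "\<forall>S\<in>E. emeasure (\<kappa> b) S = emeasure (\<kappa>' b) S"
    interpret kb: prob_space "\<kappa> b" by (rule K)
    show "\<kappa> b = \<kappa>' b"
      by (rule measure_eqI_generator_eq[OF IE, where \<Omega>=UNIV and A="\<lambda>_. UNIV"])
        (use b UE K sE in auto)
  qed
qed

text \<open>Removes the arbitrary choice in \<open>cond_law\<close>: any explicit version may be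
  used off a null set.\<close>

lemma cond_law_ae:
  fixes A :: "'w \<Rightarrow> 'a::euclidean_space" and B :: "'w \<Rightarrow> 'b::euclidean_space"
  assumes "prob_space M" and [measurable]: "B \<in> borel_measurable M" and "is_cond_law M A B \<kappa>"
  shows "AE b in distr M borel B. cond_law M A B b = \<kappa> b"
proof (rule kernel_ae_unique)
  show "finite_measure (distr M borel B)"
    using prob_space.prob_space_distr[OF assms(1,2)] by (rule prob_space.finite_measure)
  have c: "is_cond_law M A B (cond_law M A B)"
    unfolding cond_law_def by (rule someI[of "is_cond_law M A B"]) (rule assms(3))
  show "cond_law M A B \<in> borel \<rightarrow>\<^sub>M prob_algebra borel" "\<kappa> \<in> borel \<rightarrow>\<^sub>M prob_algebra borel"
    using c assms(3) by (auto simp: is_cond_law_def)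
  show "(\<integral>\<^sup>+b. emeasure (cond_law M A B b) S * indicator T b \<partial>distr M borel B)
    = (\<integral>\<^sup>+b. emeasure (\<kappa> b) S * indicator T b \<partial>distr M borel B)"
    if "S \<in> sets borel" "T \<in> sets borel" for S T
  proof -
    have "emeasure M {\<omega> \<in> space M. A \<omega> \<in> S \<and> B \<omega> \<in> T} = (\<integral>\<^sup>+b. emeasure (\<kappa>' b) S * indicator T b \<partial>distr M borel B)"
      if "is_cond_law M A B \<kappa>'" for \<kappa>' using that \<open>S \<in> _\<close> \<open>T \<in> _\<close> by (simp add: is_cond_law_def)
    from this[OF c] this[OF assms(3)] show ?thesis by simp
  qed
qed simp

text \<open>The dictionary between random vectors on \<open>M\<close> and linear maps on a source
  space. \<open>\<phi>\<close> may fail to be surjective, so singular laws are included.\<close>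

definition glaw :: "'w measure \<Rightarrow> ('w \<Rightarrow> 'a::euclidean_space) \<Rightarrow> ('e::euclidean_space \<Rightarrow> 'a) \<Rightarrow> bool" where
  "glaw M A \<phi> \<longleftrightarrow> A \<in> borel_measurable M \<and> linear \<phi> \<and> distr M borel A = distr std_gauss borel \<phi>"

lemma glaw_map:
  assumes "glaw M A \<phi>" "linear \<theta>"
  shows "glaw M (\<lambda>\<omega>. \<theta> (A \<omega>)) (\<lambda>e. \<theta> (\<phi> e))"
proof -
  have l: "linear \<phi>" and [measurable]: "A \<in> borel_measurable M" and d: "distr M borel A = distr std_gauss borel \<phi>"
    using assms by (auto simp: glaw_def)
  note [measurable] = borel_measurable_linear[OF assms(2)] borel_measurable_linear[OF l]
  have "distr M borel (\<lambda>\<omega>. \<theta> (A \<omega>)) = distr std_gauss borel (\<lambda>e. \<theta> (\<phi> e))"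
    using distr_distr[of \<theta> borel borel A M] distr_distr[of \<theta> borel borel \<phi> std_gauss] d by (simp add: o_def)
  then show ?thesis using linear_compose[OF l assms(2)] by (simp add: glaw_def o_def)
qed

lemma glaw_law:
  assumes "glaw M A \<phi>" "lsurj \<phi>"
  shows "distr M borel A = density lborel (\<lambda>a. ennreal (gdens \<phi> a))"
  using assms by (simp add: glaw_def law_gdens)

text \<open>The density is strictly positive, so the law and Lebesgue measure have the same null
  sets. Exceptional sets arising from different conditionings can then be combined.\<close>

lemma glaw_AE:
  assumes "glaw M A \<phi>" "lsurj \<phi>"
  shows "(AE a in distr M borel A. P a) \<longleftrightarrow> (AE a in lborel. P a)"
  unfolding glaw_law[OF assms] using gdens_measurable[OF assms(2)] gdens_pos[OF assms(2)]
  by (subst AE_density) auto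

lemma is_cond_law_gauss:
  fixes A :: "'w \<Rightarrow> 'a::euclidean_space" and B :: "'w \<Rightarrow> 'b::euclidean_space"
  assumes g: "glaw M (A \<star> B) (\<phi> \<star> \<psi>)" and s: "lsurj (\<phi> \<star> \<psi>)"
  shows "is_cond_law M A B (\<lambda>b. density lborel (\<lambda>a. ennreal (gdens (resid \<phi> \<psi>) (a - \<phi> (pinv \<psi> b)))))"
proof -
  note s' = lsurj_pairD[OF s] resid_lsurj[OF s]
  let ?p = "\<lambda>e. (\<phi> e, \<psi> e)" and ?r = "resid \<phi> \<psi>"
  note [measurable] = gdens_measurable[OF s] gdens_measurable[OF s'(3)] gdens_measurable[OF s'(2)]
    borel_measurable_linear[OF lsurj_linear[OF s'(1)]] borel_measurable_linear[OF pinv_linear[OF s'(2)]]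
  have gB: "glaw M B \<psi>" using glaw_map[OF g linear_snd] by simp
  have gA: "glaw M A \<phi>" using glaw_map[OF g linear_fst] by simp
  have [measurable]: "A \<in> borel_measurable M" "B \<in> borel_measurable M" using gA gB by (auto simp: glaw_def)
  show ?thesis unfolding is_cond_law_def
  proof (intro conjI ballI)
    show "(\<lambda>b. density lborel (\<lambda>a. ennreal (gdens ?r (a - \<phi> (pinv \<psi> b))))) \<in> borel \<rightarrow>\<^sub>M prob_algebra borel"
    proof (rule measurable_prob_algebraI)
      fix b show "prob_space (density lborel (\<lambda>a. ennreal (gdens ?r (a - \<phi> (pinv \<psi> b)))))" by (rule prob_space_gdens[OF s'(3)])
    next
      show "(\<lambda>b. density lborel (\<lambda>a. ennreal (gdens ?r (a - \<phi> (pinv \<psi> b))))) \<in> borel \<rightarrow>\<^sub>M subprob_algebra borel"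
        by (rule measurable_subprob_algebra)
          (auto simp: emeasure_density intro!: prob_space_imp_subprob_space prob_space_gdens[OF s'(3)])
    qed
  next
    fix S :: "'a set" and T :: "'b set" assume [measurable]: "S \<in> sets borel" "T \<in> sets borel"
    have ST: "S \<times> T \<in> sets borel" unfolding borel_prod[symmetric] by simp
    have [measurable]: "S \<times> T \<in> sets borel" by (rule ST)
    have "emeasure M {\<omega> \<in> space M. A \<omega> \<in> S \<and> B \<omega> \<in> T} = emeasure (distr M borel (A \<star> B)) (S \<times> T)"
      by (subst emeasure_distr) (auto simp: ST intro!: arg_cong[where f="emeasure M"])
    also have "\<dots> = (\<integral>\<^sup>+x. ennreal (gdens ?p x) * indicator (S \<times> T) x \<partial>(lborel \<Otimes>\<^sub>M lborel))"
      unfolding glaw_law[OF g s] lborel_prod by (rule emeasure_density) (simp_all add: ST)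
    also have "\<dots> = (\<integral>\<^sup>+b. \<integral>\<^sup>+a. ennreal (gdens ?p (a, b)) * indicator (S \<times> T) (a, b) \<partial>lborel \<partial>lborel)"
      by (rule lborel_pair.nn_integral_snd[symmetric]) (simp add: lborel_prod)
    also have "\<dots> = (\<integral>\<^sup>+b. \<integral>\<^sup>+a. (ennreal (gdens \<psi> b) * indicator T b) * (ennreal (gdens ?r (a - \<phi> (pinv \<psi> b))) * indicator S a) \<partial>lborel \<partial>lborel)"
      using gdens_pos[OF s'(2)] gdens_pos[OF s'(3)]
      by (simp add: gdens_pair[OF s] ennreal_mult less_imp_le mult_ac indicator_times)
    also have "\<dots> = (\<integral>\<^sup>+b. (ennreal (gdens \<psi> b) * indicator T b) * (\<integral>\<^sup>+a. (ennreal (gdens ?r (a - \<phi> (pinv \<psi> b))) * indicator S a) \<partial>lborel) \<partial>lborel)"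
      by (intro nn_integral_cong nn_integral_cmult) measurable
    also have "\<dots> = (\<integral>\<^sup>+b. emeasure (density lborel (\<lambda>a. ennreal (gdens ?r (a - \<phi> (pinv \<psi> b))))) S * indicator T b \<partial>distr M borel B)"
      unfolding glaw_law[OF gB s'(2)]
      by (simp add: nn_integral_density emeasure_density mult_ac)
    finally show "emeasure M {\<omega> \<in> space M. A \<omega> \<in> S \<and> B \<omega> \<in> T} =
      (\<integral>\<^sup>+b. emeasure (density lborel (\<lambda>a. ennreal (gdens ?r (a - \<phi> (pinv \<psi> b))))) S * indicator T b \<partial>distr M borel B)" .
  qed
qed

lemma cond_law_gauss:
  fixes A :: "'w \<Rightarrow> 'a::euclidean_space" and B :: "'w \<Rightarrow> 'b::euclidean_space"
  assumes "prob_space M" and g: "glaw M (A \<star> B) (\<phi> \<star> \<psi>)" and s: "lsurj (\<phi> \<star> \<psi>)"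
  shows "AE b in lborel. cond_law M A B b = density lborel (\<lambda>a. ennreal (gdens (resid \<phi> \<psi>) (a - \<phi> (pinv \<psi> b))))"
proof -
  have gB: "glaw M B \<psi>" using glaw_map[OF g linear_snd] by simp
  then have "B \<in> borel_measurable M" by (simp add: glaw_def)
  from cond_law_ae[OF assms(1) this is_cond_law_gauss[OF g s]]
  show ?thesis by (simp add: glaw_AE[OF gB lsurj_pairD(2)[OF s]])
qed

section \<open>Relative entropy of Gaussian laws\<close>

lemma qform_affine_integral:
  fixes q :: "'e::euclidean_space \<Rightarrow> 'a::euclidean_space" and \<sigma> :: "'f::euclidean_space \<Rightarrow> 'a"
  assumes "lsurj \<sigma>" "linear q"
  shows "\<exists>c. \<forall>p. has_bochner_integral std_gauss (\<lambda>w. qform \<sigma> (p + q w)) (qform \<sigma> p + c)"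
proof -
  have "linear (\<lambda>w. pinv \<sigma> (q w))" using linear_compose[OF assms(2) pinv_linear[OF assms(1)]] by (simp add: o_def)
  from std_gauss_norm2[OF this] obtain c where
    c: "\<And>p. has_bochner_integral std_gauss (\<lambda>w. (norm (p + pinv \<sigma> (q w)))\<^sup>2) ((norm p)\<^sup>2 + c)" by blast
  show ?thesis
    using c[of "pinv \<sigma> p" for p] by (intro exI[of _ c]) (simp add: qform_def linear_add[OF pinv_linear[OF assms(1)]])
qed

text \<open>\<open>h\<close> is the logarithm of the density ratio; its integral exists because
  Gaussian quadratic moments do. Nonnegativity is stated separately because \<open>ennreal\<close>
  sends negative reals to 0.\<close>

lemma kl_gauss:
  fixes \<rho> :: "'e::euclidean_space \<Rightarrow> 'a::euclidean_space" and \<sigma> :: "'f::euclidean_space \<Rightarrow> 'a"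
    and m m' :: 'a
  assumes r: "lsurj \<rho>" and s: "lsurj \<sigma>"
  defines "h \<equiv> \<lambda>a. ln (gconst \<rho> / gconst \<sigma>) + qform \<sigma> (a - m') - qform \<rho> (a - m)"
  shows "kl (density lborel (\<lambda>a. ennreal (gdens \<rho> (a - m)))) (density lborel (\<lambda>a. ennreal (gdens \<sigma> (a - m'))))
      = ennreal (\<integral>e. h (m + \<rho> e) \<partial>std_gauss)"
    and "0 \<le> (\<integral>e. h (m + \<rho> e) \<partial>std_gauss)"
proof -
  define p where "p = (\<lambda>a. gdens \<rho> (a - m))"
  define q where "q = (\<lambda>a. gdens \<sigma> (a - m'))"
  define P where "P = density lborel (\<lambda>a. ennreal (p a))"
  define Q where "Q = density lborel (\<lambda>a. ennreal (q a))"
  note [measurable] = gdens_measurable[OF r] gdens_measurable[OF s] qform_measurable[OF r] qform_measurable[OF s]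
    borel_measurable_linear[OF lsurj_linear[OF r]]
  have [measurable]: "p \<in> borel_measurable borel" "q \<in> borel_measurable borel" "h \<in> borel_measurable borel"
    by (simp_all add: p_def q_def h_def)
  have pos: "p a > 0" "q a > 0" for a by (simp_all add: p_def q_def gdens_pos r s)
  interpret P: prob_space P unfolding P_def p_def by (rule prob_space_gdens[OF r])
  interpret Q: prob_space Q unfolding Q_def q_def by (rule prob_space_gdens[OF s])
  have q0: "q a \<noteq> 0" for a using pos(2)[of a] by simp
  have PQ: "P = density Q (\<lambda>a. ennreal (p a / q a))"
    unfolding P_def Q_def using pos
    by (subst density_density_eq) (auto simp: ennreal_mult[symmetric] less_imp_le q0 intro!: density_cong)
  have ac: "absolutely_continuous Q P" unfolding PQ by (rule absolutely_continuousI_density) (simp add: Q_def)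
  have hpq: "log (exp 1) (p a / q a) = h a" for a
    using gconst_pos[OF r] gconst_pos[OF s]
    by (simp add: p_def q_def gdens_def h_def log_def ln_mult ln_div)
  have "AE a in Q. ennreal (p a / q a) = RN_deriv Q P a"
    by (rule Q.RN_deriv_unique) (simp_all add: PQ Q_def)
  then have "AE a in Q. entropy_density (exp 1) Q P a = h a"
  proof eventually_elim
    fix a assume "ennreal (p a / q a) = RN_deriv Q P a"
    then have "enn2real (RN_deriv Q P a) = p a / q a"
      using pos[of a] by (metis enn2real_ennreal less_imp_le divide_nonneg_nonneg)
    then show "entropy_density (exp 1) Q P a = h a"
      by (simp add: entropy_density_def hpq)
  qed
  then have ae: "AE a in P. entropy_density (exp 1) Q P a = h a"
    by (rule absolutely_continuous_AE[OF _ ac, rotated]) (simp add: P_def Q_def)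
  have Pd: "P = distr std_gauss borel (\<lambda>e. m + \<rho> e)" unfolding P_def p_def by (rule gdens_shift[OF r])
  obtain c1 where c1: "\<And>p. has_bochner_integral std_gauss (\<lambda>w. qform \<sigma> (p + \<rho> w)) (qform \<sigma> p + c1)"
    using qform_affine_integral[OF s lsurj_linear[OF r]] by blast
  obtain c2 where c2: "\<And>p. has_bochner_integral std_gauss (\<lambda>w. qform \<rho> (p + \<rho> w)) (qform \<rho> p + c2)"
    using qform_affine_integral[OF r lsurj_linear[OF r]] by blast
  interpret S: prob_space "std_gauss :: 'e measure" by (rule prob_space_std_gauss)
  have "integrable std_gauss (\<lambda>e. h (m + \<rho> e))"
    using c1[of "m - m'"] c2[of 0] unfolding h_def
    by (intro Bochner_Integration.integrable_add Bochner_Integration.integrable_diff)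
      (auto simp: has_bochner_integral_iff algebra_simps)
  then have hi: "integrable P h" unfolding Pd by (subst integrable_distr_eq) auto
  have "entropy_density (exp 1) Q P \<in> borel_measurable P"
    using measurable_entropy_density[of "exp 1" Q P] by (simp add: P_def Q_def)
  then have ei: "integrable P (entropy_density (exp 1) Q P)"
    using hi ae by (subst integrable_cong_AE[where g=h]) (auto simp: P_def)
  have KL: "KL_divergence (exp 1) Q P = integral\<^sup>L P h"
    unfolding KL_divergence_def using ae \<open>entropy_density (exp 1) Q P \<in> borel_measurable P\<close>
    by (intro integral_cong_AE) (auto simp: P_def)
  have hd: "integral\<^sup>L P h = (\<integral>e. h (m + \<rho> e) \<partial>std_gauss)" unfolding Pd by (subst integral_distr) auto
  have "integrable lborel (\<lambda>x. p x * log (exp 1) (p x / q x))"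
    using hi unfolding hpq P_def by (subst (asm) integrable_density) (auto simp: pos less_imp_le)
  then have "0 \<le> KL_divergence (exp 1) Q P"
    using P.prob_space_axioms Q.prob_space_axioms less_imp_le[OF pos(1)] less_imp_le[OF pos(2)]
    unfolding P_def Q_def
    by (intro lborel.KL_density_density_nonneg) (simp_all add: always_eventually q0)
  then show "0 \<le> (\<integral>e. h (m + \<rho> e) \<partial>std_gauss)" using KL hd by simp
  show "kl (density lborel (\<lambda>a. ennreal (gdens \<rho> (a - m)))) (density lborel (\<lambda>a. ennreal (gdens \<sigma> (a - m'))))
      = ennreal (\<integral>e. h (m + \<rho> e) \<partial>std_gauss)"
    using ac ei KL hd unfolding kl_def P_def[unfolded p_def, symmetric] Q_def[unfolded q_def, symmetric] by simp
qed

section \<open>Divergences between conditional laws as functions of u\<close>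

lemma pinv_base:
  assumes "lsurj (y \<star> w)"
  shows "pinv (y \<star> w) (y0, w (pinv y y0)) = pinv y y0"
  using lsurj_pairD[OF assms]
  by (intro pinv_eqI[OF assms]) (auto simp: pinv_right pinv_ortho zero_prod_def)

lemma AE_lborel_pair:
  fixes P :: "'a::euclidean_space \<times> 'b::euclidean_space \<Rightarrow> bool"
  assumes "AE z in lborel. P z"
  shows "AE a in lborel. AE b in lborel. P (a, b)"
  using assms unfolding lborel_prod[symmetric] by (rule lborel_pair.AE_pair)

lemma std_gauss_const: "has_bochner_integral (std_gauss :: 'e::euclidean_space measure) (\<lambda>_. c) (c::real)"
proof -
  interpret prob_space "std_gauss :: 'e measure" by (rule prob_space_std_gauss)
  show ?thesis using prob_space by (simp add: has_bochner_integral_iff)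
qed

text \<open>\<open>qform_bayes2\<close> makes the dependence on \<open>u0\<close> explicit: the law
  of X given \<open>u0\<close> enters through the residual of \<open>u\<close> on \<open>x\<close>,
  and averaging over X given \<open>y0\<close> moves the centre to the averaged prediction.
  Everything free of \<open>u0\<close> goes into \<open>c\<close>. In the update, Y0 takes the role
  of X here.\<close>

lemma kl_cond_gauss:
  fixes x :: "'e::euclidean_space \<Rightarrow> 'x::euclidean_space" and y :: "'e \<Rightarrow> 'y::euclidean_space"
    and u :: "'e \<Rightarrow> 'u::euclidean_space"
  assumes M: "prob_space M"
    and gY: "glaw M (X \<star> Y) (x \<star> y)" and sY: "lsurj (x \<star> y)"
    and gU: "glaw M (X \<star> U) (x \<star> u)" and sU: "lsurj (x \<star> u)"
  defines "D \<equiv> \<lambda>u0 y0. qform (resid u x) (u0 - u (prj x (pinv y y0))) - qform u u0"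
  shows "\<exists>c. AE y0 in lborel. AE u0 in lborel.
    kl (cond_law M X Y y0) (cond_law M X U u0) = ennreal (c y0 + D u0 y0) \<and> 0 \<le> c y0 + D u0 y0"
proof -
  note su = lsurj_pairD[OF sU] and sy = lsurj_pairD[OF sY]
  note l = lsurj_linear[OF sy(1)] lsurj_linear[OF sy(2)] lsurj_linear[OF su(2)]
  note rr = resid_lsurj[OF sY] and rs = resid_lsurj[OF sU] and ru = resid_lsurj[OF qform_swap2(2)[OF sU]]
  define k where "k = ln (gconst (resid x y) / gconst (resid x u))"
  have lpx: "linear (\<lambda>e. pinv x (resid x y e))"
    using linear_compose[OF lsurj_linear[OF rr] pinv_linear[OF sy(1)]] by (simp add: o_def)
  have lq: "linear (\<lambda>e. - u (pinv x (resid x y e)))"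
    using linear_compose_neg[OF linear_compose[OF lpx l(3)]] by (simp add: o_def)
  obtain c1 where c1: "\<And>p. has_bochner_integral std_gauss (\<lambda>e. qform (resid u x) (p + - u (pinv x (resid x y e)))) (qform (resid u x) p + c1)"
    using qform_affine_integral[OF ru lq] by blast
  obtain c2 where c2: "\<And>p. has_bochner_integral std_gauss (\<lambda>e. qform x (p + resid x y e)) (qform x p + c2)"
    using qform_affine_integral[OF sy(1) lsurj_linear[OF rr]] by blast
  obtain c3 where c3: "\<And>p. has_bochner_integral std_gauss (\<lambda>e. qform (resid x y) (p + resid x y e)) (qform (resid x y) p + c3)"
    using qform_affine_integral[OF rr lsurj_linear[OF rr]] by blast
  define c where "c = (\<lambda>y0. k + c1 + (qform x (x (pinv y y0)) + c2) - (qform (resid x y) 0 + c3))"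
  have *: "kl (density lborel (\<lambda>a. ennreal (gdens (resid x y) (a - x (pinv y y0))))) (density lborel (\<lambda>a. ennreal (gdens (resid x u) (a - x (pinv u u0)))))
      = ennreal (c y0 + D u0 y0) \<and> 0 \<le> c y0 + D u0 y0" for y0 u0
  proof -
    define p where "p = pinv y y0"
    define h where "h = (\<lambda>a. k + qform (resid x u) (a - x (pinv u u0)) - qform (resid x y) (a - x p))"
    have "h (x p + resid x y e) = k + (qform (resid u x) ((u0 - u (prj x p)) + - u (pinv x (resid x y e)))
        + qform x (x p + resid x y e) - qform u u0) - qform (resid x y) (0 + resid x y e)" for e
      unfolding h_def qform_bayes2[OF sU]
      by (simp add: linear_add[OF pinv_linear[OF sy(1)]] linear_add[OF l(3)] prj_def algebra_simps)
    then have heq: "(\<lambda>e. h (x p + resid x y e)) = (\<lambda>e. k + (qform (resid u x) ((u0 - u (prj x p)) + - u (pinv x (resid x y e)))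
        + qform x (x p + resid x y e) - qform u u0) - qform (resid x y) (0 + resid x y e))" by (rule ext)
    have "has_bochner_integral std_gauss (\<lambda>e. k + (qform (resid u x) ((u0 - u (prj x p)) + - u (pinv x (resid x y e)))
        + qform x (x p + resid x y e) - qform u u0) - qform (resid x y) (0 + resid x y e))
        (k + ((qform (resid u x) (u0 - u (prj x p)) + c1) + (qform x (x p) + c2) - qform u u0) - (qform (resid x y) 0 + c3))"
      by (intro has_bochner_integral_add has_bochner_integral_diff std_gauss_const c1 c2 c3)
    then have "has_bochner_integral std_gauss (\<lambda>e. h (x p + resid x y e)) (c y0 + D u0 y0)"
      unfolding heq by (rule back_subst[of "has_bochner_integral std_gauss _"]) (simp add: c_def D_def p_def)
    then have "(\<integral>e. h (x p + resid x y e) \<partial>std_gauss) = c y0 + D u0 y0" by (simp add: has_bochner_integral_iff)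
    then show ?thesis
      using kl_gauss[OF rr rs, where m="x p" and m'="x (pinv u u0)"]
      unfolding h_def k_def p_def by simp
  qed
  have "AE y0 in lborel. AE u0 in lborel.
    kl (cond_law M X Y y0) (cond_law M X U u0) = ennreal (c y0 + D u0 y0) \<and> 0 \<le> c y0 + D u0 y0"
    using cond_law_gauss[OF M gY sY]
  proof eventually_elim
    case (elim y0)
    show ?case using cond_law_gauss[OF M gU sU] by eventually_elim (simp only: elim *)
  qed
  then show ?thesis by blast
qed

lemma lsurj_images:
  assumes "lsurj \<phi>" "linear \<theta>" "surj \<theta>"
  shows "lsurj (\<lambda>e. \<theta> (\<phi> e))"
  using lsurj_comp assms unfolding lsurj_def by auto

lemma lsurj_drop_mid:
  assumes "lsurj (x \<star> y \<star> w)"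
  shows "lsurj (x \<star> w)" "lsurj (w \<star> y)" "lsurj (y \<star> w)"
  using lsurj_images[OF assms, of "\<lambda>(x, y, w). (x, w)"] lsurj_images[OF assms, of "\<lambda>(x, y, w). (w, y)"]
    lsurj_images[OF assms, of "\<lambda>(x, y, w). (y, w)"]
  by (simp_all add: linear_iff split_beta surj_def)

text \<open>The two averages, over W given \<open>y0\<close> and over X given
  \<open>(y0, w0)\<close>, are simulated by two independent copies of the source; the expected
  divergence becomes one integral of a quadratic polynomial, expanded by
  \<open>qform_bayes3\<close>.\<close>

lemma expected_kl_gauss:
  fixes x :: "'e::euclidean_space \<Rightarrow> 'x::euclidean_space" and y :: "'e \<Rightarrow> 'y::euclidean_space"
    and u :: "'e \<Rightarrow> 'u::euclidean_space" and w :: "'e \<Rightarrow> 'w::euclidean_space"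
  assumes M: "prob_space M"
    and gY: "glaw M (X \<star> Y \<star> W) (x \<star> y \<star> w)" and sY: "lsurj (x \<star> y \<star> w)"
    and gU: "glaw M (X \<star> U \<star> W) (x \<star> u \<star> w)" and sU: "lsurj (x \<star> u \<star> w)"
  defines "D \<equiv> \<lambda>u0 y0. qform (resid u (x \<star> w)) (u0 - u (prj (x \<star> w) (pinv y y0)))
     - qform (resid u w) (u0 - u (prj w (pinv y y0)))"
  shows "\<exists>c. AE y0 in lborel. AE u0 in lborel.
    expected_kl M X W Y U u0 y0 = ennreal (c y0 + D u0 y0) \<and> 0 \<le> c y0 + D u0 y0"
proof -
  let ?yw = "\<lambda>e. (y e, w e)" and ?uw = "\<lambda>e. (u e, w e)" and ?xw = "\<lambda>e. (x e, w e)"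
  have syw: "lsurj ?yw" and suw: "lsurj ?uw" and sxw: "lsurj ?xw" and swy: "lsurj (w \<star> y)"
    using lsurj_drop_mid[OF sY] lsurj_drop_mid[OF sU] by auto
  note sx = lsurj_pairD(1)[OF sY] and sy = lsurj_pairD(1)[OF syw] and sw = lsurj_pairD(2)[OF syw]
    and su = lsurj_pairD(1)[OF suw]
  note l = sx[THEN lsurj_linear] sy[THEN lsurj_linear] sw[THEN lsurj_linear] su[THEN lsurj_linear]
  define \<rho> where "\<rho> = resid x ?yw"
  define \<sigma> where "\<sigma> = resid x ?uw"
  define \<tau> where "\<tau> = resid w y"
  have r: "lsurj \<rho>" and s: "lsurj \<sigma>" and t: "lsurj \<tau>"
    unfolding \<rho>_def \<sigma>_def \<tau>_def by (intro resid_lsurj sY sU swy)+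
  have su_xw: "lsurj (u \<star> ?xw)" by (rule qform_swap3(2)[OF sU])
  have rux: "lsurj (resid u ?xw)" and ruw: "lsurj (resid u w)" by (intro resid_lsurj su_xw suw)+
  define k where "k = ln (gconst \<rho> / gconst \<sigma>)"
  \<comment> \<open>The fluctuation of \<open>(x, w)\<close> given Y = \<open>y0\<close>: the first
    copy drives the residual of \<open>w\<close>, which also shifts \<open>x\<close> by regression,
    and the second copy drives what remains of \<open>x\<close>.\<close>
  define L where "L = (\<lambda>z::'e\<times>'e. (x (pinv ?yw (0, \<tau> (fst z))) + \<rho> (snd z), \<tau> (fst z)))"
  have lt: "linear (\<lambda>z::'e\<times>'e. \<tau> (fst z))" and lr: "linear (\<lambda>z::'e\<times>'e. \<rho> (snd z))"
    using linear_compose[OF linear_fst lsurj_linear[OF t]] linear_compose[OF linear_snd lsurj_linear[OF r]]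
    by (simp_all add: o_def)
  have lL: "linear L"
    unfolding L_def
    using linear_compose[OF linear_compose[OF linear_pair[OF linear_zero lt] pinv_linear[OF syw]] l(1)] lr
    by (intro linear_pair lt linear_compose_add) (simp_all add: o_def)
  have lq1: "linear (\<lambda>z. - u (pinv ?xw (L z)))"
    using linear_compose_neg[OF linear_compose[OF linear_compose[OF lL pinv_linear[OF sxw]] l(4)]] by (simp add: o_def)
  have lq3: "linear (\<lambda>z::'e\<times>'e. - u (pinv w (\<tau> (fst z))))"
    using linear_compose_neg[OF linear_compose[OF linear_compose[OF lt pinv_linear[OF sw]] l(4)]] by (simp add: o_def)
  obtain c1 where c1: "\<And>p. has_bochner_integral std_gauss (\<lambda>z. qform (resid u ?xw) (p + - u (pinv ?xw (L z)))) (qform (resid u ?xw) p + c1)"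
    using qform_affine_integral[OF rux lq1] by blast
  obtain c2 where c2: "\<And>p. has_bochner_integral std_gauss (\<lambda>z. qform ?xw (p + L z)) (qform ?xw p + c2)"
    using qform_affine_integral[OF sxw lL] by blast
  obtain c3 where c3: "\<And>p. has_bochner_integral std_gauss (\<lambda>z::'e\<times>'e. qform (resid u w) (p + - u (pinv w (\<tau> (fst z))))) (qform (resid u w) p + c3)"
    using qform_affine_integral[OF ruw lq3] by blast
  obtain c4 where c4: "\<And>p. has_bochner_integral std_gauss (\<lambda>z::'e\<times>'e. qform w (p + \<tau> (fst z))) (qform w p + c4)"
    using qform_affine_integral[OF sw lt] by blast
  obtain c5 where c5: "\<And>p. has_bochner_integral std_gauss (\<lambda>z::'e\<times>'e. qform \<rho> (p + \<rho> (snd z))) (qform \<rho> p + c5)"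
    using qform_affine_integral[OF r lr] by blast
  define c where "c = (\<lambda>y0. k + c1 + (qform ?xw (?xw (pinv y y0)) + c2) - c3 - (qform w (w (pinv y y0)) + c4) - (qform \<rho> 0 + c5))"
  define N where "N = (\<lambda>y0 w0. density lborel (\<lambda>a. ennreal (gdens \<rho> (a - x (pinv ?yw (y0, w0))))))"
  define N' where "N' = (\<lambda>u0 w0. density lborel (\<lambda>a. ennreal (gdens \<sigma> (a - x (pinv ?uw (u0, w0))))))"
  have *: "(\<integral>\<^sup>+w0. kl (N y0 w0) (N' u0 w0) \<partial>density lborel (\<lambda>a. ennreal (gdens \<tau> (a - w (pinv y y0)))))
      = ennreal (c y0 + D u0 y0) \<and> 0 \<le> c y0 + D u0 y0" for y0 u0
  proof -
    define p where "p = pinv y y0"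
    define H where "H = (\<lambda>w0 e. k + qform \<sigma> (x (pinv ?yw (y0, w0)) + \<rho> e - x (pinv ?uw (u0, w0))) - qform \<rho> (\<rho> e))"
    have kl: "kl (N y0 w0) (N' u0 w0) = ennreal (\<integral>e. H w0 e \<partial>std_gauss)" "0 \<le> (\<integral>e. H w0 e \<partial>std_gauss)" for w0
      using kl_gauss[OF r s, where m="x (pinv ?yw (y0, w0))" and m'="x (pinv ?uw (u0, w0))"]
      unfolding N_def N'_def H_def k_def by (simp_all add: add_diff_eq)
    \<comment> \<open>Centres \<open>w\<close> at its prediction from \<open>y0\<close>. There the
      least-norm preimage of the pair is the one of \<open>y0\<close> alone, and the rest is linear
      in the deviation \<open>t0\<close>.\<close>
    have pyw: "pinv ?yw (y0, w p + t0) = p + pinv ?yw (0, t0)" for t0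
      using linear_add[OF pinv_linear[OF syw], of "(y0, w p)" "(0, t0)"] pinv_base[OF syw, of y0] by (simp add: p_def)
    have Hz: "H (w p + \<tau> (fst z)) (snd z) = k + (qform (resid u ?xw) ((u0 - u (prj ?xw p)) + - u (pinv ?xw (L z)))
       + qform ?xw (?xw p + L z) - qform (resid u w) ((u0 - u (prj w p)) + - u (pinv w (\<tau> (fst z)))) - qform w (w p + \<tau> (fst z)))
       - qform \<rho> (0 + \<rho> (snd z))" for z
    proof -
      have 1: "(x (pinv ?yw (y0, w p + \<tau> (fst z))) + \<rho> (snd z), w p + \<tau> (fst z)) = ?xw p + L z"
        by (simp add: pyw L_def linear_add[OF l(1)])
      show ?thesis
        unfolding H_def \<sigma>_def qform_bayes3[OF sU] 1
        by (simp add: linear_add[OF pinv_linear[OF sxw]] linear_add[OF pinv_linear[OF sw]] linear_add[OF l(4)] prj_def algebra_simps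
            del: add_Pair)
    qed
    have Hi: "has_bochner_integral std_gauss (\<lambda>z. H (w p + \<tau> (fst z)) (snd z)) (c y0 + D u0 y0)"
    proof -
      have "has_bochner_integral std_gauss (\<lambda>z. H (w p + \<tau> (fst z)) (snd z))
       (k + ((qform (resid u ?xw) (u0 - u (prj ?xw p)) + c1)
       + (qform ?xw (?xw p) + c2) - (qform (resid u w) (u0 - u (prj w p)) + c3) - (qform w (w p) + c4)) - (qform \<rho> 0 + c5))"
        unfolding Hz by (intro has_bochner_integral_add has_bochner_integral_diff std_gauss_const c1 c2 c3 c4 c5)
      then show ?thesis
        by (rule back_subst[of "has_bochner_integral std_gauss _"]) (simp add: c_def D_def p_def)
    qed
    note [measurable] = qform_measurable[OF r] qform_measurable[OF s] borel_measurable_linear[OF lsurj_linear[OF r]]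
      borel_measurable_linear[OF lsurj_linear[OF t]]
      borel_measurable_linear[OF l(1)] borel_measurable_linear[OF pinv_linear[OF syw]] borel_measurable_linear[OF pinv_linear[OF suw]]
    interpret S: prob_space "std_gauss :: 'e measure" by (rule prob_space_std_gauss)
    interpret SS: pair_sigma_finite "std_gauss :: 'e measure" "std_gauss :: 'e measure" ..
    have Hm[measurable]: "(\<lambda>(w0, e). H w0 e) \<in> borel_measurable (borel \<Otimes>\<^sub>M std_gauss)"
      unfolding H_def by measurable
    have i2: "integrable (std_gauss \<Otimes>\<^sub>M std_gauss) (\<lambda>(e', e). H (w p + \<tau> e') e)"
      and v2: "integral\<^sup>L (std_gauss \<Otimes>\<^sub>M std_gauss) (\<lambda>(e', e). H (w p + \<tau> e') e) = c y0 + D u0 y0"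
      using Hi unfolding std_gauss_prod_measure has_bochner_integral_iff by (simp_all add: split_beta')
    have "(\<integral>\<^sup>+w0. kl (N y0 w0) (N' u0 w0) \<partial>density lborel (\<lambda>a. ennreal (gdens \<tau> (a - w (pinv y y0)))))
      = (\<integral>\<^sup>+w0. ennreal (\<integral>e. H w0 e \<partial>std_gauss) \<partial>distr std_gauss borel (\<lambda>e'. w p + \<tau> e'))"
      unfolding gdens_shift[OF t] p_def[symmetric] kl(1) ..
    also have "\<dots> = (\<integral>\<^sup>+e'. ennreal (\<integral>e. H (w p + \<tau> e') e \<partial>std_gauss) \<partial>std_gauss)"
      by (subst nn_integral_distr) measurable
    also have "\<dots> = ennreal (\<integral>e'. (\<integral>e. H (w p + \<tau> e') e \<partial>std_gauss) \<partial>std_gauss)"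
      using SS.integrable_fst[OF i2] kl(2) by (intro nn_integral_eq_integral) auto
    also have "(\<integral>e'. (\<integral>e. H (w p + \<tau> e') e \<partial>std_gauss) \<partial>std_gauss) = c y0 + D u0 y0"
      using SS.integral_fst[OF i2] v2 by simp
    moreover have "0 \<le> (\<integral>e'. (\<integral>e. H (w p + \<tau> e') e \<partial>std_gauss) \<partial>std_gauss)"
      by (rule Bochner_Integration.integral_nonneg) (rule kl(2))
    ultimately show ?thesis by simp
  qed
  have gWY: "glaw M (W \<star> Y) (w \<star> y)"
    using glaw_map[OF gY, of "\<lambda>(x, y, w). (w, y)"] by (simp add: linear_iff split_beta)
  have A1: "AE y0 in lborel. cond_law M W Y y0 = density lborel (\<lambda>a. ennreal (gdens \<tau> (a - w (pinv y y0))))"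
    using cond_law_gauss[OF M gWY swy] by (simp add: \<tau>_def)
  \<comment> \<open>The chosen version is Gaussian only off a null set of pairs, which Fubini turns
    into nested almost-everywhere statements.\<close>
  have A2: "AE y0 in lborel. AE w0 in lborel. cond_law M X (Y \<star> W) (y0, w0) = N y0 w0"
    using AE_lborel_pair[OF cond_law_gauss[OF M gY sY]] by (simp add: N_def \<rho>_def)
  have A3: "AE u0 in lborel. AE w0 in lborel. cond_law M X (U \<star> W) (u0, w0) = N' u0 w0"
    using AE_lborel_pair[OF cond_law_gauss[OF M gU sU]] by (simp add: N'_def \<sigma>_def)
  have "AE y0 in lborel. AE u0 in lborel.
    expected_kl M X W Y U u0 y0 = ennreal (c y0 + D u0 y0) \<and> 0 \<le> c y0 + D u0 y0"
    using A1 A2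
  proof eventually_elim
    case (elim y0)
    note 1 = elim(1) and 2 = elim(2)
    show ?case using A3
    proof eventually_elim
      case (elim u0)
      have "AE w0 in lborel. kl (cond_law M X (Y \<star> W) (y0, w0)) (cond_law M X (U \<star> W) (u0, w0))
          = kl (N y0 w0) (N' u0 w0)"
        using 2 elim by eventually_elim simp
      \<comment> \<open>The law of W given \<open>y0\<close> has a density, so the Lebesgue-null set
        of bad \<open>w0\<close> does not affect the integral.\<close>
      then have "AE w0 in density lborel (\<lambda>a. ennreal (gdens \<tau> (a - w (pinv y y0)))).
          kl (cond_law M X (Y \<star> W) (y0, w0)) (cond_law M X (U \<star> W) (u0, w0))
          = kl (N y0 w0) (N' u0 w0)"
        using gdens_measurable[OF t] by (subst AE_density) auto
      then have "expected_kl M X W Y U u0 y0 = (\<integral>\<^sup>+w0. kl (N y0 w0) (N' u0 w0) \<partial>density lborel (\<lambda>a. ennreal (gdens \<tau> (a - w (pinv y y0)))))"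
        unfolding expected_kl_def 1 by (rule nn_integral_cong_AE)
      then show ?case using *[of y0 u0] by simp
    qed
  qed
  then show ?thesis by blast
qed

text \<open>The part of -ln (q(u) exp (- psi)) that depends on \<open>u0\<close>. The argument
  \<open>p\<close> is a source point, taken to be \<open>pinv y y0\<close>; its projection
  \<open>prj b p\<close> is then the mean, given Y = \<open>y0\<close>, of the prediction of the
  source from \<open>b\<close>.\<close>

definition upd_exponent ::
  "('e::euclidean_space \<Rightarrow> 'x::euclidean_space) \<Rightarrow> ('e \<Rightarrow> 'v::euclidean_space) \<Rightarrow> ('e \<Rightarrow> 'n::euclidean_space)
    \<Rightarrow> ('e \<Rightarrow> 'u::euclidean_space) \<Rightarrow> real \<Rightarrow> real \<Rightarrow> 'u \<Rightarrow> 'e \<Rightarrow> real" where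
  "upd_exponent x v n u s1 s u0 p =
     1 / s * qform (resid u (x \<star> n)) (u0 - u (prj (x \<star> n) p))
     - (1 - s1) / s * qform (resid u (v \<star> n)) (u0 - u (prj (v \<star> n) p))
     + (s - s1) / s * qform (resid u n) (u0 - u (prj n p))"

text \<open>Adds the three divergences to the logarithm of q(u): the forms of \<open>u\<close> alone
  cancel, and only residual forms remain.\<close>

lemma upd_weight_gauss:
  fixes x :: "'e::euclidean_space \<Rightarrow> complex^'x" and v :: "'e \<Rightarrow> complex^'v" and n :: "'e \<Rightarrow> complex^'n"
    and y :: "'e \<Rightarrow> complex^'y" and u :: "'e \<Rightarrow> complex^'u"
  assumes M: "prob_space M"
    and g: "glaw M (X \<star> V \<star> Y0 \<star> Y \<star> U) (x \<star> v \<star> n \<star> y \<star> u)"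
    and sY: "lsurj (x \<star> y \<star> v \<star> n)" and sU: "lsurj (x \<star> u \<star> v \<star> n)"
    and ci: "\<And>e. u (prj (x \<star> v \<star> n) e) = u (prj (x \<star> n) e)"
    and s: "0 < s1" "s1 \<le> 1" "0 < s"
  shows "\<exists>c. AE y0 in lborel. AE u0 in lborel.
    upd_weight M X Y0 Y U V s1 s u0 y0 = ennreal (exp (c y0 - upd_exponent x v n u s1 s u0 (pinv y y0)))"
proof -
  have gA: "glaw M (X \<star> Y \<star> V \<star> Y0) (x \<star> y \<star> v \<star> n)"
    and gB: "glaw M (X \<star> U \<star> V \<star> Y0) (x \<star> u \<star> v \<star> n)"
    and gC: "glaw M (X \<star> Y \<star> Y0) (x \<star> y \<star> n)"
    and gD: "glaw M (X \<star> U \<star> Y0) (x \<star> u \<star> n)"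
    and gE: "glaw M (Y0 \<star> Y) (n \<star> y)"
    and gF: "glaw M (Y0 \<star> U) (n \<star> u)"
    and gU: "glaw M U u"
    using glaw_map[OF g, of "\<lambda>(x, v, n, y, u). (x, y, v, n)"] glaw_map[OF g, of "\<lambda>(x, v, n, y, u). (x, u, v, n)"]
      glaw_map[OF g, of "\<lambda>(x, v, n, y, u). (x, y, n)"] glaw_map[OF g, of "\<lambda>(x, v, n, y, u). (x, u, n)"]
      glaw_map[OF g, of "\<lambda>(x, v, n, y, u). (n, y)"] glaw_map[OF g, of "\<lambda>(x, v, n, y, u). (n, u)"]
      glaw_map[OF g, of "\<lambda>(x, v, n, y, u). u"]
    by (simp_all add: linear_iff split_beta)
  have sC: "lsurj (x \<star> y \<star> n)" and sD: "lsurj (x \<star> u \<star> n)"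
    and sE: "lsurj (n \<star> y)" and sF: "lsurj (n \<star> u)"
    using lsurj_images[OF sY, of "\<lambda>(x, y, v, n). (x, y, n)"] lsurj_images[OF sU, of "\<lambda>(x, y, v, n). (x, y, n)"]
      lsurj_images[OF sY, of "\<lambda>(x, y, v, n). (n, y)"] lsurj_images[OF sU, of "\<lambda>(x, y, v, n). (n, y)"]
    by (simp_all add: linear_iff split_beta surj_def)
  have su: "lsurj u" using lsurj_pairD(2)[OF sF] .
  \<comment> \<open>By \<open>ci\<close> the other agent's variable drops out next to (X, Y0), so
    both divergences of laws of X lead to the same form \<open>J1\<close>.\<close>
  have resid: "resid u (x \<star> v \<star> n) = resid u (x \<star> n)"
    using ci lsurj_linear[OF su] by (auto simp: resid_def fun_eq_iff linear_diff)
  define J1 where "J1 = (\<lambda>u0 y0. qform (resid u (x \<star> n)) (u0 - u (prj (x \<star> n) (pinv y y0))))"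
  define J2 where "J2 = (\<lambda>u0 y0. qform (resid u (v \<star> n)) (u0 - u (prj (v \<star> n) (pinv y y0))))"
  define J3 where "J3 = (\<lambda>u0 y0. qform (resid u n) (u0 - u (prj n (pinv y y0))))"
  note J = J1_def J2_def J3_def
  obtain c1 where c1: "AE y0 in lborel. AE u0 in lborel. expected_kl M X (V \<star> Y0) Y U u0 y0
      = ennreal (c1 y0 + (J1 u0 y0 - J2 u0 y0)) \<and> 0 \<le> c1 y0 + (J1 u0 y0 - J2 u0 y0)"
    using expected_kl_gauss[OF M gA sY gB sU] unfolding resid ci J by blast
  obtain c2 where c2: "AE y0 in lborel. AE u0 in lborel. expected_kl M X Y0 Y U u0 y0
      = ennreal (c2 y0 + (J1 u0 y0 - J3 u0 y0)) \<and> 0 \<le> c2 y0 + (J1 u0 y0 - J3 u0 y0)"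
    using expected_kl_gauss[OF M gC sC gD sD] unfolding J by blast
  obtain c3 where c3: "AE y0 in lborel. AE u0 in lborel. kl (cond_law M Y0 Y y0) (cond_law M Y0 U u0)
      = ennreal (c3 y0 + (J3 u0 y0 - qform u u0)) \<and> 0 \<le> c3 y0 + (J3 u0 y0 - qform u u0)"
    using kl_cond_gauss[OF M gE sE gF sF] unfolding J by blast
  have "AE u0 in lborel. ennreal (gdens u u0) = RN_deriv lborel (distr M borel U) u0"
    using gdens_measurable[OF su]
    by (intro sigma_finite_measure.RN_deriv_unique[OF sigma_finite_lborel]) (simp_all add: glaw_law[OF gU su])
  note c0 = this
  define c where "c = (\<lambda>y0. ln (gconst u) - (1 - s1) / s * c1 y0 - s1 / s * c2 y0 - c3 y0)"
  have "AE y0 in lborel. AE u0 in lborel.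
    upd_weight M X Y0 Y U V s1 s u0 y0 = ennreal (exp (c y0 - upd_exponent x v n u s1 s u0 (pinv y y0)))"
    using c1 c2 c3
  proof eventually_elim
    case (elim y0)
    then show ?case using c0
    proof eventually_elim
      case (elim u0)
      define e1 where "e1 = c1 y0 + (J1 u0 y0 - J2 u0 y0)"
      define e2 where "e2 = c2 y0 + (J1 u0 y0 - J3 u0 y0)"
      define e3 where "e3 = c3 y0 + (J3 u0 y0 - qform u u0)"
      have e1: "expected_kl M X (V \<star> Y0) Y U u0 y0 = ennreal e1" "0 \<le> e1"
        and e2: "expected_kl M X Y0 Y U u0 y0 = ennreal e2" "0 \<le> e2"
        and e3: "kl (cond_law M Y0 Y y0) (cond_law M Y0 U u0) = ennreal e3" "0 \<le> e3"
        unfolding e1_def e2_def e3_def using elim by blast+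
      define \<psi> where "\<psi> = (1 - s1) / s * e1 + s1 / s * e2 + e3"
      \<comment> \<open>Nonnegative weights, by \<open>s1 \<le> 1\<close>, together with the
        nonnegativity of \<open>e1\<close>, \<open>e2\<close>, \<open>e3\<close>, allow the extended
        sum \<open>psi\<close> to be computed in the reals.\<close>
      have nn: "0 \<le> (1 - s1) / s" "0 \<le> s1 / s" using s by auto
      have "psi M X Y0 Y U V s1 s u0 y0 = ennreal \<psi>" "0 \<le> \<psi>"
        using e3(2) mult_nonneg_nonneg[OF nn(1) e1(2)] mult_nonneg_nonneg[OF nn(2) e2(2)]
        unfolding psi_def e1(1) e2(1) e3(1) \<psi>_def
        by (simp_all only: ennreal_mult[OF nn(1) e1(2), symmetric] ennreal_mult[OF nn(2) e2(2), symmetric]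
            ennreal_plus[symmetric] add_nonneg_nonneg)
      then have "upd_weight M X Y0 Y U V s1 s u0 y0 = ennreal (gdens u u0 * exp (- \<psi>))"
        unfolding upd_weight_def elim(4)[symmetric] exp_neg_def
        using gdens_pos[OF su, of u0] by (simp add: ennreal_mult less_imp_le)
      also have "gdens u u0 * exp (- \<psi>) = exp (ln (gconst u) - qform u u0 - \<psi>)"
        using gconst_pos[OF su] by (simp add: gdens_def exp_diff exp_minus exp_add field_simps)
      also have "ln (gconst u) - qform u u0 - \<psi> = c y0 - upd_exponent x v n u s1 s u0 (pinv y y0)"
      proof -
        have "upd_exponent x v n u s1 s u0 (pinv y y0)
            = 1 / s * J1 u0 y0 - (1 - s1) / s * J2 u0 y0 + (s - s1) / s * J3 u0 y0"
          by (simp only: upd_exponent_def J)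
        then show ?thesis using s by (simp add: \<psi>_def e1_def e2_def e3_def c_def field_simps)
      qed
      finally show ?case .
    qed
  qed
  then show ?thesis by blast
qed

section \<open>Complex-linear maps and covariance matrices\<close>

lemma inner_smult_i: "(x::complex^'n) \<bullet> (\<i> *s y) = - ((\<i> *s x) \<bullet> y)"
  by (simp add: inner_vec_def inner_complex_def vector_scalar_mult_def sum_negf[symmetric])

text \<open>\<open>T\<close> plays multiplication by the imaginary unit on the source space, which is a product of
  spaces and carries no scalar multiplication by complex numbers.\<close>
definition cplx_str :: "('e::euclidean_space \<Rightarrow> 'e) \<Rightarrow> bool" where
  "cplx_str T \<longleftrightarrow> linear T \<and> (\<forall>e. T (T e) = - e) \<and> (\<forall>e f. T e \<bullet> T f = e \<bullet> f)"

text \<open>Intertwining \<open>T\<close> with multiplication by the imaginary unit encodes circular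
  symmetry: the complex covariance then determines all real second moments.\<close>

definition cplx_lin :: "('e::euclidean_space \<Rightarrow> 'e) \<Rightarrow> ('e \<Rightarrow> complex^'a) \<Rightarrow> bool" where
  "cplx_lin T \<phi> \<longleftrightarrow> linear \<phi> \<and> (\<forall>e. \<phi> (T e) = \<i> *s \<phi> e)"

lemma cplx_str_anti: assumes "cplx_str T" shows "e \<bullet> T f = - (T e \<bullet> f)"
proof -
  have "e \<bullet> T f = T e \<bullet> T (T f)" using assms unfolding cplx_str_def by metis
  also have "T (T f) = - f" using assms by (simp add: cplx_str_def)
  finally show ?thesis by (simp only: inner_minus_right)
qed

lemma cplx_lin_adj:
  assumes "cplx_str T" "cplx_lin T \<phi>"
  shows "adjoint \<phi> (\<i> *s a) = T (adjoint \<phi> a)"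
proof -
  have l: "linear \<phi>" using assms(2) by (simp add: cplx_lin_def)
  have "e \<bullet> adjoint \<phi> (\<i> *s a) = e \<bullet> T (adjoint \<phi> a)" for e
    using assms(2) unfolding cplx_str_anti[OF assms(1)] adjoint_works[OF l] inner_smult_i by (simp add: cplx_lin_def)
  then show ?thesis using vector_eq_ldot by blast
qed

text \<open>Real linearity and commutation with the imaginary unit give complex linearity, hence a
  complex matrix.\<close>

lemma complex_linear_matrix:
  fixes g :: "complex^'b \<Rightarrow> complex^'a"
  assumes "linear g" "\<And>b. g (\<i> *s b) = \<i> *s g b"
  shows "matrix g *v b = g b"
proof (rule matrix_works)
  have sc: "c *s x = Re c *\<^sub>R x + Im c *\<^sub>R (\<i> *s x)" for c and x :: "complex^'d"
    by (simp add: vec_eq_iff complex_eq_iff vector_scalar_mult_def)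
  show "Vector_Spaces.linear (*s) (*s) g"
  proof (unfold_locales)
    show "g (b1 + b2) = g b1 + g b2" for b1 b2 using assms(1) by (rule linear_add)
    show "g (c *s b) = c *s g b" for c b
    proof -
      have "g (c *s b) = g (Re c *\<^sub>R b + Im c *\<^sub>R (\<i> *s b))" by (rule arg_cong[OF sc])
      also have "\<dots> = Re c *\<^sub>R g b + Im c *\<^sub>R (\<i> *s g b)" using assms by (simp add: linear_add linear_scale)
      also have "\<dots> = c *s g b" by (rule sc[symmetric])
      finally show ?thesis .
    qed
  qed
qed

lemma vec_nth_inner: "x $ i = complex_of_real (x \<bullet> axis i 1) + \<i> * complex_of_real (x \<bullet> axis i \<i>)"
  for x :: "complex^'n"
  by (simp add: inner_axis inner_complex_def complex_eq_iff)

lemma axis_i: "axis i \<i> = \<i> *s (axis i 1 :: complex^'n)"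
  by (simp add: vec_eq_iff axis_def vector_scalar_mult_def)

lemma has_bochner_integral_complex:
  assumes "has_bochner_integral M f a" "has_bochner_integral M g b"
  shows "has_bochner_integral M (\<lambda>x. complex_of_real (f x) + \<i> * complex_of_real (g x)) (complex_of_real a + \<i> * complex_of_real b)"
  using assms by (intro has_bochner_integral_add has_bochner_integral_mult_right has_bochner_integral_of_real)

lemma glaw_integral:
  fixes f :: "'a::euclidean_space \<Rightarrow> complex"
  assumes "glaw M A \<phi>" "f \<in> borel_measurable borel"
  shows "(\<integral>\<omega>. f (A \<omega>) \<partial>M) = (\<integral>e. f (\<phi> e) \<partial>std_gauss)"
proof -
  have [measurable]: "A \<in> borel_measurable M" "\<phi> \<in> borel_measurable borel" "f \<in> borel_measurable borel"
    and d: "distr M borel A = distr std_gauss borel \<phi>"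
    using assms by (auto simp: glaw_def intro!: borel_measurable_linear)
  have "(\<integral>\<omega>. f (A \<omega>) \<partial>M) = integral\<^sup>L (distr M borel A) f" by (subst integral_distr) auto
  also have "\<dots> = (\<integral>e. f (\<phi> e) \<partial>std_gauss)" unfolding d by (subst integral_distr) auto
  finally show ?thesis .
qed

text \<open>Identifies the complex matrix with a real operator. Each real second moment carries a
  factor 1/2, but an entry of the matrix adds two equal ones, because \<open>T\<close> is an
  isometry.\<close>

lemma cross_cov_apply:
  fixes A :: "'w \<Rightarrow> complex^'a" and B :: "'w \<Rightarrow> complex^'b"
  assumes T: "cplx_str T" "cplx_lin T \<phi>" "cplx_lin T \<psi>" and g: "glaw M (A \<star> B) (\<phi> \<star> \<psi>)"
  shows "cross_cov M A B *v b = \<phi> (adjoint \<psi> b)"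
proof -
  have l: "linear \<phi>" "linear \<psi>" using T by (auto simp: cplx_lin_def)
  have gA: "glaw M A \<phi>" and gB: "glaw M B \<psi>" using glaw_map[OF g linear_fst] glaw_map[OF g linear_snd] by auto
  have mean: "(\<integral>\<omega>. C \<omega> $ i \<partial>M) = 0" if "glaw M C \<theta>" for C and \<theta> :: "_ \<Rightarrow> complex^'d" and i
  proof -
    have lt: "linear \<theta>" using that by (simp add: glaw_def)
    have "has_bochner_integral std_gauss (\<lambda>e. \<theta> e $ i) (complex_of_real 0 + \<i> * complex_of_real 0)"
      unfolding vec_nth_inner[of "\<theta> _"] by (intro has_bochner_integral_complex std_gauss_linear_mean lt)
    moreover have "(\<integral>\<omega>. C \<omega> $ i \<partial>M) = (\<integral>e. \<theta> e $ i \<partial>std_gauss)"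
      by (rule glaw_integral[OF that]) (intro borel_measurable_continuous_onI continuous_intros)
    ultimately show ?thesis by (simp add: has_bochner_integral_iff)
  qed
  have ent: "cross_cov M A B $ i $ j = \<phi> (adjoint \<psi> (axis j 1)) $ i" for i j
  proof -
    define \<alpha> where "\<alpha> = adjoint \<phi> (axis i 1)"
    define \<beta> where "\<beta> = adjoint \<psi> (axis j 1)"
    have ai: "adjoint \<phi> (axis i \<i>) = T \<alpha>" "adjoint \<psi> (axis j \<i>) = T \<beta>"
      unfolding axis_i \<alpha>_def \<beta>_def by (rule cplx_lin_adj[OF T(1,2)], rule cplx_lin_adj[OF T(1,3)])
    \<comment> \<open>Reduces the four real moments of an entry to two: \<open>T\<close> preserves
      inner products and is skew.\<close>
    have TT: "T \<alpha> \<bullet> T \<beta> = \<alpha> \<bullet> \<beta>" "\<alpha> \<bullet> T \<beta> = - (T \<alpha> \<bullet> \<beta>)"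
      using T(1) cplx_str_anti[OF T(1)] by (auto simp: cplx_str_def)
    have "cross_cov M A B $ i $ j = (\<integral>\<omega>. A \<omega> $ i * cnj (B \<omega> $ j) \<partial>M)"
      unfolding cross_cov_def using mean[OF gA] mean[OF gB] by simp
    also have "\<dots> = (\<integral>e. \<phi> e $ i * cnj (\<psi> e $ j) \<partial>std_gauss)"
      using glaw_integral[OF g, of "\<lambda>(a, b). a $ i * cnj (b $ j)"]
      by (simp add: borel_measurable_continuous_onI split_beta continuous_intros)
    also have "\<dots> = complex_of_real (\<alpha> \<bullet> \<beta>) + \<i> * complex_of_real (T \<alpha> \<bullet> \<beta>)"
    proof -
      have "\<phi> e $ i * cnj (\<psi> e $ j) =
          complex_of_real ((\<phi> e \<bullet> axis i 1) * (\<psi> e \<bullet> axis j 1) + (\<phi> e \<bullet> axis i \<i>) * (\<psi> e \<bullet> axis j \<i>))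
          + \<i> * complex_of_real ((\<phi> e \<bullet> axis i \<i>) * (\<psi> e \<bullet> axis j 1) - (\<phi> e \<bullet> axis i 1) * (\<psi> e \<bullet> axis j \<i>))" for e
        by (simp add: inner_axis inner_complex_def complex_eq_iff)
      then have "has_bochner_integral std_gauss (\<lambda>e. \<phi> e $ i * cnj (\<psi> e $ j))
        (complex_of_real (\<alpha> \<bullet> \<beta> / 2 + T \<alpha> \<bullet> T \<beta> / 2) + \<i> * complex_of_real (T \<alpha> \<bullet> \<beta> / 2 - \<alpha> \<bullet> T \<beta> / 2))"
        unfolding ai[symmetric] unfolding \<alpha>_def \<beta>_def
        by (simp only:) (intro has_bochner_integral_complex has_bochner_integral_add has_bochner_integral_diff std_gauss_linear_inner l)
      then show ?thesis by (simp add: has_bochner_integral_iff TT)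
    qed
    also have "\<dots> = \<phi> \<beta> $ i"
    proof -
      have "\<alpha> \<bullet> \<beta> = \<phi> \<beta> \<bullet> axis i 1" "T \<alpha> \<bullet> \<beta> = \<phi> \<beta> \<bullet> axis i \<i>"
        unfolding ai(1)[symmetric] unfolding \<alpha>_def adjoint_works[OF l(1), symmetric] by (simp_all add: inner_commute)
      then show ?thesis unfolding vec_nth_inner[of "\<phi> \<beta>"] by simp
    qed
    finally show ?thesis by (simp add: \<beta>_def)
  qed
  have "cross_cov M A B = matrix (\<lambda>b. \<phi> (adjoint \<psi> b))"
    by (simp add: vec_eq_iff ent matrix_def)
  moreover have "\<phi> (adjoint \<psi> (\<i> *s b)) = \<i> *s \<phi> (adjoint \<psi> b)" for b
    using T(2) by (simp add: cplx_lin_adj[OF T(1,3)] cplx_lin_def)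
  moreover have "linear (\<lambda>b. \<phi> (adjoint \<psi> b))"
    using linear_compose[OF adjoint_linear[OF l(2)] l(1)] by (simp add: o_def)
  ultimately show ?thesis using complex_linear_matrix by metis
qed

section \<open>Covariance matrices and their inverses\<close>

lemma glaw_diag: "glaw M A \<phi> \<Longrightarrow> glaw M (A \<star> A) (\<phi> \<star> \<phi>)"
  using glaw_map[of M A \<phi> "\<lambda>a. (a, a)"] by (simp add: linear_iff)

lemma covm_apply:
  fixes A :: "'w \<Rightarrow> complex^'a"
  assumes "cplx_str T" "cplx_lin T \<phi>" "glaw M A \<phi>"
  shows "covm M A *v b = \<phi> (adjoint \<phi> b)"
  unfolding covm_def by (rule cross_cov_apply[OF assms(1,2,2) glaw_diag[OF assms(3)]])

lemma matrix_inv_left_right: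
  fixes C :: "complex^'n^'n"
  assumes "invertible C"
  shows "matrix_inv C ** C = mat 1" "C ** matrix_inv C = mat 1"
  using assms unfolding invertible_def matrix_inv_def by (metis (mono_tags, lifting) someI_ex)+

lemma matrix_inv_apply:
  fixes C :: "complex^'n^'n"
  assumes "invertible C"
  shows "matrix_inv C *v (C *v x) = x" "C *v (matrix_inv C *v x) = x"
  using matrix_inv_left_right[OF assms] by (simp_all add: matrix_vector_mul_assoc)

lemma invertible_iff_inj:
  fixes C :: "complex^'n^'n"
  shows "invertible C \<longleftrightarrow> (\<forall>x. C *v x = 0 \<longrightarrow> x = 0)"
  by (simp add: invertible_left_inverse matrix_left_invertible_ker)

lemma covm_surj:
  fixes A :: "'w \<Rightarrow> complex^'a"
  assumes "cplx_str T" "cplx_lin T \<phi>" "glaw M A \<phi>" "invertible (covm M A)"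
  shows "lsurj \<phi>"
  using matrix_inv_apply(2)[OF assms(4)] assms(2) unfolding covm_apply[OF assms(1-3)]
  by (auto simp: lsurj_def cplx_lin_def surj_def) metis

lemma covm_inv:
  fixes A :: "'w \<Rightarrow> complex^'a"
  assumes "cplx_str T" "cplx_lin T \<phi>" "glaw M A \<phi>" "lsurj \<phi>"
  shows "invertible (covm M A)" "adjoint \<phi> (matrix_inv (covm M A) *v a) = pinv \<phi> a"
proof -
  note b = bij_cov[OF assms(4)]
  have z: "b = 0" if "\<phi> (adjoint \<phi> b) = 0" for b
    using that b(1) b(2) by (metis bij_is_inj linear_injective_0)
  show i: "invertible (covm M A)"
    unfolding invertible_iff_inj covm_apply[OF assms(1-3)] using z by blast
  have "\<phi> (adjoint \<phi> (matrix_inv (covm M A) *v a)) = a"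
    using matrix_inv_apply(2)[OF i, of a] unfolding covm_apply[OF assms(1-3)] .
  then have "matrix_inv (covm M A) *v a = inv (\<lambda>b. \<phi> (adjoint \<phi> b)) a"
    using b(2) by (metis (no_types, lifting) bij_inv_eq_iff)
  then show "adjoint \<phi> (matrix_inv (covm M A) *v a) = pinv \<phi> a" by (simp add: pinv_def)
qed

lemma adjoint_resid:
  assumes "linear \<phi>" "lsurj \<psi>"
  shows "adjoint (resid \<phi> \<psi>) a = adjoint \<phi> a - prj \<psi> (adjoint \<phi> a)"
proof -
  have "e \<bullet> adjoint (resid \<phi> \<psi>) a = e \<bullet> (adjoint \<phi> a - prj \<psi> (adjoint \<phi> a))" for e
    by (simp add: adjoint_works[OF resid_linear[OF assms]] resid_def adjoint_works[OF assms(1), symmetric]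
        inner_diff_left inner_diff_right prj_selfadj[OF assms(2)])
  then show ?thesis using vector_eq_ldot by blast
qed

lemma resid_adjoint_resid:
  assumes "linear \<phi>" "lsurj \<psi>"
  shows "resid \<phi> \<psi> (adjoint (resid \<phi> \<psi>) a) = resid \<phi> \<psi> (adjoint \<phi> a)"
  unfolding adjoint_resid[OF assms]
  by (simp add: resid_def linear_diff[OF prj_linear[OF assms(2)]]) (simp add: prj_def pinv_right[OF assms(2)])

text \<open>The adjoint of \<open>\<beta>\<close> applied after the inverse covariance of B is
  \<open>pinv \<beta>\<close>, so the subtracted product of matrices is \<open>\<phi>\<close> after
  projection.\<close>

lemma cond_cov_apply:
  fixes A :: "'w \<Rightarrow> complex^'a" and B :: "'w \<Rightarrow> complex^'b"
  assumes T: "cplx_str T" "cplx_lin T \<phi>" "cplx_lin T \<beta>" and g: "glaw M (A \<star> B) (\<phi> \<star> \<beta>)" and s: "lsurj \<beta>"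
  shows "cond_cov M A B *v a = resid \<phi> \<beta> (adjoint \<phi> a)"
proof -
  have gA: "glaw M A \<phi>" and gB: "glaw M B \<beta>" using glaw_map[OF g linear_fst] glaw_map[OF g linear_snd] by auto
  have g': "glaw M (B \<star> A) (\<beta> \<star> \<phi>)"
    using glaw_map[OF g linear_swap2] by simp
  have "cond_cov M A B *v a = \<phi> (adjoint \<phi> a) - \<phi> (adjoint \<beta> (matrix_inv (covm M B) *v (\<beta> (adjoint \<phi> a))))"
    unfolding cond_cov_def matrix_vector_mult_diff_rdistrib matrix_vector_mul_assoc[symmetric]
      cross_cov_apply[OF T g] cross_cov_apply[OF T(1,3,2) g'] covm_apply[OF T(1,2) gA] ..
  also have "\<dots> = resid \<phi> \<beta> (adjoint \<phi> a)"
    unfolding covm_inv(2)[OF T(1,3) gB s] using T(2) by (simp add: resid_def prj_def cplx_lin_def linear_diff)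
  finally show ?thesis .
qed

text \<open>Such a \<open>b\<close> exhibits \<open>adjoint \<phi> b\<close> as the least-norm
  preimage; moving the adjoint across gives its squared norm.\<close>

lemma qform_inv:
  assumes "lsurj \<phi>" "\<phi> (adjoint \<phi> b) = a" shows "qform \<phi> a = a \<bullet> b"
proof -
  have "pinv \<phi> a = adjoint \<phi> b"
    unfolding pinv_def assms(2)[symmetric] inv_f_f[OF bij_is_inj[OF bij_cov(2)[OF assms(1)]]] ..
  then show ?thesis
    using adjoint_works[OF lsurj_linear[OF assms(1)], of "adjoint \<phi> b" b] assms(2)
    by (simp add: qform_def power2_norm_eq_inner)
qed

text \<open>The conditional covariance is the covariance operator of the residual, hence invertible.
  Symmetry of the inverse is what completing the square needs later.\<close>

lemma cond_cov_inv:
  fixes A :: "'w \<Rightarrow> complex^'a" and B :: "'w \<Rightarrow> complex^'b"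
  assumes T: "cplx_str T" "cplx_lin T \<phi>" "cplx_lin T \<beta>" and g: "glaw M (A \<star> B) (\<phi> \<star> \<beta>)" and s: "lsurj (\<phi> \<star> \<beta>)"
  shows "qform (resid \<phi> \<beta>) a = a \<bullet> (matrix_inv (cond_cov M A B) *v a)"
    and "a \<bullet> (matrix_inv (cond_cov M A B) *v b) = (matrix_inv (cond_cov M A B) *v a) \<bullet> b"
proof -
  note s' = lsurj_pairD[OF s] resid_lsurj[OF s]
  let ?r = "resid \<phi> \<beta>"
  have c: "cond_cov M A B *v a = ?r (adjoint ?r a)" for a
    using cond_cov_apply[OF T g s'(2)] resid_adjoint_resid[OF lsurj_linear[OF s'(1)] s'(2)] by simp
  have i: "invertible (cond_cov M A B)"
    unfolding invertible_iff_inj c using bij_cov[OF s'(3)] by (metis bij_is_inj linear_injective_0)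
  note inv = matrix_inv_apply(2)[OF i, unfolded c]
  show "qform ?r a = a \<bullet> (matrix_inv (cond_cov M A B) *v a)" by (rule qform_inv[OF s'(3) inv])
  show "a \<bullet> (matrix_inv (cond_cov M A B) *v b) = (matrix_inv (cond_cov M A B) *v a) \<bullet> b"
    using adjoint_works[OF lsurj_linear[OF s'(3)], of "adjoint ?r (matrix_inv (cond_cov M A B) *v a)" "matrix_inv (cond_cov M A B) *v b"]
     adjoint_works[OF lsurj_linear[OF s'(3)], of "adjoint ?r (matrix_inv (cond_cov M A B) *v b)" "matrix_inv (cond_cov M A B) *v a"]
    unfolding inv by (simp add: inner_commute)
qed

section \<open>Stacked vectors\<close>

lemma linear_stack: "linear (\<lambda>(a, b). stack a b)"
  by (auto simp: linear_iff stack_def vec_eq_iff split: sum.split)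

definition vecl :: "complex^('a::finite + 'b::finite) \<Rightarrow> complex^'a" where "vecl c = (\<chi> i. c $ Inl i)"
definition vecr :: "complex^('a::finite + 'b::finite) \<Rightarrow> complex^'b" where "vecr c = (\<chi> i. c $ Inr i)"

lemma vecl_stack[simp]: "vecl (stack a b) = a" and vecr_stack[simp]: "vecr (stack a b) = b"
  by (simp_all add: vecl_def vecr_def stack_def vec_eq_iff)

lemma vec_lr:
  "vecl (c + d) = vecl c + vecl d" "vecl (r *\<^sub>R c) = r *\<^sub>R vecl c" "vecl (\<i> *s c) = \<i> *s vecl c"
  "vecr (c + d) = vecr c + vecr d" "vecr (r *\<^sub>R c) = r *\<^sub>R vecr c" "vecr (\<i> *s c) = \<i> *s vecr c"
  by (simp_all add: vecl_def vecr_def vec_eq_iff)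

lemma stack_0_iff: "stack a b = 0 \<longleftrightarrow> a = 0 \<and> b = 0"
proof
  assume "stack a b = 0"
  then have "vecl (stack a b) = 0" "vecr (stack a b) = 0" by (simp_all add: vecl_def vecr_def vec_eq_iff)
  then show "a = 0 \<and> b = 0" by simp
qed (simp add: stack_def vec_eq_iff split: sum.split)

lemma stack_vec: "stack (vecl c) (vecr c) = c"
  by (simp add: stack_def vecl_def vecr_def vec_eq_iff split: sum.split)

lemma surj_stack: "surj (\<lambda>(a, b). stack a b)"
  by (rule surjI[of _ "\<lambda>c. (vecl c, vecr c)"]) (simp add: stack_vec)

lemma cplx_lin_stack: "cplx_lin T \<phi> \<Longrightarrow> cplx_lin T \<psi> \<Longrightarrow> cplx_lin T (\<lambda>e. stack (\<phi> e) (\<psi> e))"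
  using linear_compose[OF linear_pair linear_stack, of \<phi> \<psi>]
  by (auto simp: cplx_lin_def o_def stack_def vec_eq_iff split: sum.split)

lemma lsurj_stack: "lsurj (\<phi> \<star> \<psi>) \<Longrightarrow> lsurj (\<lambda>e. stack (\<phi> e) (\<psi> e))"
  using lsurj_images[OF _ linear_stack surj_stack, of "\<lambda>e. (\<phi> e, \<psi> e)"] by simp

text \<open>Stacking only renames coordinates, so the kernel is that of the pair.\<close>

lemma resid_stack:
  assumes "lsurj (\<phi> \<star> \<psi>)"
  shows "prj (\<lambda>e. stack (\<phi> e) (\<psi> e)) = prj (\<phi> \<star> \<psi>)"
    and "resid u (\<lambda>e. stack (\<phi> e) (\<psi> e)) = resid u (\<phi> \<star> \<psi>)"
proof -
  show p: "prj (\<lambda>e. stack (\<phi> e) (\<psi> e)) = prj (\<phi> \<star> \<psi>)"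
    by (rule ext, rule prj_cong_kernel[OF lsurj_stack[OF assms] assms]) (simp add: stack_0_iff zero_prod_def)
  show "resid u (\<lambda>e. stack (\<phi> e) (\<psi> e)) = resid u (\<phi> \<star> \<psi>)"
    by (rule ext) (simp add: resid_def p)
qed

lemma linear_id_stack: "linear (\<lambda>(u, a, b). (u, stack a b))"
  using linear_stack by (auto simp: linear_iff)

lemma surj_id_stack: "surj (\<lambda>(u, a, b). (u, stack a b))"
proof -
  have "\<exists>a b. c = stack a b" for c :: "complex^('d::finite+'e::finite)"
    using surjD[OF surj_stack, of c] by auto
  then show ?thesis unfolding surj_def by auto
qed

lemma cond_cov_stack:
  fixes U :: "'w \<Rightarrow> complex^'u" and A :: "'w \<Rightarrow> complex^'a" and B :: "'w \<Rightarrow> complex^'b"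
  assumes T: "cplx_str T" "cplx_lin T u" "cplx_lin T a" "cplx_lin T b"
    and g: "glaw M (U \<star> A \<star> B) (u \<star> a \<star> b)" and s: "lsurj (u \<star> a \<star> b)"
  shows "qform (resid u (a \<star> b)) r = r \<bullet> (matrix_inv (cond_cov M U (A \<bowtie> B)) *v r)"
    and "r \<bullet> (matrix_inv (cond_cov M U (A \<bowtie> B)) *v t) = (matrix_inv (cond_cov M U (A \<bowtie> B)) *v r) \<bullet> t"
  using cond_cov_inv[OF T(1,2) cplx_lin_stack[OF T(3,4)]] glaw_map[OF g linear_id_stack]
    lsurj_images[OF s linear_id_stack surj_id_stack]
  by (simp_all add: resid_stack(2)[OF lsurj_pairD(2)[OF s]] stack_rv_def)

text \<open>The paper's factor \<open>I - \<Sigma>\<^sub>y\<^sub>|\<^sub>b \<Sigma>\<^sub>y\<^sup>-\<^sup>1\<close> maps \<open>y\<close> to the expectation, given \<open>y\<close>, of the prediction of \<open>Y\<close> from \<open>B\<close>.\<close>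
lemma gain_factor:
  fixes Y :: "'w \<Rightarrow> complex^'y" and B :: "'w \<Rightarrow> complex^'b"
  assumes T: "cplx_str T" "cplx_lin T y" "cplx_lin T b"
    and g: "glaw M (Y \<star> B) (y \<star> b)" and s: "lsurj y" "lsurj b"
  shows "(mat 1 - cond_cov M Y B ** matrix_inv (covm M Y)) *v y0 = y (prj b (pinv y y0))"
proof -
  have gY: "glaw M Y y" using glaw_map[OF g linear_fst] by auto
  show ?thesis
    unfolding matrix_vector_mult_diff_rdistrib matrix_vector_mul_assoc[symmetric] cond_cov_apply[OF T g s(2)]
      covm_inv(2)[OF T(1,2) gY s(1)] matrix_vector_mul_lid
    by (simp add: resid_def linear_diff[OF lsurj_linear[OF s(1)]] pinv_right[OF s(1)])
qed

lemma gain_factor_stack: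
  fixes Y :: "'w \<Rightarrow> complex^'y" and A :: "'w \<Rightarrow> complex^'a" and B :: "'w \<Rightarrow> complex^'b"
  assumes T: "cplx_str T" "cplx_lin T y" "cplx_lin T a" "cplx_lin T b"
    and g: "glaw M (Y \<star> A \<star> B) (y \<star> a \<star> b)" and s: "lsurj y" "lsurj (a \<star> b)"
  shows "(mat 1 - cond_cov M Y (A \<bowtie> B) ** matrix_inv (covm M Y)) *v y0 = y (prj (a \<star> b) (pinv y y0))"
  using gain_factor[OF T(1,2) cplx_lin_stack[OF T(3,4)] _ s(1) lsurj_stack[OF s(2)], of M Y "A \<bowtie> B"]
    glaw_map[OF g linear_id_stack]
  by (simp add: stack_rv_def resid_stack(1)[OF s(2)])

section \<open>Factorization of positive definite matrices\<close>

text \<open>The sesquilinear extension of the real form \<open>a \<bullet> (S *v b)\<close>;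
  Gram-Schmidt has to run over complex scalars to produce a complex factor.\<close>

definition hform :: "complex^'n^'n \<Rightarrow> complex^'n \<Rightarrow> complex^'n \<Rightarrow> complex" where
  "hform S a b = (\<Sum>i\<in>UNIV. cnj (a $ i) * (S *v b) $ i)"

lemma Re_hform: "Re (hform S a b) = a \<bullet> (S *v b)"
  by (simp add: hform_def inner_vec_def inner_complex_def)

lemma hform_right: "hform S a (b + c) = hform S a b + hform S a c" "hform S a (b - c) = hform S a b - hform S a c"
    "hform S a (z *s b) = z * hform S a b"
  by (simp_all add: hform_def matrix_vector_right_distrib matrix_vector_mult_diff_distrib distrib_left right_diff_distrib
      sum.distrib sum_subtractf vector_scalar_commute sum_distrib_left mult_ac)

lemma hform_left: "hform S (z *s a) b = cnj z * hform S a b"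
  by (simp add: hform_def sum_distrib_left mult_ac)

lemma hform_sum: "finite I \<Longrightarrow> hform S a (\<Sum>i\<in>I. f i) = (\<Sum>i\<in>I. hform S a (f i))"
proof (induction I rule: finite_induct)
  case empty then show ?case by (simp add: hform_def)
next
  case (insert i I) then show ?case by (simp add: hform_right)
qed

text \<open>Real symmetry gives the real parts; applied to a vector multiplied by the imaginary
  unit, it also gives the imaginary parts, since \<open>S\<close> is complex linear.\<close>

lemma hform_cnj:
  assumes "\<And>a b. a \<bullet> (S *v b) = (S *v a) \<bullet> b"
  shows "hform S b a = cnj (hform S a b)"
proof -
  have im: "Im (hform S a b) = (\<i> *s a) \<bullet> (S *v b)" for a b
    using Re_hform[of S "\<i> *s a" b] by (simp add: hform_left)
  have "Im (hform S b a) = - Im (hform S a b)"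
    unfolding im using inner_smult_i[of "S *v b" a] assms[of "\<i> *s b" a]
    by (simp add: vector_scalar_commute[symmetric] inner_commute)
  moreover have "Re (hform S b a) = Re (hform S a b)"
    unfolding Re_hform using assms[of b a] by (simp add: inner_commute)
  ultimately show ?thesis by (simp add: complex_eq_iff)
qed

text \<open>Induction on the set of indices already treated. While an index is missing, the span is
  proper by dimension, and a vector outside it can be made orthogonal to the earlier ones and
  rescaled.\<close>

lemma gram_schmidt:
  fixes S :: "complex^'n^'n"
  assumes sym: "\<And>a b. a \<bullet> (S *v b) = (S *v a) \<bullet> b" and pos: "\<And>a. a \<noteq> 0 \<Longrightarrow> 0 < a \<bullet> (S *v a)"
  shows "\<exists>v :: 'n \<Rightarrow> complex^'n. \<forall>i\<in>K. \<forall>j\<in>K. hform S (v i) (v j) = (if i = j then 1 else 0)"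
  using finite[of K]
proof (induction K rule: finite_induct)
  case empty then show ?case by simp
next
  case (insert k K)
  from insert(3) obtain v :: "'n \<Rightarrow> complex^'n" where v: "\<And>i j. i \<in> K \<Longrightarrow> j \<in> K \<Longrightarrow> hform S (v i) (v j) = (if i = j then 1 else 0)"
    by blast
  have "card (v ` K) \<le> card K" by (rule card_image_le) simp
  also have "card K < CARD('n)" using insert(2) by (intro psubset_card_mono) auto
  finally have "vec.dim (v ` K) < CARD('n)" using vec.dim_le_card'[of "v ` K"] by simp
  then have "vec.span (v ` K) \<noteq> UNIV" using vec.dim_span[of "v ` K"] vec_dim_card[where 'a=complex and 'n='n] by (metis less_irrefl)
  then obtain x where x: "x \<notin> vec.span (v ` K)" by auto
  define w where "w = x - (\<Sum>j\<in>K. hform S (v j) x *s v j)"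
  have w0: "w \<noteq> 0"
  proof
    assume "w = 0"
    then have "x = (\<Sum>j\<in>K. hform S (v j) x *s v j)" by (simp add: w_def)
    also have "\<dots> \<in> vec.span (v ` K)" by (intro vec.span_sum vec.span_scale vec.span_base) auto
    finally show False using x by simp
  qed
  have vw: "hform S (v i) w = 0" if "i \<in> K" for i
  proof -
    have "hform S (v i) w = hform S (v i) x - (\<Sum>j\<in>K. hform S (v j) x * hform S (v i) (v j))"
      unfolding w_def by (simp add: hform_right hform_sum)
    also have "(\<Sum>j\<in>K. hform S (v j) x * hform S (v i) (v j)) = (\<Sum>j\<in>K. if i = j then hform S (v j) x else 0)"
      using v[OF that] by (intro sum.cong) simp_all
    finally show ?thesis using that by simp
  qed
  then have wv: "hform S w (v i) = 0" if "i \<in> K" for i using hform_cnj[OF sym, of w "v i"] that by simp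
  define t where "t = w \<bullet> (S *v w)"
  have t: "t > 0" unfolding t_def by (rule pos[OF w0])
  have "Im (hform S w w) = 0" using hform_cnj[OF sym, of w w] by (simp add: complex_eq_iff)
  then have ww: "hform S w w = complex_of_real t" using Re_hform[of S w w] by (simp add: complex_eq_iff t_def)
  define v' where "v' = v(k := complex_of_real (1 / sqrt t) *s w)"
  have "hform S (v' k) (v' k) = 1"
    using t by (simp add: v'_def hform_left hform_right ww flip: of_real_mult of_real_divide)
  then have "\<forall>i\<in>insert k K. \<forall>j\<in>insert k K. hform S (v' i) (v' j) = (if i = j then 1 else 0)"
    using insert(2) v vw wv by (auto simp: v'_def hform_left hform_right)
  then show ?case by blast
qed

text \<open>A matrix V with \<open>S\<close>-orthonormal columns satisfies V^H S V = 1, whence V V^H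
  is the inverse of \<open>S\<close>. Such a factor is the witness demanded by
  \<open>complex_gaussian\<close>.\<close>

lemma pd_factor:
  fixes S :: "complex^'n^'n"
  assumes sym: "\<And>a b. a \<bullet> (S *v b) = (S *v a) \<bullet> b" and pos: "\<And>a. a \<noteq> 0 \<Longrightarrow> 0 < a \<bullet> (S *v a)"
  shows "\<exists>L :: complex^'n^'n. invertible L \<and> L ** conj_transpose L = matrix_inv S" and "invertible S"
proof -
  show i: "invertible S" unfolding invertible_iff_inj using pos by (metis inner_zero_right less_irrefl)
  obtain v :: "'n \<Rightarrow> complex^'n" where v: "\<And>i j. hform S (v i) (v j) = (if i = j then 1 else 0)"
    using gram_schmidt[OF assms, of UNIV] by auto
  define V where "V = (\<chi> i j. v j $ i)"
  have Vax: "column j V = v j" for j by (simp add: column_def V_def vec_eq_iff)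
  have "(conj_transpose V ** (S ** V)) $ i $ j = hform S (v i) (v j)" for i j
    by (simp add: matrix_matrix_mult_def conj_transpose_def hform_def V_def matrix_vector_mult_def)
  then have "conj_transpose V ** (S ** V) = mat 1" by (simp add: vec_eq_iff v mat_def)
  then have 1: "(conj_transpose V ** S) ** V = mat 1" by (simp add: matrix_mul_assoc)
  then have "V ** (conj_transpose V ** S) = mat 1" by (simp add: matrix_left_right_inverse)
  then have "(V ** conj_transpose V) ** S = mat 1" by (simp add: matrix_mul_assoc)
  then have "(V ** conj_transpose V) ** (S ** matrix_inv S) = matrix_inv S"
    by (simp add: matrix_mul_assoc)
  then have "V ** conj_transpose V = matrix_inv S" by (simp add: matrix_inv_left_right(2)[OF i])
  moreover have "invertible V" using 1 invertible_left_inverse by blast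
  ultimately show "\<exists>L :: complex^'n^'n. invertible L \<and> L ** conj_transpose L = matrix_inv S" by blast
qed

lemma linear_matrix: "linear (\<lambda>w. (L :: complex^'b^'a) *v w)"
  unfolding linear_iff by (auto simp: matrix_vector_right_distrib) (simp add: vec_eq_iff matrix_vector_mult_def scaleR_sum_right)

lemma adjoint_matrix:
  fixes L :: "complex^'b^'a"
  shows "adjoint (\<lambda>w. L *v w) a = conj_transpose L *v a"
proof -
  have l: "linear (\<lambda>w. L *v w)" by (rule linear_matrix)
  have "e \<bullet> (conj_transpose L *v a) = (L *v e) \<bullet> a" for e
  proof -
    have "e \<bullet> (conj_transpose L *v a) = Re (\<Sum>i\<in>UNIV. \<Sum>j\<in>UNIV. cnj (e $ i) * (cnj (L $ j $ i) * a $ j))"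
      by (simp add: inner_vec_def inner_complex_def matrix_vector_mult_def conj_transpose_def algebra_simps
          sum_distrib_left sum.distrib sum_subtractf)
    also have "\<dots> = Re (\<Sum>j\<in>UNIV. \<Sum>i\<in>UNIV. cnj (e $ i) * (cnj (L $ j $ i) * a $ j))"
      by (subst sum.swap) simp
    also have "\<dots> = (L *v e) \<bullet> a"
      by (simp add: inner_vec_def inner_complex_def matrix_vector_mult_def algebra_simps
          sum_distrib_left sum_distrib_right sum.distrib sum_subtractf)
    finally show ?thesis .
  qed
  then have "e \<bullet> adjoint (\<lambda>w. L *v w) a = e \<bullet> (conj_transpose L *v a)" for e
    using adjoint_works[OF l] by simp
  then show ?thesis using vector_eq_ldot by blast
qed

lemma std_complex_gaussian_eq: "(std_complex_gaussian :: (complex^'n) measure) = std_gauss"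
proof -
  have "(\<Prod>i\<in>UNIV. exp (- (cmod (w $ i))\<^sup>2) / pi) = exp (- (norm w)\<^sup>2) / sqrt pi ^ DIM(complex^'n)" for w :: "complex^'n"
  proof -
    have "(norm w)\<^sup>2 = (\<Sum>i\<in>UNIV. (cmod (w $ i))\<^sup>2)"
      by (simp add: power2_norm_eq_inner inner_vec_def)
    moreover have "sqrt pi ^ DIM(complex^'n) = pi ^ CARD('n)" by (simp add: power_mult mult.commute[of _ 2])
    ultimately show ?thesis by (simp add: prod_dividef exp_sum[symmetric] sum_negf)
  qed
  then show ?thesis by (simp add: std_complex_gaussian_def std_gauss_def)
qed

section \<open>The updated law\<close>

text \<open>No measurability is assumed, because it is applied to \<open>upd_weight\<close>, which
  involves arbitrarily chosen conditional laws and is identified only almost everywhere.\<close>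

lemma density_cong_AE:
  assumes "AE x in M. f x = g x" shows "density M f = density M g"
proof -
  have "(\<lambda>A. \<integral>\<^sup>+x. f x * indicator A x \<partial>M) = (\<lambda>A. \<integral>\<^sup>+x. g x * indicator A x \<partial>M)"
    by (rule ext, rule nn_integral_cong_AE) (use assms in \<open>auto elim: eventually_mono\<close>)
  then show ?thesis by (simp add: density_def)
qed

text \<open>The three forms have different centres; the common centre \<open>g\<close> is fixed by
  matching the terms linear in \<open>u\<close>, and what remains is constant in
  \<open>u\<close>.\<close>

lemma complete_square:
  fixes K1 K2 K3 P :: "complex^'n^'n"
  assumes K: "\<And>a b. a \<bullet> (K1 *v b) = (K1 *v a) \<bullet> b" "\<And>a b. a \<bullet> (K2 *v b) = (K2 *v a) \<bullet> b" "\<And>a b. a \<bullet> (K3 *v b) = (K3 *v a) \<bullet> b"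
    and P: "\<And>r. P *v r = c1 *\<^sub>R (K1 *v r) - c2 *\<^sub>R (K2 *v r) + c3 *\<^sub>R (K3 *v r)"
    and g: "P *v g = c1 *\<^sub>R (K1 *v m1) - c2 *\<^sub>R (K2 *v m2) + c3 *\<^sub>R (K3 *v m3)"
  shows "c1 * ((u - m1) \<bullet> (K1 *v (u - m1))) - c2 * ((u - m2) \<bullet> (K2 *v (u - m2))) + c3 * ((u - m3) \<bullet> (K3 *v (u - m3)))
    = (u - g) \<bullet> (P *v (u - g))
      + (c1 * (m1 \<bullet> (K1 *v m1)) - c2 * (m2 \<bullet> (K2 *v m2)) + c3 * (m3 \<bullet> (K3 *v m3)) - g \<bullet> (P *v g))"
proof -
  have sq: "(u - m) \<bullet> (K *v (u - m)) = u \<bullet> (K *v u) - 2 * (u \<bullet> (K *v m)) + m \<bullet> (K *v m)"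
    if "\<And>a b. a \<bullet> (K *v b) = (K *v a) \<bullet> b" for K :: "complex^'n^'n" and m
    using that[of m u] by (simp add: matrix_vector_mult_diff_distrib inner_diff_left inner_diff_right inner_commute)
  have Ps: "a \<bullet> (P *v b) = (P *v a) \<bullet> b" for a b
    using K by (simp add: P inner_add_left inner_add_right inner_diff_left inner_diff_right)
  have "u \<bullet> (P *v u) = c1 * (u \<bullet> (K1 *v u)) - c2 * (u \<bullet> (K2 *v u)) + c3 * (u \<bullet> (K3 *v u))"
    by (simp add: P inner_add_right inner_diff_right)
  moreover have "u \<bullet> (P *v g) = c1 * (u \<bullet> (K1 *v m1)) - c2 * (u \<bullet> (K2 *v m2)) + c3 * (u \<bullet> (K3 *v m3))"
    by (simp add: g inner_add_right inner_diff_right)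
  ultimately show ?thesis
    unfolding sq[OF K(1)] sq[OF K(2)] sq[OF K(3)] sq[OF Ps] by (simp add: algebra_simps)
qed

lemma scaleR_matrix_apply: "(c *\<^sub>R (K::complex^'b^'a)) *v r = c *\<^sub>R (K *v r)"
  by (simp add: vec_eq_iff matrix_vector_mult_def scaleR_sum_right)

lemma matrix_scaleR_apply: "(K::complex^'b^'a) *v (c *\<^sub>R r) = c *\<^sub>R (K *v r)"
  by (simp add: vec_eq_iff matrix_vector_mult_def scaleR_sum_right)

lemma gaussian_update_gauss:
  fixes x :: "'e::euclidean_space \<Rightarrow> complex^'x" and v :: "'e \<Rightarrow> complex^'v" and n :: "'e \<Rightarrow> complex^'n"
    and y :: "'e \<Rightarrow> complex^'y" and u :: "'e \<Rightarrow> complex^'u"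
  assumes M: "prob_space M"
    and T: "cplx_str T" "cplx_lin T x" "cplx_lin T v" "cplx_lin T n" "cplx_lin T y" "cplx_lin T u"
    and g: "glaw M (X \<star> V \<star> Y0 \<star> Y \<star> U) (x \<star> v \<star> n \<star> y \<star> u)"
    and sY: "lsurj (x \<star> y \<star> v \<star> n)" and sU: "lsurj (x \<star> u \<star> v \<star> n)"
    and ci: "\<And>e. u (prj (x \<star> v \<star> n) e) = u (prj (x \<star> n) e)"
    and A: "\<And>e. u (prj (x \<star> n) e) = A *v y (prj (x \<star> n) e)"
      "\<And>e. u (prj (v \<star> n) e) = A *v y (prj (v \<star> n) e)"
      "\<And>e. u (prj n e) = A *v y (prj n e)"
    and s: "0 < s1" "s1 \<le> 1" "0 < s"
  shows "gaussian_update M X Y0 Y U V A s1 s"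
proof -
  have gs: "glaw M (U \<star> X \<star> Y0) (u \<star> x \<star> n)"
    "glaw M (U \<star> V \<star> Y0) (u \<star> v \<star> n)"
    "glaw M (U \<star> Y0) (u \<star> n)"
    "glaw M (Y \<star> X \<star> Y0) (y \<star> x \<star> n)"
    "glaw M (Y \<star> V \<star> Y0) (y \<star> v \<star> n)"
    "glaw M (Y \<star> Y0) (y \<star> n)"
    "glaw M Y y"
    using glaw_map[OF g, of "\<lambda>(x, v, n, y, u). (u, x, n)"] glaw_map[OF g, of "\<lambda>(x, v, n, y, u). (u, v, n)"]
      glaw_map[OF g, of "\<lambda>(x, v, n, y, u). (u, n)"] glaw_map[OF g, of "\<lambda>(x, v, n, y, u). (y, x, n)"]
      glaw_map[OF g, of "\<lambda>(x, v, n, y, u). (y, v, n)"] glaw_map[OF g, of "\<lambda>(x, v, n, y, u). (y, n)"]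
      glaw_map[OF g, of "\<lambda>(x, v, n, y, u). y"]
    by (simp_all add: linear_iff split_beta)
  have ss: "lsurj (u \<star> x \<star> n)" "lsurj (u \<star> v \<star> n)" "lsurj (u \<star> n)"
    "lsurj (u \<star> x \<star> v \<star> n)"
    using lsurj_images[OF sU, of "\<lambda>(x, u, v, n). (u, x, n)"] lsurj_images[OF sU, of "\<lambda>(x, u, v, n). (u, v, n)"]
      lsurj_images[OF sU, of "\<lambda>(x, u, v, n). (u, n)"] lsurj_images[OF sU, of "\<lambda>(x, u, v, n). (u, x, v, n)"]
    by (simp_all add: linear_iff split_beta surj_def)
  have sy: "lsurj y" using lsurj_pairD(1)[OF lsurj_pairD(2)[OF sY]] .
  have sn: "lsurj n" and sxn: "lsurj (x \<star> n)" and svn: "lsurj (v \<star> n)"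
    using ss[THEN lsurj_pairD(2)] by auto
  define K1 where "K1 = matrix_inv (cond_cov M U (X \<bowtie> Y0))"
  define K2 where "K2 = matrix_inv (cond_cov M U (V \<bowtie> Y0))"
  define K3 where "K3 = matrix_inv (cond_cov M U Y0)"
  define J1 where "J1 = qform (resid u (x \<star> n))"
  define J2 where "J2 = qform (resid u (v \<star> n))"
  define J3 where "J3 = qform (resid u n)"
  have J: "J1 r = r \<bullet> (K1 *v r)" "J2 r = r \<bullet> (K2 *v r)" "J3 r = r \<bullet> (K3 *v r)" for r
    unfolding J1_def J2_def J3_def K1_def K2_def K3_def
    using cond_cov_stack(1)[OF T(1,6,2,4) gs(1) ss(1)] cond_cov_stack(1)[OF T(1,6,3,4) gs(2) ss(2)]
      cond_cov_inv(1)[OF T(1,6,4) gs(3) ss(3)] by blast+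
  have K: "a \<bullet> (K1 *v b) = (K1 *v a) \<bullet> b" "a \<bullet> (K2 *v b) = (K2 *v a) \<bullet> b" "a \<bullet> (K3 *v b) = (K3 *v a) \<bullet> b" for a b
    unfolding K1_def K2_def K3_def
    using cond_cov_stack(2)[OF T(1,6,2,4) gs(1) ss(1)] cond_cov_stack(2)[OF T(1,6,3,4) gs(2) ss(2)]
      cond_cov_inv(2)[OF T(1,6,4) gs(3) ss(3)] by blast+
  define c1 where "c1 = 1 / s"
  define c2 where "c2 = (1 - s1) / s"
  define c3 where "c3 = (s - s1) / s"
  define P where "P = next_precision M X Y0 U V s1 s"
  have P: "P *v r = c1 *\<^sub>R (K1 *v r) - c2 *\<^sub>R (K2 *v r) + c3 *\<^sub>R (K3 *v r)" for r
    unfolding P_def next_precision_def K1_def K2_def K3_def c1_def c2_def c3_def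
    by (simp only: matrix_vector_mult_add_rdistrib matrix_vector_mult_diff_rdistrib scaleR_matrix_apply)
  have Ps: "a \<bullet> (P *v b) = (P *v a) \<bullet> b" for a b
    using K by (simp add: P inner_add_left inner_add_right inner_diff_left inner_diff_right)
  have resid: "resid u (x \<star> v \<star> n) = resid u (x \<star> n)"
    using ci lsurj_linear[OF lsurj_pairD(1)[OF ss(1)]] by (auto simp: resid_def fun_eq_iff linear_diff)
  have Ppos: "0 < a \<bullet> (P *v a)" if "a \<noteq> 0" for a
  proof -
    \<comment> \<open>Monotonicity compares only nested conditionings, so (X, Y0) is first enlarged
      to (X, V, Y0), which \<open>resid\<close> permits.\<close>
    have 1: "J2 a \<le> J1 a" unfolding J1_def J2_def resid[symmetric]
      by (rule qform_resid_mono[OF ss(4,2)]) (simp add: zero_prod_def)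
    have 2: "J3 a \<le> J1 a" unfolding J1_def J3_def
      by (rule qform_resid_mono[OF ss(1,3)]) (simp add: zero_prod_def)
    have 3: "0 < J3 a" unfolding J3_def by (rule qform_pos[OF resid_lsurj[OF ss(3)] that])
    have "a \<bullet> (P *v a) = c1 * J1 a - c2 * J2 a + c3 * J3 a"
      by (simp add: P J inner_add_right inner_diff_right)
    \<comment> \<open>The coefficient of \<open>J3\<close> may be negative, as \<open>s\<close> may
      be smaller than \<open>s1\<close>; in this grouping two terms are nonnegative and the last is
      positive.\<close>
    also have "\<dots> = (1 - s1) / s * (J1 a - J2 a) + s1 / s * (J1 a - J3 a) + J3 a"
      using s by (simp add: c1_def c2_def c3_def field_simps)
    finally show ?thesis using 1 2 3 s by (simp add: add_nonneg_pos)
  qed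
  obtain L :: "complex^'u^'u" where L: "invertible L" "L ** conj_transpose L = matrix_inv P"
    using pd_factor(1)[OF Ps Ppos] by blast
  have iP: "invertible P" by (rule pd_factor(2)[OF Ps Ppos])
  \<comment> \<open>The new noise is represented on a source of its own. The factorization of the
    inverse of \<open>P\<close> makes the form of this map the one given by
    \<open>P\<close>.\<close>
  let ?L = "\<lambda>w. L *v w"
  have sL: "lsurj ?L"
    unfolding lsurj_def surj_def using linear_matrix matrix_inv_apply(2)[OF L(1)] by metis
  have JL: "qform ?L r = r \<bullet> (P *v r)" for r
  proof (rule qform_inv[OF sL])
    have "L *v (conj_transpose L *v (P *v r)) = (L ** conj_transpose L) *v (P *v r)"
      by (simp only: matrix_vector_mul_assoc matrix_mul_assoc)
    also have "\<dots> = r" unfolding L(2) by (rule matrix_inv_apply(1)[OF iP])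
    finally show "L *v adjoint ?L (P *v r) = r" by (simp only: adjoint_matrix)
  qed
  define Z' where "Z' = distr std_complex_gaussian borel (\<lambda>w. 0 + L *v w)"
  have Z'g: "complex_gaussian Z' 0 (next_noise_cov M X Y0 U V s1 s)"
    unfolding complex_gaussian_def Z'_def next_noise_cov_def P_def[symmetric] using L(2) by blast
  have Z': "Z' = distr std_gauss borel ?L" by (simp add: Z'_def std_complex_gaussian_eq)
  note Lm[measurable] = borel_measurable_linear[OF linear_matrix[of L]]
  define G where "G = next_gain M X Y0 Y U V A s1 s"
  define m1 where "m1 = (\<lambda>y0. u (prj (x \<star> n) (pinv y y0)))"
  define m2 where "m2 = (\<lambda>y0. u (prj (v \<star> n) (pinv y y0)))"
  define m3 where "m3 = (\<lambda>y0. u (prj n (pinv y y0)))"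
  \<comment> \<open>\<open>P\<close> cancels the noise covariance in front of the gain. Each factor
    with a conditional covariance gives an averaged prediction of Y by \<open>gain_factor\<close>,
    and the hypotheses \<open>A\<close> turn it into the averaged prediction of U.\<close>
  have PG: "P *v (G *v y0) = c1 *\<^sub>R (K1 *v m1 y0) - c2 *\<^sub>R (K2 *v m2 y0) + c3 *\<^sub>R (K3 *v m3 y0)" for y0
  proof -
    have "G *v y0 = matrix_inv P *v (c1 *\<^sub>R (K1 *v m1 y0))
      - matrix_inv P *v (c2 *\<^sub>R (K2 *v m2 y0) - c3 *\<^sub>R (K3 *v m3 y0))"
      unfolding G_def next_gain_def next_noise_cov_def P_def[symmetric] K1_def[symmetric] K2_def[symmetric] K3_def[symmetric]
        c1_def[symmetric] c2_def[symmetric] c3_def[symmetric]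
        matrix_vector_mult_diff_rdistrib[of "_ ** _"] matrix_vector_mult_diff_rdistrib[of "_ *\<^sub>R _"]
        scaleR_matrix_apply matrix_vector_mul_assoc[symmetric]
        gain_factor_stack[OF T(1,5,2,4) gs(4) sy sxn] gain_factor_stack[OF T(1,5,3,4) gs(5) sy svn]
        gain_factor[OF T(1,5,4) gs(6) sy sn]
      by (simp only: m1_def m2_def m3_def A)
    then show ?thesis
      unfolding matrix_vector_mult_diff_distrib[symmetric] by (simp add: matrix_inv_apply[OF iP])
  qed
  define d where "d = (\<lambda>y0. c1 * (m1 y0 \<bullet> (K1 *v m1 y0)) - c2 * (m2 y0 \<bullet> (K2 *v m2 y0)) + c3 * (m3 y0 \<bullet> (K3 *v m3 y0))
      - (G *v y0) \<bullet> (P *v (G *v y0)))"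
  have quad: "upd_exponent x v n u s1 s u0 (pinv y y0) = qform ?L (u0 - G *v y0) + d y0" for u0 y0
    unfolding upd_exponent_def JL d_def c1_def[symmetric] c2_def[symmetric] c3_def[symmetric]
      J1_def[symmetric] J2_def[symmetric] J3_def[symmetric] m1_def[symmetric, THEN fun_cong] m2_def[symmetric, THEN fun_cong]
      m3_def[symmetric, THEN fun_cong] J
    by (rule complete_square[OF K P PG])
  obtain c where c: "AE y0 in lborel. AE u0 in lborel.
    upd_weight M X Y0 Y U V s1 s u0 y0 = ennreal (exp (c y0 - upd_exponent x v n u s1 s u0 (pinv y y0)))"
    using upd_weight_gauss[OF M g sY sU ci s] by blast
  have "AE y0 in distr M borel Y.
          0 < upd_normalizer M X Y0 Y U V s1 s y0 \<and>
          upd_normalizer M X Y0 Y U V s1 s y0 < \<infinity> \<and>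
          upd_law M X Y0 Y U V s1 s y0 = distr Z' borel (\<lambda>z. G *v y0 + z)"
    unfolding glaw_AE[OF gs(7) sy] using c
  proof eventually_elim
    fix y0 assume w: "AE u0 in lborel. upd_weight M X Y0 Y U V s1 s u0 y0 = ennreal (exp (c y0 - upd_exponent x v n u s1 s u0 (pinv y y0)))"
    \<comment> \<open>All factors free of \<open>u0\<close>, corrected by the constant of the
      normalized Gaussian density; it turns out to be the normalizer.\<close>
    define k where "k = exp (c y0 - d y0) / gconst ?L"
    have k: "k > 0" using gconst_pos[OF sL] by (simp add: k_def)
    have w': "AE u0 in lborel. upd_weight M X Y0 Y U V s1 s u0 y0 = ennreal k * ennreal (gdens ?L (u0 - G *v y0))"
      using w
    proof eventually_elim
      fix u0 assume "upd_weight M X Y0 Y U V s1 s u0 y0 = ennreal (exp (c y0 - upd_exponent x v n u s1 s u0 (pinv y y0)))"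
      moreover have "exp (c y0 - upd_exponent x v n u s1 s u0 (pinv y y0)) = k * gdens ?L (u0 - G *v y0)"
        using gconst_pos[OF sL] by (simp add: quad k_def gdens_def exp_diff exp_add exp_minus field_simps)
      ultimately show "upd_weight M X Y0 Y U V s1 s u0 y0 = ennreal k * ennreal (gdens ?L (u0 - G *v y0))"
        using k gdens_pos[OF sL] by (simp add: ennreal_mult less_imp_le)
    qed
    have N: "upd_normalizer M X Y0 Y U V s1 s y0 = ennreal k"
      unfolding upd_normalizer_def nn_integral_cong_AE[OF w'] using gdens_measurable[OF sL]
      by (subst nn_integral_cmult) (auto simp: nn_integral_gdens[OF sL])
    have "upd_law M X Y0 Y U V s1 s y0 = density lborel (\<lambda>u0. ennreal (gdens ?L (u0 - G *v y0)))"
      unfolding upd_law_def N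
    proof (rule density_cong_AE)
      show "AE u0 in lborel. upd_weight M X Y0 Y U V s1 s u0 y0 / ennreal k = ennreal (gdens ?L (u0 - G *v y0))"
        using w'
      proof eventually_elim
        fix u0 assume "upd_weight M X Y0 Y U V s1 s u0 y0 = ennreal k * ennreal (gdens ?L (u0 - G *v y0))"
        then have "upd_weight M X Y0 Y U V s1 s u0 y0 = ennreal (k * gdens ?L (u0 - G *v y0))"
          using k gdens_pos[OF sL] by (simp add: ennreal_mult less_imp_le)
        then show "upd_weight M X Y0 Y U V s1 s u0 y0 / ennreal k = ennreal (gdens ?L (u0 - G *v y0))"
          using k gdens_pos[OF sL] by (simp add: divide_ennreal less_imp_le)
      qed
    qed
    also have "\<dots> = distr std_gauss borel (\<lambda>e. G *v y0 + L *v e)" by (rule gdens_shift[OF sL])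
    also have "\<dots> = distr Z' borel (\<lambda>z. G *v y0 + z)"
      unfolding Z' by (subst distr_distr) (auto simp: o_def)
    finally show "0 < upd_normalizer M X Y0 Y U V s1 s y0 \<and>
          upd_normalizer M X Y0 Y U V s1 s y0 < \<infinity> \<and>
          upd_law M X Y0 Y U V s1 s y0 = distr Z' borel (\<lambda>z. G *v y0 + z)"
      using k by (simp add: N)
  qed
  then show ?thesis
    unfolding gaussian_update_def G_def using iP Z'g by (auto simp: P_def)
qed

section \<open>Independence and uncorrelatedness\<close>

lemma orth_resid:
  assumes "linear \<phi>" "linear \<psi>" "lsurj b" "orth \<phi> \<psi>" "orth \<phi> b"
  shows "orth \<phi> (resid \<psi> b)"
  using assms(4) orth_pinv[OF assms(1,5)] unfolding orth_iff[OF assms(1)] adjoint_resid[OF assms(2,3)]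
  by (simp add: linear_diff[OF assms(1)] prj_def)

lemma orth_add_right:
  assumes "linear \<phi>" "linear \<psi>" "linear \<psi>'" "orth \<phi> \<psi>" "orth \<phi> \<psi>'" shows "orth \<phi> (\<lambda>e. \<psi> e + \<psi>' e)"
  by (subst orth_sym, rule orth_add[OF assms(2,3)]; subst orth_sym, rule assms)

lemma orth_comp_right:
  assumes "linear \<psi>" "linear A" "orth \<phi> \<psi>" shows "orth \<phi> (\<lambda>e. A (\<psi> e))"
  by (subst orth_sym, rule orth_comp[OF assms(1,2)]; subst orth_sym, rule assms)

lemma orth_pair_right:
  assumes "linear \<psi>" "linear \<psi>'" "orth \<phi> \<psi>" "orth \<phi> \<psi>'" shows "orth \<phi> (\<psi> \<star> \<psi>')"
  by (subst orth_sym, rule orth_pair[OF assms(1,2)]; subst orth_sym, rule assms)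

lemma glaw_second_moment:
  assumes "glaw M (A \<star> B) (\<phi> \<star> \<psi>)"
  shows "(\<integral>\<omega>. (A \<omega> \<bullet> a) * (B \<omega> \<bullet> b) \<partial>M) = adjoint \<phi> a \<bullet> adjoint \<psi> b / 2"
proof -
  have l: "linear \<phi>" "linear \<psi>" using glaw_map[OF assms linear_fst] glaw_map[OF assms linear_snd] by (auto simp: glaw_def)
  have [measurable]: "(A \<star> B) \<in> borel_measurable M" "(\<phi> \<star> \<psi>) \<in> borel_measurable borel"
    and d: "distr M borel (A \<star> B) = distr std_gauss borel (\<phi> \<star> \<psi>)"
    using assms by (auto simp: glaw_def intro!: borel_measurable_linear linear_pair)
  have [measurable]: "(\<lambda>x. (fst x \<bullet> a) * (snd x \<bullet> b)) \<in> borel_measurable borel"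
    by (intro borel_measurable_continuous_onI continuous_intros)
  have "(\<integral>\<omega>. (A \<omega> \<bullet> a) * (B \<omega> \<bullet> b) \<partial>M) = (\<integral>x. (fst x \<bullet> a) * (snd x \<bullet> b) \<partial>distr M borel (A \<star> B))"
    by (subst integral_distr) auto
  also have "\<dots> = (\<integral>e. (\<phi> e \<bullet> a) * (\<psi> e \<bullet> b) \<partial>std_gauss)"
    unfolding d by (subst integral_distr) auto
  also have "\<dots> = adjoint \<phi> a \<bullet> adjoint \<psi> b / 2"
    using std_gauss_linear_inner[OF l] by (simp add: has_bochner_integral_iff)
  finally show ?thesis .
qed

text \<open>Being uncorrelated is a property of the joint law through its second moments, so it may
  be verified on any other representation of the same pair.\<close>

lemma glaw_orth_unique:
  assumes "glaw M (A \<star> B) (\<phi> \<star> \<psi>)" "glaw M (A \<star> B) (\<phi>' \<star> \<psi>')"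
    and "orth \<phi>' \<psi>'"
  shows "orth \<phi> \<psi>"
  using glaw_second_moment[OF assms(1)] glaw_second_moment[OF assms(2)] assms(3) by (simp add: orth_def)

lemma adjoint_snd:
  fixes \<psi> :: "'f::euclidean_space \<Rightarrow> 'b::euclidean_space"
  assumes "linear \<psi>"
  shows "adjoint (\<lambda>e::'e::euclidean_space\<times>'f. \<psi> (snd e)) b = (0, adjoint \<psi> b)"
proof -
  have l: "linear (\<lambda>e::'e\<times>'f. \<psi> (snd e))" using linear_compose[OF linear_snd assms] by (simp add: o_def)
  have "e \<bullet> adjoint (\<lambda>e. \<psi> (snd e)) b = e \<bullet> (0, adjoint \<psi> b)" for e :: "'e\<times>'f"
    unfolding adjoint_works[OF l] by (cases e) (simp add: adjoint_works[OF assms])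
  then show ?thesis using vector_eq_ldot by blast
qed

lemma orth_fst_snd:
  fixes \<phi> :: "'e::euclidean_space \<Rightarrow> 'a::euclidean_space" and \<psi> :: "'f::euclidean_space \<Rightarrow> 'b::euclidean_space"
  assumes "linear \<phi>" "linear \<psi>"
  shows "orth (\<lambda>e. \<phi> (fst e)) (\<lambda>e. \<psi> (snd e))"
proof -
  have l: "linear (\<lambda>e::'e\<times>'f. \<phi> (fst e))" "linear (\<lambda>e::'e\<times>'f. \<psi> (snd e))"
    using linear_compose[OF linear_fst assms(1)] linear_compose[OF linear_snd assms(2)] by (simp_all add: o_def)
  show ?thesis unfolding orth_iff[OF l(1)] by (simp add: adjoint_snd[OF assms(2)] linear_0[OF assms(1)])
qed

lemma orth_snd_snd:
  assumes "linear \<phi>" "linear \<psi>" "orth \<phi> \<psi>"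
  shows "orth (\<lambda>e. \<phi> (snd e)) (\<lambda>e. \<psi> (snd e))"
  using assms(3) by (simp add: orth_def adjoint_snd[OF assms(1)] adjoint_snd[OF assms(2)])

lemma indep_rv_prob:
  assumes M: "prob_space M" and i: "indep_rv M A B" and S: "S \<in> sets borel" "T \<in> sets borel"
  shows "emeasure M {\<omega> \<in> space M. A \<omega> \<in> S \<and> B \<omega> \<in> T}
    = emeasure M {\<omega> \<in> space M. A \<omega> \<in> S} * emeasure M {\<omega> \<in> space M. B \<omega> \<in> T}"
proof -
  interpret prob_space M by fact
  have "A -` S \<inter> space M \<in> sets (vimage_algebra (space M) A borel)"
    "B -` T \<inter> space M \<in> sets (vimage_algebra (space M) B borel)"
    using S by (auto intro!: in_vimage_algebra)
  from indep_setD[OF i[unfolded indep_rv_def] this]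
  have "prob ((A -` S \<inter> space M) \<inter> (B -` T \<inter> space M)) = prob (A -` S \<inter> space M) * prob (B -` T \<inter> space M)" .
  moreover have "(A -` S \<inter> space M) \<inter> (B -` T \<inter> space M) = {\<omega> \<in> space M. A \<omega> \<in> S \<and> B \<omega> \<in> T}"
    "A -` S \<inter> space M = {\<omega> \<in> space M. A \<omega> \<in> S}" "B -` T \<inter> space M = {\<omega> \<in> space M. B \<omega> \<in> T}" by auto
  ultimately show ?thesis by (simp add: emeasure_eq_measure ennreal_mult)
qed

text \<open>The law of the pair is a product measure, represented on the product source.
  Independence is assumed as a formula on events so that preimages under stacking maps can be
  inserted directly.\<close>

lemma glaw_indep:
  fixes \<phi> :: "'e::euclidean_space \<Rightarrow> 'a::euclidean_space" and \<psi> :: "'f::euclidean_space \<Rightarrow> 'b::euclidean_space"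
  assumes M: "prob_space M" and g: "glaw M A \<phi>" "glaw M B \<psi>"
    and i: "\<And>S T. S \<in> sets borel \<Longrightarrow> T \<in> sets borel \<Longrightarrow> emeasure M {\<omega> \<in> space M. A \<omega> \<in> S \<and> B \<omega> \<in> T}
      = emeasure M {\<omega> \<in> space M. A \<omega> \<in> S} * emeasure M {\<omega> \<in> space M. B \<omega> \<in> T}"
  shows "glaw M (A \<star> B) (\<lambda>e. (\<phi> (fst e), \<psi> (snd e)))"
proof -
  interpret prob_space M by fact
  have [measurable]: "A \<in> borel_measurable M" "B \<in> borel_measurable M" and l: "linear \<phi>" "linear \<psi>"
    and d: "distr M borel A = distr std_gauss borel \<phi>" "distr M borel B = distr std_gauss borel \<psi>"
    using g by (auto simp: glaw_def)
  note [measurable] = borel_measurable_linear[OF l(1)] borel_measurable_linear[OF l(2)]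
  interpret A: prob_space "distr M borel A" by (rule prob_space_distr) measurable
  interpret B: prob_space "distr M borel B" by (rule prob_space_distr) measurable
  have dA: "emeasure (distr M borel A) S = emeasure M {\<omega> \<in> space M. A \<omega> \<in> S}" if "S \<in> sets borel" for S
    using that by (subst emeasure_distr) (auto intro!: arg_cong[where f="emeasure M"])
  have dB: "emeasure (distr M borel B) S = emeasure M {\<omega> \<in> space M. B \<omega> \<in> S}" if "S \<in> sets borel" for S
    using that by (subst emeasure_distr) (auto intro!: arg_cong[where f="emeasure M"])
  have "distr M borel A \<Otimes>\<^sub>M distr M borel B = distr M borel (A \<star> B)"
  proof (rule pair_measure_eqI)
    show "sets (distr M borel A \<Otimes>\<^sub>M distr M borel B) = sets (distr M borel (A \<star> B))"
      by (simp add: borel_prod[symmetric] cong: sets_pair_measure_cong)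
    fix S T assume "S \<in> sets (distr M borel A)" "T \<in> sets (distr M borel B)"
    then have S: "S \<in> sets borel" "T \<in> sets borel" by auto
    then have ST: "S \<times> T \<in> sets borel" unfolding borel_prod[symmetric] by simp
    have "emeasure (distr M borel (A \<star> B)) (S \<times> T) = emeasure M {\<omega> \<in> space M. A \<omega> \<in> S \<and> B \<omega> \<in> T}"
      by (subst emeasure_distr) (auto simp: ST intro!: arg_cong[where f="emeasure M"])
    then show "emeasure (distr M borel A) S * emeasure (distr M borel B) T = emeasure (distr M borel (A \<star> B)) (S \<times> T)"
      using S by (simp only: i dA dB)
  qed unfold_locales
  moreover have "distr std_gauss borel \<phi> \<Otimes>\<^sub>M distr std_gauss borel \<psi> = distr std_gauss borel (\<lambda>e. (\<phi> (fst e), \<psi> (snd e)))"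
    using pair_measure_distr[of \<phi> std_gauss borel \<psi> std_gauss borel] B.sigma_finite_measure_axioms
    by (simp add: d std_gauss_prod_measure borel_prod split_beta')
  moreover have "linear (\<lambda>e::'e\<times>'f. (\<phi> (fst e), \<psi> (snd e)))"
    using linear_compose[OF linear_fst l(1)] linear_compose[OF linear_snd l(2)] by (intro linear_pair) (simp_all add: o_def)
  ultimately show ?thesis unfolding glaw_def by (simp add: d)
qed

lemma indep_orth:
  assumes M: "prob_space M" and g: "glaw M (A \<star> B) (\<phi> \<star> \<psi>)" and i: "indep_rv M A B"
  shows "orth \<phi> \<psi>"
proof -
  have gA: "glaw M A \<phi>" and gB: "glaw M B \<psi>" using glaw_map[OF g linear_fst] glaw_map[OF g linear_snd] by auto
  have l: "linear \<phi>" "linear \<psi>" using gA gB by (auto simp: glaw_def)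
  show ?thesis
    by (rule glaw_orth_unique[OF g glaw_indep[OF M gA gB indep_rv_prob[OF M i]] orth_fst_snd[OF l]])
qed

text \<open>Links the two descriptions of conditioning: integrated over events generated by
  \<open>N\<close>, the defining identity of the kernel is exactly the characterization of the
  conditional expectation.\<close>

lemma cond_prob_kernel:
  fixes N :: "'w \<Rightarrow> 'n::euclidean_space"
  assumes M: "prob_space M" and [measurable]: "A \<in> borel_measurable M" "N \<in> borel_measurable M"
    and k: "is_cond_law M A N \<kappa>" and [measurable]: "S \<in> sets borel"
  shows "AE \<omega> in M. real_cond_exp M (vimage_algebra (space M) N borel) (indicator (A -` S \<inter> space M)) \<omega>
    = measure (\<kappa> (N \<omega>)) S"
proof -
  interpret prob_space M by fact
  let ?F = "vimage_algebra (space M) N borel"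
  have sub: "subalgebra M ?F"
    unfolding subalgebra_def by (auto simp: sets_vimage_algebra2 intro: measurable_sets)
  interpret finite_measure_subalgebra M ?F by unfold_locales (rule sub)
  have kp: "\<kappa> \<in> borel \<rightarrow>\<^sub>M prob_algebra borel" using k by (simp add: is_cond_law_def)
  have P: "prob_space (\<kappa> b)" for b using measurable_space[OF kp, of b] by (auto simp: space_prob_algebra)
  have [measurable]: "(\<lambda>b. measure (\<kappa> b) S) \<in> borel_measurable borel"
    using measurable_compose[OF kp measurable_measure_prob_algebra] by simp
  have NF: "N \<in> borel_measurable ?F" by (rule measurable_vimage_algebra1) simp
  have E: "A -` S \<inter> space M \<in> sets M" by measurable
  show ?thesis
  proof (rule real_cond_exp_charact)
    show "integrable M (indicator (A -` S \<inter> space M) :: _ \<Rightarrow> real)"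
      using E by (intro integrable_real_indicator) (simp_all add: less_top[symmetric])
    show int: "integrable M (\<lambda>\<omega>. measure (\<kappa> (N \<omega>)) S)"
      by (rule integrable_const_bound[of _ 1]) (use P in \<open>auto intro!: AE_I2 prob_space.prob_le_1\<close>)
    show "(\<lambda>\<omega>. measure (\<kappa> (N \<omega>)) S) \<in> borel_measurable ?F"
      by (rule measurable_compose[OF NF]) measurable
    fix C assume "C \<in> sets ?F"
    then obtain T where T[measurable]: "T \<in> sets borel" and C: "C = N -` T \<inter> space M"
      by (auto simp: sets_vimage_algebra2)
    have "ennreal (\<integral>\<omega>\<in>C. indicator (A -` S \<inter> space M) \<omega> \<partial>M) = emeasure M {\<omega> \<in> space M. A \<omega> \<in> S \<and> N \<omega> \<in> T}"
    proof -
      have "(\<integral>\<omega>\<in>C. indicator (A -` S \<inter> space M) \<omega> \<partial>M) = (\<integral>\<omega>. indicat_real {\<omega> \<in> space M. A \<omega> \<in> S \<and> N \<omega> \<in> T} \<omega> \<partial>M)"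
        unfolding set_lebesgue_integral_def by (rule Bochner_Integration.integral_cong) (auto simp: C indicator_def)
      also have "\<dots> = measure M {\<omega> \<in> space M. A \<omega> \<in> S \<and> N \<omega> \<in> T}" by simp
      finally show ?thesis by (simp only: emeasure_eq_measure)
    qed
    also have "\<dots> = (\<integral>\<^sup>+ b. emeasure (\<kappa> b) S * indicator T b \<partial>distr M borel N)"
      using k by (simp add: is_cond_law_def)
    also have "\<dots> = (\<integral>\<^sup>+ b. ennreal (measure (\<kappa> b) S * indicator T b) \<partial>distr M borel N)"
      using P by (intro nn_integral_cong) (simp add: finite_measure.emeasure_eq_measure prob_space.finite_measure indicator_def)
    also have "\<dots> = (\<integral>\<^sup>+ \<omega>. ennreal (indicator C \<omega> *\<^sub>R measure (\<kappa> (N \<omega>)) S) \<partial>M)"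
      by (subst nn_integral_distr) (auto intro!: nn_integral_cong simp: C indicator_def)
    also have "\<dots> = ennreal (\<integral>\<omega>\<in>C. measure (\<kappa> (N \<omega>)) S \<partial>M)"
      unfolding set_lebesgue_integral_def
      by (intro nn_integral_eq_integral integrable_mult_indicator int) (auto simp: C)
    finally show "(\<integral>\<omega>\<in>C. indicator (A -` S \<inter> space M) \<omega> \<partial>M) = (\<integral>\<omega>\<in>C. measure (\<kappa> (N \<omega>)) S \<partial>M)"
      by (subst (asm) ennreal_inj) (auto simp: set_lebesgue_integral_def intro!: Bochner_Integration.integral_nonneg)
  qed
qed

text \<open>Boxes are stable under intersection, and products of basic open sets show that they
  generate the Borel sets.\<close>

lemma borel3_eqI:
  fixes P Q :: "('a::euclidean_space \<times> 'b::euclidean_space \<times> 'c::euclidean_space) measure"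
  assumes s: "sets P = sets borel" "sets Q = sets borel" and "prob_space P"
    and eq: "\<And>A B C. A \<in> sets borel \<Longrightarrow> B \<in> sets borel \<Longrightarrow> C \<in> sets borel \<Longrightarrow> emeasure P (A \<times> B \<times> C) = emeasure Q (A \<times> B \<times> C)"
  shows "P = Q"
proof -
  interpret prob_space P by fact
  define G where "G = {A \<times> B \<times> C | A B C. A \<in> sets (borel :: 'a measure) \<and> B \<in> sets (borel :: 'b measure) \<and> C \<in> sets (borel :: 'c measure)}"
  obtain BA :: "'a set set" where BA: "countable BA" "topological_basis BA" using ex_countable_basis by blast
  obtain BB :: "'b set set" where BB: "countable BB" "topological_basis BB" using ex_countable_basis by blast
  obtain BC :: "'c set set" where BC: "countable BC" "topological_basis BC" using ex_countable_basis by blast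
  define BD where "BD = (\<lambda>(a, b). a \<times> b) ` (BB \<times> BC)"
  define BE where "BE = (\<lambda>(a, b). a \<times> b) ` (BA \<times> BD)"
  have BD: "countable BD" "topological_basis BD" unfolding BD_def using BB BC by (auto intro: topological_basis_prod)
  have BE: "countable BE" "topological_basis BE" unfolding BE_def using BA BD by (auto intro: topological_basis_prod)
  have "BE \<subseteq> G"
    unfolding BE_def BD_def G_def using topological_basis_open[OF BA(2)] topological_basis_open[OF BB(2)] topological_basis_open[OF BC(2)]
    by fastforce
  then have "sets borel \<subseteq> sigma_sets UNIV G"
    unfolding borel_eq_countable_basis[OF BE] by (simp add: sigma_sets_mono')
  moreover have Gs: "G \<subseteq> sets borel" unfolding G_def borel_prod[symmetric] by auto
  ultimately have GS: "sigma_sets UNIV G = sets borel"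
    using sets.sigma_sets_subset[of G borel] by auto
  have IG: "Int_stable G"
    unfolding Int_stable_def G_def by (auto simp: Times_Int_Times) blast
  show ?thesis
  proof (rule measure_eqI_generator_eq[OF IG, where \<Omega>=UNIV and A="\<lambda>_. UNIV"])
    show "range (\<lambda>_. UNIV) \<subseteq> G" unfolding G_def by (auto intro!: exI[of _ UNIV])
    show "\<And>X. X \<in> G \<Longrightarrow> emeasure P X = emeasure Q X" using eq by (auto simp: G_def)
  qed (use s GS emeasure_finite in auto)
qed

text \<open>The regressions of \<open>N1\<close> and \<open>N2\<close> on \<open>N0\<close> may be sampled with independent copies of the residuals
  without changing the joint law, so the residuals are uncorrelated.\<close>
lemma cond_indep_orth:
  fixes n0 :: "'e::euclidean_space \<Rightarrow> 'n0::euclidean_space" and n1 :: "'e \<Rightarrow> 'n1::euclidean_space" and n2 :: "'e \<Rightarrow> 'n2::euclidean_space"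
  assumes M: "prob_space M" and g: "glaw M (N0 \<star> N1 \<star> N2) (n0 \<star> n1 \<star> n2)"
    and s: "lsurj (n1 \<star> n0)" "lsurj (n2 \<star> n0)"
    and ci: "cond_indep_rv M N1 N2 N0"
  shows "orth (resid n1 n0) (resid n2 n0)"
proof -
  interpret prob_space M by fact
  note s1 = lsurj_pairD[OF s(1)] and s2 = lsurj_pairD[OF s(2)]
  note l = s1[THEN lsurj_linear] s2[THEN lsurj_linear]
  have g1: "glaw M (N1 \<star> N0) (n1 \<star> n0)" and g2: "glaw M (N2 \<star> N0) (n2 \<star> n0)"
    and g0: "glaw M N0 n0" and g1': "glaw M N1 n1" and g2': "glaw M N2 n2"
    using glaw_map[OF g, of "\<lambda>(n0, n1, n2). (n1, n0)"] glaw_map[OF g, of "\<lambda>(n0, n1, n2). (n2, n0)"]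
      glaw_map[OF g, of "\<lambda>(n0, n1, n2). n0"] glaw_map[OF g, of "\<lambda>(n0, n1, n2). n1"] glaw_map[OF g, of "\<lambda>(n0, n1, n2). n2"]
    by (simp_all add: linear_iff split_beta)
  have [measurable]: "N0 \<in> borel_measurable M" "N1 \<in> borel_measurable M" "N2 \<in> borel_measurable M"
    using g0 g1' g2' by (auto simp: glaw_def)
  define r1 where "r1 = resid n1 n0"
  define r2 where "r2 = resid n2 n0"
  have r: "lsurj r1" "lsurj r2" unfolding r1_def r2_def by (intro resid_lsurj s)+
  have lr: "linear r1" "linear r2" using r[THEN lsurj_linear] .
  define K1 where "K1 = (\<lambda>b. n1 (pinv n0 b))"
  define K2 where "K2 = (\<lambda>b. n2 (pinv n0 b))"
  have lK: "linear K1" "linear K2" unfolding K1_def K2_def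
    using linear_compose[OF pinv_linear[OF s1(2)] l(1)] linear_compose[OF pinv_linear[OF s1(2)] l(3)] by (simp_all add: o_def)
  define k1 where "k1 = (\<lambda>b. distr std_gauss borel (\<lambda>e. K1 b + r1 e))"
  define k2 where "k2 = (\<lambda>b. distr std_gauss borel (\<lambda>e. K2 b + r2 e))"
  \<comment> \<open>The kernels are written as images of the source rather than as densities, so
    that a product of conditional probabilities is an integral over two independent copies.\<close>
  have k: "is_cond_law M N1 N0 k1" "is_cond_law M N2 N0 k2"
    using is_cond_law_gauss[OF g1 s(1)] is_cond_law_gauss[OF g2 s(2)]
    unfolding k1_def k2_def r1_def[symmetric] r2_def[symmetric] gdens_shift[OF r(1)] gdens_shift[OF r(2)] K1_def K2_def .
  note [measurable] = borel_measurable_linear[OF lr(1)] borel_measurable_linear[OF lr(2)]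
    borel_measurable_linear[OF lK(1)] borel_measurable_linear[OF lK(2)] borel_measurable_linear[OF l(2)]
  let ?F = "vimage_algebra (space M) N0 borel"
  have sub: "subalgebra M ?F"
    unfolding subalgebra_def by (auto simp: sets_vimage_algebra2 intro: measurable_sets)
  interpret F: finite_measure_subalgebra M ?F by unfold_locales (rule sub)
  define \<Phi> where "\<Phi> = (\<lambda>(e0, e1, e2). (n0 e0, K1 (n0 e0) + r1 e1, K2 (n0 e0) + r2 e2))"
  have l\<Phi>: "linear \<Phi>"
    unfolding \<Phi>_def linear_iff
    by (auto simp: linear_add[OF l(2)] linear_add[OF lK(1)] linear_add[OF lK(2)] linear_add[OF lr(1)] linear_add[OF lr(2)]
        linear_scale[OF l(2)] linear_scale[OF lK(1)] linear_scale[OF lK(2)] linear_scale[OF lr(1)] linear_scale[OF lr(2)]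
        scaleR_right_distrib)
  note [measurable] = borel_measurable_linear[OF l\<Phi>]
  have mN: "(N0 \<star> N1 \<star> N2) \<in> borel_measurable M" using g by (simp add: glaw_def)
  have "distr M borel (N0 \<star> N1 \<star> N2) = distr std_gauss borel \<Phi>"
  proof (rule borel3_eqI)
    show "prob_space (distr M borel (N0 \<star> N1 \<star> N2))" by (rule prob_space_distr[OF mN])
    fix B :: "'n0 set" and S :: "'n1 set" and T :: "'n2 set"
    assume [measurable]: "B \<in> sets borel" "S \<in> sets borel" "T \<in> sets borel"
    have BST[measurable]: "B \<times> S \<times> T \<in> sets borel" unfolding borel_prod[symmetric] by simp
    define E where "E = N1 -` S \<inter> N2 -` T \<inter> space M"
    define C where "C = N0 -` B \<inter> space M"
    have Es: "E \<in> sets M" and C: "C \<in> sets ?F" and Cs: "C \<in> sets M" by (auto simp: E_def C_def sets_vimage_algebra2)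
    have P: "prob_space (k1 b)" "prob_space (k2 b)" for b
      unfolding k1_def k2_def by (rule prob_space_distr_std_gauss, measurable)+
    have mk: "(\<lambda>b. measure (k1 b) S) \<in> borel_measurable borel" "(\<lambda>b. measure (k2 b) T) \<in> borel_measurable borel"
      using k measurable_compose[OF _ measurable_measure_prob_algebra] by (auto simp: is_cond_law_def)
    have "k1 \<in> borel \<rightarrow>\<^sub>M subprob_algebra borel" "k2 \<in> borel \<rightarrow>\<^sub>M subprob_algebra borel"
      using k by (auto simp: is_cond_law_def intro: measurable_prob_algebraD)
    then have mke: "(\<lambda>b. emeasure (k1 b) S) \<in> borel_measurable borel" "(\<lambda>b. emeasure (k2 b) T) \<in> borel_measurable borel"
      by (auto intro: measurable_emeasure_kernel)
    note [measurable] = mk mke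
    have ae: "AE \<omega> in M. real_cond_exp M ?F (indicator E) \<omega> = measure (k1 (N0 \<omega>)) S * measure (k2 (N0 \<omega>)) T"
    proof -
      have "AE \<omega> in M. real_cond_exp M ?F (indicator E) \<omega> = real_cond_exp M ?F (indicator (N1 -` S \<inter> space M)) \<omega> * real_cond_exp M ?F (indicator (N2 -` T \<inter> space M)) \<omega>"
        using ci by (simp add: cond_indep_rv_def Let_def E_def)
      with cond_prob_kernel[OF M _ _ k(1), of S] cond_prob_kernel[OF M _ _ k(2), of T] show ?thesis
        by (auto elim: eventually_elim2)
    qed
    have bound: "norm (measure (k1 b) S * measure (k2 b) T) \<le> 1" for b
      using prob_space.prob_le_1[OF P(1)] prob_space.prob_le_1[OF P(2)] by (simp add: mult_le_one)
    have int: "integrable M (\<lambda>\<omega>. measure (k1 (N0 \<omega>)) S * measure (k2 (N0 \<omega>)) T)"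
      by (rule integrable_const_bound[of _ 1]) (use bound in auto)
    have "emeasure (distr M borel (N0 \<star> N1 \<star> N2)) (B \<times> S \<times> T) = emeasure M (C \<inter> E)"
      using mN by (subst emeasure_distr) (auto simp: C_def E_def intro!: arg_cong[where f="emeasure M"])
    also have "\<dots> = ennreal (\<integral>\<omega>\<in>C. indicator E \<omega> \<partial>M)"
      unfolding set_lebesgue_integral_def using Es Cs
      by (simp add: emeasure_eq_measure indicator_inter_arith[symmetric])
    also have "(\<integral>\<omega>\<in>C. indicator E \<omega> \<partial>M) = (\<integral>\<omega>\<in>C. real_cond_exp M ?F (indicator E) \<omega> \<partial>M)"
      using Es by (intro F.real_cond_exp_intA[OF _ C] integrable_real_indicator) (simp_all add: less_top[symmetric])
    also have "\<dots> = (\<integral>\<omega>\<in>C. measure (k1 (N0 \<omega>)) S * measure (k2 (N0 \<omega>)) T \<partial>M)"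
      unfolding set_lebesgue_integral_def using ae Cs
      by (intro integral_cong_AE) (auto intro: borel_measurable_cond_exp2)
    also have "ennreal \<dots> = (\<integral>\<^sup>+\<omega>. ennreal (indicator C \<omega> *\<^sub>R (measure (k1 (N0 \<omega>)) S * measure (k2 (N0 \<omega>)) T)) \<partial>M)"
      unfolding set_lebesgue_integral_def
      by (rule nn_integral_eq_integral[symmetric]) (rule integrable_mult_indicator[OF Cs int], auto)
    also have "\<dots> = (\<integral>\<^sup>+\<omega>. indicator B (N0 \<omega>) * (emeasure (k1 (N0 \<omega>)) S * emeasure (k2 (N0 \<omega>)) T) \<partial>M)"
      using P by (intro nn_integral_cong)
        (auto simp: C_def indicator_def finite_measure.emeasure_eq_measure prob_space.finite_measure ennreal_mult)
    also have "\<dots> = (\<integral>\<^sup>+b. indicator B b * (emeasure (k1 b) S * emeasure (k2 b) T) \<partial>distr M borel N0)"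
      by (subst nn_integral_distr) simp_all
    also have "distr M borel N0 = distr std_gauss borel n0" using g0 by (simp add: glaw_def)
    also have "(\<integral>\<^sup>+b. indicator B b * (emeasure (k1 b) S * emeasure (k2 b) T) \<partial>distr std_gauss borel n0)
      = (\<integral>\<^sup>+e0. indicator B (n0 e0) * (emeasure (k1 (n0 e0)) S * emeasure (k2 (n0 e0)) T) \<partial>std_gauss)"
      by (subst nn_integral_distr) simp_all
    also have "\<dots> = (\<integral>\<^sup>+e0. (\<integral>\<^sup>+e1. (\<integral>\<^sup>+e2. indicator B (n0 e0) * (indicator S (K1 (n0 e0) + r1 e1) * indicator T (K2 (n0 e0) + r2 e2)) \<partial>std_gauss) \<partial>std_gauss) \<partial>std_gauss)"
    proof (intro nn_integral_cong)
      fix e0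
      have 1: "emeasure (k1 b) S = (\<integral>\<^sup>+e. indicator S (K1 b + r1 e) \<partial>std_gauss)" for b
      proof -
        have "emeasure (k1 b) S = (\<integral>\<^sup>+x. indicator S x \<partial>k1 b)" by (simp add: k1_def)
        then show ?thesis unfolding k1_def by (subst (asm) nn_integral_distr) auto
      qed
      have 2: "emeasure (k2 b) T = (\<integral>\<^sup>+e. indicator T (K2 b + r2 e) \<partial>std_gauss)" for b
      proof -
        have "emeasure (k2 b) T = (\<integral>\<^sup>+x. indicator T x \<partial>k2 b)" by (simp add: k2_def)
        then show ?thesis unfolding k2_def by (subst (asm) nn_integral_distr) auto
      qed
      show "indicator B (n0 e0) * (emeasure (k1 (n0 e0)) S * emeasure (k2 (n0 e0)) T) = (\<integral>\<^sup>+e1. (\<integral>\<^sup>+e2. indicator B (n0 e0) * (indicator S (K1 (n0 e0) + r1 e1) * indicator T (K2 (n0 e0) + r2 e2)) \<partial>std_gauss) \<partial>std_gauss)"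
        by (simp add: nn_integral_cmult nn_integral_multc 1 2)
    qed
    also have "\<dots> = (\<integral>\<^sup>+x. indicator (B \<times> S \<times> T) (\<Phi> x) \<partial>(std_gauss \<Otimes>\<^sub>M (std_gauss \<Otimes>\<^sub>M std_gauss)))"
    proof -
      interpret S1: prob_space "std_gauss :: 'e measure" by (rule prob_space_std_gauss)
      interpret S2: prob_space "std_gauss :: ('e \<times> 'e) measure" by (rule prob_space_std_gauss)
      have [measurable]: "\<Phi> \<in> borel_measurable (std_gauss \<Otimes>\<^sub>M (std_gauss \<Otimes>\<^sub>M std_gauss))" unfolding std_gauss_prod_measure by measurable
      have "(\<integral>\<^sup>+x. indicator (B \<times> S \<times> T) (\<Phi> x) \<partial>(std_gauss \<Otimes>\<^sub>M (std_gauss \<Otimes>\<^sub>M std_gauss)))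
        = (\<integral>\<^sup>+e0. (\<integral>\<^sup>+y. indicator (B \<times> S \<times> T) (\<Phi> (e0, y)) \<partial>(std_gauss \<Otimes>\<^sub>M std_gauss)) \<partial>std_gauss)"
        by (subst S2.nn_integral_fst[unfolded std_gauss_prod_measure[symmetric], symmetric]) simp_all
      also have "\<dots> = (\<integral>\<^sup>+e0. (\<integral>\<^sup>+e1. (\<integral>\<^sup>+e2. indicator (B \<times> S \<times> T) (\<Phi> (e0, e1, e2)) \<partial>std_gauss) \<partial>std_gauss) \<partial>std_gauss)"
        by (intro nn_integral_cong, subst S1.nn_integral_fst[symmetric]) simp_all
      finally show ?thesis by (simp add: \<Phi>_def indicator_times mult.assoc)
    qed
    also have "\<dots> = emeasure (distr std_gauss borel \<Phi>) (B \<times> S \<times> T)"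
    proof -
      have "emeasure (distr std_gauss borel \<Phi>) (B \<times> S \<times> T) = (\<integral>\<^sup>+x. indicator (B \<times> S \<times> T) x \<partial>distr std_gauss borel \<Phi>)" by simp
      then show ?thesis unfolding std_gauss_prod_measure by (subst (asm) nn_integral_distr) auto
    qed
    finally show "emeasure (distr M borel (N0 \<star> N1 \<star> N2)) (B \<times> S \<times> T) = emeasure (distr std_gauss borel \<Phi>) (B \<times> S \<times> T)" .
  qed auto
  then have g': "glaw M (N0 \<star> N1 \<star> N2) \<Phi>" using mN l\<Phi> by (simp add: glaw_def)
  \<comment> \<open>Subtracting the regressions isolates the residuals under both representations:
    on one common source point originally, on separate copies under \<open>\<Phi>\<close>.\<close>
  define \<theta> where "\<theta> = (\<lambda>(b, b1, b2). (b1 - K1 b, b2 - K2 b))"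
  have l\<theta>: "linear \<theta>" unfolding \<theta>_def linear_iff
    by (auto simp: linear_add[OF lK(1)] linear_add[OF lK(2)] linear_scale[OF lK(1)] linear_scale[OF lK(2)] scaleR_right_diff_distrib)
  have "glaw M (\<lambda>\<omega>. (N1 \<omega> - K1 (N0 \<omega>), N2 \<omega> - K2 (N0 \<omega>))) (r1 \<star> r2)"
    using glaw_map[OF g l\<theta>]
    by (simp add: \<theta>_def K1_def K2_def r1_def r2_def resid_def prj_def linear_diff[OF l(1)] linear_diff[OF l(3)])
  moreover have "glaw M (\<lambda>\<omega>. (N1 \<omega> - K1 (N0 \<omega>), N2 \<omega> - K2 (N0 \<omega>))) (\<lambda>x::'e\<times>'e\<times>'e. (r1 (fst (snd x)), r2 (snd (snd x))))"
    using glaw_map[OF g' l\<theta>] by (simp add: \<theta>_def \<Phi>_def split_beta)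
  moreover have "orth (\<lambda>x::'e\<times>'e\<times>'e. r1 (fst (snd x))) (\<lambda>x. r2 (snd (snd x)))"
  proof -
    have "linear (\<lambda>e::'e\<times>'e. r1 (fst e))" "linear (\<lambda>e::'e\<times>'e. r2 (snd e))"
      using linear_compose[OF linear_fst lr(1)] linear_compose[OF linear_snd lr(2)] by (simp_all add: o_def)
    then show ?thesis by (rule orth_snd_snd) (rule orth_fst_snd[OF lr])
  qed
  ultimately show ?thesis unfolding r1_def[symmetric] r2_def[symmetric] by (rule glaw_orth_unique)
qed

section \<open>The update of one agent\<close>

lemma orth_prj_zero: "linear z \<Longrightarrow> orth z b \<Longrightarrow> z (prj b e) = 0"
  by (simp add: prj_def orth_pinv)

lemma stack_add: "stack (a + a') (b + b') = stack a b + stack a' b'"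
  and stack_scaleR: "stack (c *\<^sub>R a) (c *\<^sub>R b) = c *\<^sub>R stack a b"
  by (simp_all add: stack_def vec_eq_iff split: sum.split)

lemma covm_surj3:
  fixes x :: "'e::euclidean_space \<Rightarrow> complex^'x" and n :: "'e \<Rightarrow> complex^'n" and w :: "'e \<Rightarrow> complex^'w"
  assumes T: "cplx_str T" "cplx_lin T x" "cplx_lin T n" "cplx_lin T w"
    and g: "glaw M (X \<star> Y0 \<star> W) (x \<star> n \<star> w)"
    and inv: "invertible (covm M (X \<bowtie> Y0 \<bowtie> W))"
  shows "lsurj (w \<star> x \<star> n)"
proof -
  have "linear (\<lambda>(x, n, w). stack x (stack n w))"
    by (auto simp: linear_iff stack_add stack_scaleR)
  from glaw_map[OF g this] have g': "glaw M (X \<bowtie> Y0 \<bowtie> W) (\<lambda>e. stack (x e) (stack (n e) (w e)))"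
    by (simp add: stack_rv_def)
  have "lsurj (\<lambda>e. stack (x e) (stack (n e) (w e)))"
    by (rule covm_surj[OF T(1) cplx_lin_stack[OF T(2) cplx_lin_stack[OF T(3,4)]] g' inv])
  moreover have "linear (\<lambda>c. (vecr (vecr c), vecl c, vecl (vecr c)))" by (simp add: linear_iff vec_lr)
  moreover have "surj (\<lambda>c. (vecr (vecr c), vecl c, vecl (vecr c)))"
    by (rule surjI[of _ "\<lambda>(w, x, n). stack x (stack n w)"]) auto
  ultimately show ?thesis using lsurj_images by fastforce
qed

text \<open>Formulated for a generic agent, so that exchanging the roles yields both halves of the
  theorem. Independence and conditional independence enter as orthogonality of maps.\<close>

lemma gaussian_update_agent:
  fixes x :: "'e::euclidean_space \<Rightarrow> complex^'x" and n :: "'e \<Rightarrow> complex^'n"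
    and y :: "'e \<Rightarrow> complex^'y" and z :: "'e \<Rightarrow> complex^'u" and y' :: "'e \<Rightarrow> complex^'y'" and z' :: "'e \<Rightarrow> complex^'v"
  assumes M: "prob_space M"
    and T: "cplx_str T" "cplx_lin T x" "cplx_lin T n" "cplx_lin T y" "cplx_lin T y'" "cplx_lin T z" "cplx_lin T z'"
    and g: "glaw M (X \<star> Y0 \<star> Y \<star> Y' \<star> Z \<star> Z') (x \<star> n \<star> y \<star> y' \<star> z \<star> z')"
    and U: "U = (\<lambda>\<omega>. A *v Y \<omega> + Z \<omega>)" and V: "V = (\<lambda>\<omega>. A' *v Y' \<omega> + Z' \<omega>)"
    and oz: "orth z x" "orth z n" "orth z y" "orth z y'" "orth z z'"
    and oz': "orth z' x" "orth z' n" "orth z' y"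
    and oy: "orth (resid y (x \<star> n)) (resid y' (x \<star> n))"
    and inv: "invertible (covm M (X \<bowtie> Y0 \<bowtie> Y))" "invertible (covm M (X \<bowtie> Y0 \<bowtie> U))" "invertible (covm M (X \<bowtie> Y0 \<bowtie> V))"
    and s: "0 < s1" "s1 \<le> 1" "0 < s"
  shows "gaussian_update M X Y0 Y U V A s1 s"
proof -
  have l: "linear x" "linear n" "linear y" "linear y'" "linear z" "linear z'"
    using T by (auto simp: cplx_lin_def)
  define u where "u = (\<lambda>e. A *v y e + z e)"
  define v where "v = (\<lambda>e. A' *v y' e + z' e)"
  have lAy: "linear (\<lambda>e. A *v y e)" "linear (\<lambda>e. A' *v y' e)"
    using linear_compose[OF l(3) linear_matrix] linear_compose[OF l(4) linear_matrix] by (simp_all add: o_def)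
  have lu: "linear u" "linear v" unfolding u_def v_def by (intro linear_compose_add lAy l)+
  have Tu: "cplx_lin T u" "cplx_lin T v"
    using T lu unfolding cplx_lin_def by (simp_all add: u_def v_def vector_scalar_commute vector_add_ldistrib)
  define \<theta> where "\<theta> = (\<lambda>(x::complex^'x, n::complex^'n, y, y', z, z'). (x, A' *v y' + z', n, y, A *v y + z))"
  have "linear \<theta>"
    unfolding \<theta>_def linear_iff
    by (auto simp: matrix_vector_right_distrib matrix_scaleR_apply scaleR_right_distrib)
  from glaw_map[OF g this] have gU: "glaw M (X \<star> V \<star> Y0 \<star> Y \<star> U) (x \<star> v \<star> n \<star> y \<star> u)"
    by (simp add: \<theta>_def U V u_def v_def)
  have gs: "glaw M (X \<star> Y0 \<star> Y) (x \<star> n \<star> y)"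
     "glaw M (X \<star> Y0 \<star> U) (x \<star> n \<star> u)"
     "glaw M (X \<star> Y0 \<star> V) (x \<star> n \<star> v)"
    using glaw_map[OF gU, of "\<lambda>(x, v, n, y, u). (x, n, y)"] glaw_map[OF gU, of "\<lambda>(x, v, n, y, u). (x, n, u)"]
      glaw_map[OF gU, of "\<lambda>(x, v, n, y, u). (x, n, v)"]
    by (simp_all add: linear_iff split_beta)
  let ?b = "\<lambda>e. (x e, n e)"
  have sy: "lsurj (y \<star> ?b)" and su: "lsurj (u \<star> ?b)" and sv: "lsurj (v \<star> ?b)"
    by (rule covm_surj3[OF T(1,2,3,4) gs(1) inv(1)], rule covm_surj3[OF T(1,2,3) Tu(1) gs(2) inv(2)],
        rule covm_surj3[OF T(1,2,3) Tu(2) gs(3) inv(3)])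
  have sb: "lsurj ?b" using lsurj_pairD(2)[OF sy] .
  have lb: "linear ?b" by (rule linear_pair[OF l(1,2)])
  have ozb: "orth z ?b" and ozb': "orth z' ?b"
    by (rule orth_pair_right[OF l(1,2) oz(1,2)], rule orth_pair_right[OF l(1,2) oz'(1,2)])
  have ozv: "orth z v" unfolding v_def
    by (rule orth_add_right[OF l(5) lAy(2) l(6) orth_comp_right[OF l(4) linear_matrix oz(4)] oz(5)])
  have resid_u: "resid u b = (\<lambda>e. A *v resid y b e + z e)" if "orth z b" for b :: "'e \<Rightarrow> 'bb::euclidean_space"
    using orth_prj_zero[OF l(5) that] by (auto simp: fun_eq_iff resid_def u_def linear_diff[OF l(5)])
  have resid_v: "resid v b = (\<lambda>e. A' *v resid y' b e + z' e)" if "orth z' b" for b :: "'e \<Rightarrow> 'bb::euclidean_space"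
    using orth_prj_zero[OF l(6) that] by (auto simp: fun_eq_iff resid_def v_def linear_diff[OF l(6)])
  note lr = resid_linear[OF l(3) sb] resid_linear[OF l(4) sb]
  have lAr: "linear (\<lambda>e. A *v resid y ?b e)" "linear (\<lambda>e. A' *v resid y' ?b e)"
    using linear_compose[OF lr(1) linear_matrix] linear_compose[OF lr(2) linear_matrix] by (simp_all add: o_def)
  have oyv: "orth (resid y ?b) (resid v ?b)"
    unfolding resid_v[OF ozb']
  proof (rule orth_add_right[OF lr(1) lAr(2) l(6) orth_comp_right[OF lr(2) linear_matrix oy]])
    show "orth (resid y ?b) z'" using orth_resid[OF l(6) l(3) sb oz'(3) ozb'] by (rule orth_sym[THEN iffD1])
  qed
  have ouv: "orth (resid u ?b) (resid v ?b)"
    unfolding resid_u[OF ozb]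
    by (rule orth_add[OF lAr(1) l(5) orth_comp[OF lr(1) linear_matrix oyv] orth_resid[OF l(5) lu(2) sb ozv ozb]])
  have "lsurj (y \<star> v \<star> ?b)" by (rule lsurj_cond_pair[OF sy sv oyv])
  then have sY: "lsurj (x \<star> y \<star> v \<star> n)"
    using lsurj_images[of "\<lambda>e. (y e, v e, ?b e)" "\<lambda>(y, v, x, n). (x, y, v, n)"] by (simp add: linear_iff split_beta surj_def)
  have "lsurj (u \<star> v \<star> ?b)" by (rule lsurj_cond_pair[OF su sv ouv])
  then have sU: "lsurj (x \<star> u \<star> v \<star> n)"
    using lsurj_images[of "\<lambda>e. (u e, v e, ?b e)" "\<lambda>(u, v, x, n). (x, u, v, n)"] by (simp add: linear_iff split_beta surj_def)
  have sxvn: "lsurj (x \<star> v \<star> n)"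
    using lsurj_images[OF sU, of "\<lambda>(x, u, v, n). (x, v, n)"] by (simp add: linear_iff split_beta surj_def)
  \<comment> \<open>Given (X, Y0), U and V are uncorrelated, so V contributes nothing to the
    prediction of U; the order of the blocks is exchanged through the common kernel.\<close>
  have ci: "u (prj (x \<star> v \<star> n) e) = u (prj ?b e)" for e
  proof -
    have "prj (x \<star> v \<star> n) e = prj (v \<star> ?b) e"
      by (rule prj_cong_kernel[OF sxvn sv]) (auto simp: zero_prod_def)
    then show ?thesis using prj_cond_orth[OF sv lu(1) ouv] by simp
  qed
  \<comment> \<open>The channel noise is uncorrelated with the conditioning vector, so its
    prediction vanishes.\<close>
  have Ap: "u (prj b e) = A *v y (prj b e)" if "orth z b" for b :: "'e \<Rightarrow> 'bb::euclidean_space" and e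
    using orth_prj_zero[OF l(5) that] by (simp add: u_def)
  show ?thesis
    by (rule gaussian_update_gauss[OF M T(1,2) Tu(2) T(3,4) Tu(1) gU sY sU ci
        Ap[OF ozb] Ap[OF orth_pair_right[OF lu(2) l(2) ozv oz(2)]] Ap[OF oz(2)] s])
qed

text \<open>Once X is known, subtracting its contributions changes neither the conditioning nor the
  residual, and X, uncorrelated with the noises, then drops out. This carries the conditional
  independence of the noises given \<open>N0\<close> over to the observations given (X, Y0).\<close>

lemma resid_shift:
  assumes "lsurj (y1 \<star> x \<star> y0)" "linear n0" "linear n1" "linear h0" "linear h1"
    and y: "y0 = (\<lambda>e. h0 (x e) + n0 e)" "y1 = (\<lambda>e. h1 (x e) + n1 e)"
    and o: "orth x n0" "orth n1 x"
  shows "resid y1 (x \<star> y0) = resid n1 n0" "lsurj (n1 \<star> n0)"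
proof -
  have sb: "lsurj (x \<star> y0)" by (rule lsurj_pairD(2)[OF assms(1)])
  have sx: "lsurj x" by (rule lsurj_pairD(1)[OF sb])
  note lx = lsurj_linear[OF sx]
  \<comment> \<open>An invertible shear from observations to noises; it transports
    nonsingularity.\<close>
  define \<theta> where "\<theta> = (\<lambda>(p, q, r). (p - h1 q, q, r - h0 q))"
  have "linear \<theta>" unfolding \<theta>_def linear_iff
    by (auto simp: linear_add[OF assms(4)] linear_add[OF assms(5)] linear_scale[OF assms(4)] linear_scale[OF assms(5)] scaleR_right_diff_distrib)
  moreover have "surj \<theta>"
    by (rule surjI[of _ "\<lambda>(p, q, r). (p + h1 q, q, r + h0 q)"]) (auto simp: \<theta>_def)
  ultimately have s3: "lsurj (n1 \<star> x \<star> n0)"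
    using lsurj_images[OF assms(1), of \<theta>] by (simp add: \<theta>_def y)
  then show "lsurj (n1 \<star> n0)"
    using lsurj_images[OF s3, of "\<lambda>(n1, x, n0). (n1, n0)"] by (simp add: linear_iff split_beta surj_def)
  have sxn: "lsurj (x \<star> n0)" by (rule lsurj_pairD(2)[OF s3])
  have sn: "lsurj n0" by (rule lsurj_pairD(2)[OF sxn])
  have p: "prj (x \<star> y0) e = prj (x \<star> n0) e" for e
    by (rule prj_cong_kernel[OF sb sxn]) (auto simp: zero_prod_def y linear_0[OF assms(4)])
  have rx: "resid x n0 = x"
    using orth_prj_zero[OF lx o(1)] by (auto simp: fun_eq_iff resid_def linear_diff[OF lx])
  have p': "prj (x \<star> n0) e = prj x e + prj n0 e" for e
    unfolding prj_pair[OF sxn] rx ..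
  have nx: "n1 (prj x e) = 0" for e by (rule orth_prj_zero[OF assms(3) o(2)])
  show "resid y1 (x \<star> y0) = resid n1 n0"
  proof
    fix e
    have "x (e - (prj x e + prj n0 e)) = 0"
      using prj_right[OF sx, of e] orth_prj_zero[OF lx o(1), of e] by (simp add: linear_diff[OF lx] linear_add[OF lx])
    then show "resid y1 (x \<star> y0) e = resid n1 n0 e"
      unfolding resid_def p p' using nx[of e]
      by (simp add: y linear_0[OF assms(5)] linear_diff[OF assms(3)] linear_add[OF assms(3)])
  qed
qed

section \<open>Representing the whole model on one source\<close>

lemma complex_gaussian_glaw:
  fixes A :: "'w \<Rightarrow> complex^'a"
  assumes "A \<in> borel_measurable M" "complex_gaussian (distr M borel A) 0 \<Sigma>"
  shows "\<exists>L :: complex^'a^'a. glaw M A (\<lambda>w. L *v w)"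
proof -
  obtain L :: "complex^'a^'a" where "distr M borel A = distr std_complex_gaussian borel (\<lambda>w. 0 + L *v w)"
    using assms(2) unfolding complex_gaussian_def by blast
  then show ?thesis using assms(1) linear_matrix[of L]
    by (intro exI[of _ L]) (simp add: glaw_def std_complex_gaussian_eq)
qed

theorem mainTheorem6:
  fixes M :: "'w measure"
    and X :: "'w \<Rightarrow> complex^'nx"
    and N0 Y0 :: "'w \<Rightarrow> complex^'n0"
    and N1 Y1 :: "'w \<Rightarrow> complex^'n1"
    and N2 Y2 :: "'w \<Rightarrow> complex^'n2"
    and Z1 U1 :: "'w \<Rightarrow> complex^'m1"
    and Z2 U2 :: "'w \<Rightarrow> complex^'m2"
    and H0 :: "complex^'nx^'n0" and H1 :: "complex^'nx^'n1" and H2 :: "complex^'nx^'n2"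
    and A1 :: "complex^'n1^'m1" and A2 :: "complex^'n2^'m2"
    and \<Sigma> :: "complex^('nx + 'n0 + 'n1 + 'n2)^('nx + 'n0 + 'n1 + 'n2)"
    and \<Sigma>x :: "complex^'nx^'nx"
    and \<Sigma>0 :: "complex^'n0^'n0" and \<Sigma>1 :: "complex^'n1^'n1" and \<Sigma>2 :: "complex^'n2^'n2"
    and \<Sigma>z1 :: "complex^'m1^'m1" and \<Sigma>z2 :: "complex^'m2^'m2"
    and s1 s2 :: real
  assumes "prob_space M"
    and "X \<in> borel_measurable M"
    and "N0 \<in> borel_measurable M" "N1 \<in> borel_measurable M" "N2 \<in> borel_measurable M"
    and "Z1 \<in> borel_measurable M" "Z2 \<in> borel_measurable M"
    and "Y0 = (\<lambda>\<omega>. H0 *v X \<omega> + N0 \<omega>)"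
    and "Y1 = (\<lambda>\<omega>. H1 *v X \<omega> + N1 \<omega>)"
    and "Y2 = (\<lambda>\<omega>. H2 *v X \<omega> + N2 \<omega>)"
    and "complex_gaussian (distr M borel (X \<bowtie> Y0 \<bowtie> Y1 \<bowtie> Y2)) 0 \<Sigma>"
    and "complex_gaussian (distr M borel X) 0 \<Sigma>x"
    and "complex_gaussian (distr M borel N0) 0 \<Sigma>0"
    and "complex_gaussian (distr M borel N1) 0 \<Sigma>1"
    and "complex_gaussian (distr M borel N2) 0 \<Sigma>2"
    and "indep_rv M X N0" "indep_rv M X N1" "indep_rv M X N2"
    and "cond_indep_rv M N1 N2 N0"
    and "complex_gaussian (distr M borel Z1) 0 \<Sigma>z1"
    and "complex_gaussian (distr M borel Z2) 0 \<Sigma>z2"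
    and "indep_rv M Z1 (\<lambda>\<omega>. (Z2 \<omega>, X \<omega>, Y0 \<omega>, Y1 \<omega>, Y2 \<omega>))"
    and "indep_rv M Z2 (\<lambda>\<omega>. (X \<omega>, Y0 \<omega>, Y1 \<omega>, Y2 \<omega>))"
    and "U1 = (\<lambda>\<omega>. A1 *v Y1 \<omega> + Z1 \<omega>)"
    and "U2 = (\<lambda>\<omega>. A2 *v Y2 \<omega> + Z2 \<omega>)"
    and "invertible (covm M (X \<bowtie> Y0 \<bowtie> Y1))" "invertible (covm M (X \<bowtie> Y0 \<bowtie> Y2))"
    and "invertible (covm M (X \<bowtie> Y0 \<bowtie> U1))" "invertible (covm M (X \<bowtie> Y0 \<bowtie> U2))"
    and "0 < s1" "s1 \<le> 1" "0 < s2"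
  shows "gaussian_update M X Y0 Y1 U1 U2 A1 s1 s1 \<and> gaussian_update M X Y0 Y2 U2 U1 A2 s1 s2"
proof -
  note M = assms(1)
  note [measurable] = assms(2-7)
  have Ym: "Y0 \<in> borel_measurable M" "Y1 \<in> borel_measurable M" "Y2 \<in> borel_measurable M"
    unfolding assms(8-10)
    by (intro borel_measurable_add assms(3-5) measurable_compose[OF assms(2) borel_measurable_linear[OF linear_matrix]])+
  note [measurable] = Ym
  let ?C = "X \<bowtie> Y0 \<bowtie> Y1 \<bowtie> Y2"
  define \<theta> where "\<theta> = (\<lambda>(a :: complex^'nx, b :: complex^'n0, c :: complex^'n1, d :: complex^'n2). stack a (stack b (stack c d)))"
  have l\<theta>: "linear \<theta>" by (auto simp: \<theta>_def linear_iff stack_add stack_scaleR)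
  note m\<theta>[measurable] = borel_measurable_linear[OF l\<theta>]
  have C\<theta>: "?C = (\<lambda>\<omega>. \<theta> (X \<omega>, Y0 \<omega>, Y1 \<omega>, Y2 \<omega>))" by (simp add: stack_rv_def \<theta>_def)
  have Cm[measurable]: "?C \<in> borel_measurable M" unfolding C\<theta> by measurable
  obtain L :: "complex^('nx + 'n0 + 'n1 + 'n2)^('nx + 'n0 + 'n1 + 'n2)" where gC: "glaw M ?C (\<lambda>w. L *v w)" using complex_gaussian_glaw[OF Cm assms(11)] by blast
  obtain L1 :: "complex^'m1^'m1" where gZ1: "glaw M Z1 (\<lambda>w. L1 *v w)" using complex_gaussian_glaw[OF assms(6) assms(20)] by blast
  obtain L2 :: "complex^'m2^'m2" where gZ2: "glaw M Z2 (\<lambda>w. L2 *v w)" using complex_gaussian_glaw[OF assms(7) assms(21)] by blast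
  have gZC: "glaw M (Z2 \<star> ?C) (\<lambda>e. (L2 *v fst e, L *v snd e))"
  proof (rule glaw_indep[OF M gZ2 gC])
    fix S :: "(complex^'m2) set" and Q :: "(complex^('nx + 'n0 + 'n1 + 'n2)) set" assume S: "S \<in> sets borel" and Q: "Q \<in> sets borel"
    \<comment> \<open>Independence is assumed for tuples, while the Gaussian law is that of the
      stacked vector; events pass between them by preimages under stacking.\<close>
    have "\<theta> -` Q \<in> sets borel" using measurable_sets_borel[OF m\<theta> Q] by simp
    from indep_rv_prob[OF M assms(23) S this]
    show "emeasure M {\<omega> \<in> space M. Z2 \<omega> \<in> S \<and> ?C \<omega> \<in> Q}
      = emeasure M {\<omega> \<in> space M. Z2 \<omega> \<in> S} * emeasure M {\<omega> \<in> space M. ?C \<omega> \<in> Q}"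
      unfolding C\<theta> by simp
  qed
  have gZZC: "glaw M (Z1 \<star> Z2 \<star> ?C) (\<lambda>e. (L1 *v fst e, L2 *v fst (snd e), L *v snd (snd e)))"
  proof (rule glaw_indep[OF M gZ1 gZC])
    fix S :: "(complex^'m1) set" and Q :: "((complex^'m2) \<times> (complex^('nx + 'n0 + 'n1 + 'n2))) set" assume S: "S \<in> sets borel" and Q: "Q \<in> sets borel"
    define \<theta>' where "\<theta>' = (\<lambda>(z :: complex^'m2, p). (z, \<theta> p))"
    have l': "linear \<theta>'" using l\<theta> by (auto simp: \<theta>'_def linear_iff)
    have "\<theta>' -` Q \<in> sets borel" by (rule measurable_sets_borel[OF borel_measurable_linear[OF l']]) (rule Q)
    from indep_rv_prob[OF M assms(22) S this]
    show "emeasure M {\<omega> \<in> space M. Z1 \<omega> \<in> S \<and> (Z2 \<omega>, ?C \<omega>) \<in> Q}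
      = emeasure M {\<omega> \<in> space M. Z1 \<omega> \<in> S} * emeasure M {\<omega> \<in> space M. (Z2 \<omega>, ?C \<omega>) \<in> Q}"
      unfolding C\<theta> by (simp add: \<theta>'_def)
  qed
  define T where "T = (\<lambda>e :: (complex^'m1) \<times> (complex^'m2) \<times> (complex^('nx + 'n0 + 'n1 + 'n2)). (\<i> *s fst e, \<i> *s fst (snd e), \<i> *s snd (snd e)))"
  have ii: "\<i> *s (\<i> *s a) = - a" "(\<i> *s a) \<bullet> (\<i> *s b) = a \<bullet> b" "\<i> *s (r *\<^sub>R a) = r *\<^sub>R (\<i> *s a)" for r and a b :: "complex^'k"
    by (simp_all add: vec_eq_iff inner_vec_def inner_complex_def add.commute)
  have T: "cplx_str T" by (auto simp: cplx_str_def T_def linear_iff ii vector_add_ldistrib)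
  have li: "linear (\<lambda>w. L1 *v w)" "linear (\<lambda>w. L2 *v w)" "linear (\<lambda>w. L *v w)" by (rule linear_matrix)+
  \<comment> \<open>Splitting \<open>w\<close> through the last two source blocks exposes both
    independences: \<open>z1\<close> uses the first block, and \<open>z2\<close> and
    \<open>q\<close> use different components of the rest.\<close>
  define q where "q = (\<lambda>e :: (complex^'m2) \<times> (complex^('nx + 'n0 + 'n1 + 'n2)). L *v snd e)"
  define w where "w = (\<lambda>e :: (complex^'m1) \<times> (complex^'m2) \<times> (complex^('nx + 'n0 + 'n1 + 'n2)). q (snd e))"
  define x where "x = (\<lambda>e. vecl (w e))"
  define y0 where "y0 = (\<lambda>e. vecl (vecr (w e)))"
  define y1 where "y1 = (\<lambda>e. vecl (vecr (vecr (w e))))"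
  define y2 where "y2 = (\<lambda>e. vecr (vecr (vecr (w e))))"
  define z1 where "z1 = (\<lambda>e :: (complex^'m1) \<times> (complex^'m2) \<times> (complex^('nx + 'n0 + 'n1 + 'n2)). L1 *v fst e)"
  define z2 where "z2 = (\<lambda>e :: (complex^'m1) \<times> (complex^'m2) \<times> (complex^('nx + 'n0 + 'n1 + 'n2)). L2 *v fst (snd e))"
  note defs = x_def y0_def y1_def y2_def z1_def z2_def w_def q_def
  have Tc: "cplx_lin T x" "cplx_lin T y0" "cplx_lin T y1" "cplx_lin T y2" "cplx_lin T z1" "cplx_lin T z2"
    by (auto simp: cplx_lin_def T_def defs linear_iff matrix_vector_right_distrib matrix_scaleR_apply vec_lr vector_scalar_commute)
  have l: "linear x" "linear y0" "linear y1" "linear y2" "linear z1" "linear z2" using Tc by (auto simp: cplx_lin_def)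
  define \<Theta> where "\<Theta> = (\<lambda>(a :: complex^'m1, b :: complex^'m2, c :: complex^('nx + 'n0 + 'n1 + 'n2)).
    (vecl c, vecl (vecr c), vecl (vecr (vecr c)), vecr (vecr (vecr c)), a, b))"
  have "linear \<Theta>" by (auto simp: \<Theta>_def linear_iff vec_lr)
  from glaw_map[OF gZZC this]
  have g: "glaw M (X \<star> Y0 \<star> Y1 \<star> Y2 \<star> Z1 \<star> Z2) (x \<star> y0 \<star> y1 \<star> y2 \<star> z1 \<star> z2)"
    by (simp add: \<Theta>_def stack_rv_def defs)
  have g': "glaw M (X \<star> Y0 \<star> Y2 \<star> Y1 \<star> Z2 \<star> Z1) (x \<star> y0 \<star> y2 \<star> y1 \<star> z2 \<star> z1)"
    using glaw_map[OF g, of "\<lambda>(x, n, y, y', z, z'). (x, n, y', y, z', z)"] by (simp add: linear_iff split_beta)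
  have oz1: "orth z1 x" "orth z1 y0" "orth z1 y1" "orth z1 y2" "orth z1 z2"
    unfolding defs
    by (rule orth_fst_snd[OF li(1)]; simp add: linear_iff matrix_vector_right_distrib matrix_scaleR_apply vec_lr)+
  have oz2': "orth z2 (\<lambda>e. P (q (snd e)))" if P: "linear P" for P :: "complex^('nx + 'n0 + 'n1 + 'n2) \<Rightarrow> complex^'k"
  proof -
    have lP: "linear (\<lambda>w. P (L *v w))" using linear_compose[OF li(3) P] by (simp add: o_def)
    have "linear (\<lambda>e :: (complex^'m2) \<times> (complex^('nx + 'n0 + 'n1 + 'n2)). L2 *v fst e)" "linear (\<lambda>e. P (q e))"
      using linear_compose[OF linear_fst li(2)] linear_compose[OF linear_snd lP] by (simp_all add: o_def q_def)
    moreover have "orth (\<lambda>e :: (complex^'m2) \<times> (complex^('nx + 'n0 + 'n1 + 'n2)). L2 *v fst e) (\<lambda>e. P (q e))"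
      unfolding q_def by (rule orth_fst_snd[OF li(2) lP])
    ultimately show ?thesis unfolding z2_def by (rule orth_snd_snd)
  qed
  have oz2: "orth z2 x" "orth z2 y0" "orth z2 y1" "orth z2 y2"
    unfolding x_def y0_def y1_def y2_def w_def
    using oz2'[of vecl] oz2'[of "\<lambda>c. vecl (vecr c)"] oz2'[of "\<lambda>c. vecl (vecr (vecr c))"] oz2'[of "\<lambda>c. vecr (vecr (vecr c))"]
    by (simp_all add: linear_iff vec_lr)
  \<comment> \<open>The noises are linear functions of the joint vector and so live on the same
    source; their separate Gaussian laws do not provide a joint representation with X.\<close>
  define n0 where "n0 = (\<lambda>e. y0 e - H0 *v x e)"
  define n1 where "n1 = (\<lambda>e. y1 e - H1 *v x e)"
  define n2 where "n2 = (\<lambda>e. y2 e - H2 *v x e)"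
  define \<Xi> where "\<Xi> = (\<lambda>(a :: complex^'nx, b, c, d, z :: complex^'m1, z' :: complex^'m2). (a, b - H0 *v a, c - H1 *v a, d - H2 *v a))"
  have "linear \<Xi>" by (auto simp: \<Xi>_def linear_iff matrix_vector_right_distrib matrix_scaleR_apply scaleR_right_diff_distrib)
  from glaw_map[OF g this] have gN: "glaw M (X \<star> N0 \<star> N1 \<star> N2) (x \<star> n0 \<star> n1 \<star> n2)"
    by (simp add: \<Xi>_def n0_def n1_def n2_def assms(8-10))
  have gX: "glaw M (X \<star> N0) (x \<star> n0)" "glaw M (X \<star> N1) (x \<star> n1)"
    "glaw M (X \<star> N2) (x \<star> n2)" "glaw M (N0 \<star> N1 \<star> N2) (n0 \<star> n1 \<star> n2)"
    "glaw M N0 n0" "glaw M N1 n1" "glaw M N2 n2"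
    using glaw_map[OF gN, of "\<lambda>(x, n0, n1, n2). (x, n0)"] glaw_map[OF gN, of "\<lambda>(x, n0, n1, n2). (x, n1)"]
      glaw_map[OF gN, of "\<lambda>(x, n0, n1, n2). (x, n2)"] glaw_map[OF gN, of "\<lambda>(x, n0, n1, n2). (n0, n1, n2)"]
      glaw_map[OF gN, of "\<lambda>(x, n0, n1, n2). n0"] glaw_map[OF gN, of "\<lambda>(x, n0, n1, n2). n1"] glaw_map[OF gN, of "\<lambda>(x, n0, n1, n2). n2"]
    by (simp_all add: linear_iff split_beta)
  have ln: "linear n0" "linear n1" "linear n2" using gX(5-7) by (auto simp: glaw_def)
  have ox: "orth x n0" "orth n1 x" "orth n2 x"
    using indep_orth[OF M gX(1) assms(16)] indep_orth[OF M gX(2) assms(17)] indep_orth[OF M gX(3) assms(18)]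
    by (simp_all add: orth_sym[of _ x])
  have g1: "glaw M (X \<star> Y0 \<star> Y1) (x \<star> y0 \<star> y1)" and g2: "glaw M (X \<star> Y0 \<star> Y2) (x \<star> y0 \<star> y2)"
    using glaw_map[OF g, of "\<lambda>(x, n, y, y', z, z'). (x, n, y)"] glaw_map[OF g, of "\<lambda>(x, n, y, y', z, z'). (x, n, y')"]
    by (simp_all add: linear_iff split_beta)
  have s1: "lsurj (y1 \<star> x \<star> y0)" and s2: "lsurj (y2 \<star> x \<star> y0)"
    by (rule covm_surj3[OF T Tc(1,2,3) g1 assms(26)], rule covm_surj3[OF T Tc(1,2,4) g2 assms(27)])
  have yn: "y0 = (\<lambda>e. H0 *v x e + n0 e)" "y1 = (\<lambda>e. H1 *v x e + n1 e)" "y2 = (\<lambda>e. H2 *v x e + n2 e)"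
    by (simp_all add: n0_def n1_def n2_def)
  note r1 = resid_shift[OF s1 ln(1,2) linear_matrix linear_matrix yn(1,2) ox(1,2)]
  note r2 = resid_shift[OF s2 ln(1,3) linear_matrix linear_matrix yn(1,3) ox(1,3)]
  have o12: "orth (resid y1 (x \<star> y0)) (resid y2 (x \<star> y0))"
    unfolding r1(1) r2(1) by (rule cond_indep_orth[OF M gX(4) r1(2) r2(2) assms(19)])
  have o21: "orth (resid y2 (x \<star> y0)) (resid y1 (x \<star> y0))" by (rule orth_sym[THEN iffD1, OF o12])
  have "gaussian_update M X Y0 Y1 U1 U2 A1 s1 s1"
    by (rule gaussian_update_agent[OF M T Tc(1,2,3,4,5,6) g assms(24,25) oz1 oz2(1,2,3) o12 assms(26,28,29,30,31,30)])
  moreover have "gaussian_update M X Y0 Y2 U2 U1 A2 s1 s2"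
  proof (rule gaussian_update_agent[OF M T Tc(1,2,4,3,6,5) g' assms(25,24) oz2(1,2,4,3) _ oz1(1,2,4) o21 assms(27,29,28) assms(30-32)])
    show "orth z2 z1" by (rule orth_sym[THEN iffD1, OF oz1(5)])
  qed
  ultimately show ?thesis ..
qed

end
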